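(* Suppose $w:A$ is a proof term of $\mathsf{LC}_2$ whose free proof variables are among $x_1^{A_1},\dots,x_n^{A_n}$. Let $\alpha_1,\dots,\alpha_k$ be individual variables and $r_1,\dots,r_k$ terms of $\mathcal L^2$; let $X_1,\dots,X_m$ be predicate variables and $\mathcal B_1,\dots,\mathcal B_m$ realizability opponents of types $\lambda\beta_1B_1,\dots,\lambda\beta_mB_m$, with associated opponent predicate constants $\dot{\mathcal B}_1,\dots,\dot{\mathcal B}_m$. For every formula $C$ set $\overline C:=C[r_1/\alpha_1\cdots r_k/\alpha_k\ \dot{\mathcal B}_1/X_1\cdots\dot{\mathcal B}_m/X_m]$. If there are terms $t_1,\dots,t_n$ of $\mathsf{LC}_2^\star$ with $t_i\Vdash\overline{A_i}$ for $i=1,\dots,n$, then $$w[r_1/\alpha_1\cdots r_k/\alpha_k\ \lambda\beta_1B_1/X_1\cdots\lambda\beta_mB_m/X_m][t_1/x_1^{\overline{A_1}}\cdots t_n/x_n^{\overline{A_n}}]\Vdash\overline A.$$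
   Context: Language $\mathcal L^2$: terms are individual variables $\alpha,\beta,\dots$, constants and $f(m_1,\dots,m_n)$. Atomic formulas are $P(m_1,\dots,m_n)$ for predicate constants $P$ (including $0$-ary $\bot$) and $X(m)$ for predicate variables $X,Y,\dots$; formulas are built with $\wedge,\vee,\to,\forall\alpha,\exists\alpha,\forall X$. $A[\lambda\alpha B/X]$ denotes $A$ with every atomic subformula $X(m)$ replaced by $B[m/\alpha]$ (avoiding capture); $A[\dot{\mathcal B}/X]$ replaces $X$ by the predicate constant $\dot{\mathcal B}$. Proof terms of $\mathsf{LC}_2$ (Church-typed): $x^A:A$; $\langle u,t\rangle:A\wedge B$; $u\pi_0:A$, $u\pi_1:B$ from $u:A\wedge B$; $tu:B$ from $t:A\to B,u:A$; $\lambda x^Au:A\to B$ from $u:B$; $\iota_0(u),\iota_1(u):A\vee B$; $u[x^A.w_1,y^B.w_2]:C$ from $u:A\vee B$, $w_1,w_2:C$; $um:A[m/\alpha]$ from $u:\forall\alpha A$; $\lambda\alpha u:\forall\alpha A$ (eigenvariable condition); $(m,u):\exists\alpha A$ from $u:A[m/\alpha]$; $u[(\alpha,x^A).t]:C$ from $u:\exists\alpha A,t:C$ (eigenvariable condition); $u\parallel_a v:C$ from $u:C,v:C$ with $a$ of type $A\to B$ in $u$ and $B\to A$ in $v$, $\parallel_a$ binding $a$; $\mathsf{efq}_P(u):P$ from $u:\bot$, $P$ atomic; $\Lambda X\,t:\forall X A$ from $t:A$ if $X$ is not free in the types of free proof variables of $t$; $t(\lambda\alpha B):A[\lambda\alpha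 B/X]$ from $t:\forall XA$. $\mathsf{LC}_2^\star$ adds constants $\mathcal A^{A\to B}:A\to B$ for all $A,B$. Stacks: finite sequences $\sigma_1\cdot\ldots\cdot\sigma_n$ of proof terms, terms $m$, $\pi_0,\pi_1$, $[x.u,y.v]$, $[(\alpha,x).v]$, and expressions $(\lambda\alpha B)$ with $B$ a formula; $\epsilon$ empty; $t\sigma=((t\sigma_1)\ldots)\sigma_n$. Basic reductions: $(\lambda xu)t\mapsto u[t/x]$; $(\lambda\alpha u)m\mapsto u[m/\alpha]$; $(\Lambda Xu)(\lambda\alpha B)\mapsto u[\lambda\alpha B/X]$; $\langle u_0,u_1\rangle\pi_i\mapsto u_i$; $\iota_i(u)[x_0.t_0,x_1.t_1]\mapsto t_i[u/x_i]$; $(m,u)[(\alpha,x).v]\mapsto v[m/\alpha][u/x]$; $(u\parallel_a v)\xi\mapsto u\xi\parallel_a v\xi$ for $\xi$ a proof term, $\pi_i$, $[x.w_1,y.w_2]$ or $[(\alpha,x).w]$ with $a$ not free in $\xi$; $\mathcal C[a^{A\to B}u\sigma]\parallel_a v\mapsto\mathcal C[v[\lambda y^Bu/a^{B\to A}]]\parallel_a v$ and $v\parallel_a\mathcal C[a^{A\to B}u\sigma]\mapsto v\parallel_a\mathcal C[v[\lambda y^Bu/a^{B\to A}]]$, where $\mathcal C[\,]=u_1\parallel_{a_1}\cdots[\,]\cdots\parallel_{a_n}u_n$ is a parallel context, $a$ free in $\mathcal C[au\sigma]$, $y$ dummy; $\mathcal Au\sigma\mapsto u$ when $\mathcal Au\sigma$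 and $u$ have the same type. Head reduction $\succ$: writing $t=t_1\parallel_{a_1}\cdots\parallel_{a_n}t_{n+1}$ (parallel processes; elementary if not of the form $u\parallel_a v$), the head redex of $t$ is $h$ where $t=h\sigma$ with $h=r\xi$, $\xi$ one stack element and $r$ one of $\lambda xu,\lambda\alpha u,\Lambda Xu,\langle u,v\rangle,\iota_i(u),(m,u),u\parallel_a v$ ($h$ a redex), or $h=t$ if $t=u\parallel_a v$ is a redex, or $h=t=\mathcal Au\sigma$ if $u,t$ have the same type; starting symbol: the opening parenthesis of $r\xi$, resp. the leftmost occurrence of $a$ heading an elementary process $a\,s\,\rho$ of $u\parallel_a v$; $t\succ t'$ contracts the head redex with leftmost starting symbol among the head redexes of the parallel processes of $t$. $\mathsf{HN}^\star$: terms of $\mathsf{LC}_2^\star$ with no infinite $\succ$-sequence. A stack $\sigma$ is adapted to a type $C$ if $t\sigma$ is a term of $\mathsf{LC}_2^\star$ for all terms $t:C$. A realizability opponent of type $\lambda\alpha C$ is a function mapping each term $m$ of $\mathcal L^2$ to a set of stacks adapted to $C[m/\alpha]$; each such $\mathcal B$ has an associated opponent predicate constant $\dot{\mathcal B}$ of $\mathcal L^2$, of type $\lambda\alpha C$. Realizability: $t\Vdash C$ iff $t:C$ and $t\sigma\in\mathsf{HN}^\star$ for all $\sigma\in\|C\|$, where: $\|P\|=\{\epsilon\}$ for $P$ atomic (other than opponent constants); $\|\dot{\mathcal B}(m)\|=\mathcal B(m)$; $\|A\to B\|=\{u\cdot\sigma:u\Vdash A,\sigma\in\|B\|\}\cup\{\epsilon\}$;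 $\|A\wedge B\|=\{\pi_0\cdot\sigma:\sigma\in\|A\|\}\cup\{\pi_1\cdot\sigma:\sigma\in\|B\|\}\cup\{\epsilon\}$; $\|A\vee B\|=\{[x.u,y.v]\cdot\sigma:\forall t\,((t\Vdash A\Rightarrow u[t/x]\sigma\in\mathsf{HN}^\star)\wedge(t\Vdash B\Rightarrow v[t/y]\sigma\in\mathsf{HN}^\star))\}\cup\{\epsilon\}$; $\|\forall\alpha A\|=\{m\cdot\sigma:\sigma\in\|A[m/\alpha]\|\}\cup\{\epsilon\}$; $\|\exists\alpha A\|=\{[(\alpha,x).v]\cdot\sigma:\forall m\,\forall t\,(t\Vdash A[m/\alpha]\Rightarrow v[m/\alpha][t/x]\sigma\in\mathsf{HN}^\star)\}\cup\{\epsilon\}$; $\|\forall XA\|=\{(\lambda\alpha B)\cdot\sigma:\sigma\in\|A[\dot{\mathcal B}/X]\|$ for some realizability opponent $\mathcal B$ of type $\lambda\alpha B\}\cup\{\epsilon\}$.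
   Formalization: Opponent constants do not occur in proof terms or stacks (cardinality forbids it); t : C means t has the type got from C by replacing each opponent constant by its type; LC_2^* has efq at all formulas, not only atomic ones; stacks in ||A∨B|| and ||∃αA|| must be adapted. *)

theory Defs
  imports Main
begin

text \<open>
  Individual variables, predicate variables and proof variables are de Bruijn indices, in three
  independent name spaces; dangling indices are the free variables.  A predicate abstraction
  \<open>\<lambda>\<alpha> B\<close> is represented by the formula \<open>B\<close> in which the individual index \<open>0\<close> stands for \<open>\<alpha>\<close>.
\<close>

section \<open>The language\<close>

datatype 'f tm = V nat | F 'f "'f tm list"

datatype ('f, 'p) fm =
    Bot
  | Pr 'p "'f tm list"
  | PV nat "'f tm"
  | And "('f, 'p) fm" "('f, 'p) fm"
  | Or "('f, 'p) fm" "('f, 'p) fm"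
  | Imp "('f, 'p) fm" "('f, 'p) fm"
  | All "('f, 'p) fm"
  | Ex "('f, 'p) fm"
  | AllP "('f, 'p) fm"

primrec atomic :: "('f, 'p) fm \<Rightarrow> bool" where
  "atomic Bot = True"
| "atomic (Pr p ms) = True"
| "atomic (PV X m) = True"
| "atomic (And A B) = False"
| "atomic (Or A B) = False"
| "atomic (Imp A B) = False"
| "atomic (All A) = False"
| "atomic (Ex A) = False"
| "atomic (AllP A) = False"

primrec tsub :: "(nat \<Rightarrow> 'f tm) \<Rightarrow> 'f tm \<Rightarrow> 'f tm" where
  "tsub \<rho> (V i) = \<rho> i"
| "tsub \<rho> (F f ms) = F f (map (tsub \<rho>) ms)"

definition up :: "(nat \<Rightarrow> 'f tm) \<Rightarrow> nat \<Rightarrow> 'f tm" where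
  "up \<rho> = case_nat (V 0) (\<lambda>i. tsub (\<lambda>k. V (Suc k)) (\<rho> i))"

primrec fsubi :: "(nat \<Rightarrow> 'f tm) \<Rightarrow> ('f, 'p) fm \<Rightarrow> ('f, 'p) fm" where
  "fsubi \<rho> Bot = Bot"
| "fsubi \<rho> (Pr p ms) = Pr p (map (tsub \<rho>) ms)"
| "fsubi \<rho> (PV X m) = PV X (tsub \<rho> m)"
| "fsubi \<rho> (And A B) = And (fsubi \<rho> A) (fsubi \<rho> B)"
| "fsubi \<rho> (Or A B) = Or (fsubi \<rho> A) (fsubi \<rho> B)"
| "fsubi \<rho> (Imp A B) = Imp (fsubi \<rho> A) (fsubi \<rho> B)"
| "fsubi \<rho> (All A) = All (fsubi (up \<rho>) A)"
| "fsubi \<rho> (Ex A) = Ex (fsubi (up \<rho>) A)"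
| "fsubi \<rho> (AllP A) = AllP (fsubi \<rho> A)"

abbreviation finst :: "('f, 'p) fm \<Rightarrow> 'f tm \<Rightarrow> ('f, 'p) fm" where
  "finst A m \<equiv> fsubi (case_nat m V) A"

primrec frenp :: "(nat \<Rightarrow> nat) \<Rightarrow> ('f, 'p) fm \<Rightarrow> ('f, 'p) fm" where
  "frenp g Bot = Bot"
| "frenp g (Pr p ms) = Pr p ms"
| "frenp g (PV X m) = PV (g X) m"
| "frenp g (And A B) = And (frenp g A) (frenp g B)"
| "frenp g (Or A B) = Or (frenp g A) (frenp g B)"
| "frenp g (Imp A B) = Imp (frenp g A) (frenp g B)"
| "frenp g (All A) = All (frenp g A)"
| "frenp g (Ex A) = Ex (frenp g A)"
| "frenp g (AllP A) = AllP (frenp (case_nat 0 (\<lambda>X. Suc (g X))) A)"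

abbreviation ishift :: "('f, 'p) fm \<Rightarrow> ('f, 'p) fm" where
  "ishift \<equiv> fsubi (\<lambda>i. V (Suc i))"

abbreviation pshift :: "('f, 'p) fm \<Rightarrow> ('f, 'p) fm" where
  "pshift \<equiv> frenp Suc"

abbreviation PVar :: "nat \<Rightarrow> ('f, 'p) fm" where
  "PVar X \<equiv> PV X (V 0)"

text \<open>A predicate substitution maps each predicate variable to (the body of) an abstraction
  \<open>\<lambda>\<alpha> B\<close>.  The next two functions move it under an individual and under a predicate binder; the
  first one leaves \<open>\<alpha>\<close>, the index \<open>0\<close> of the body, alone.\<close>

definition upi :: "(nat \<Rightarrow> ('f, 'p) fm) \<Rightarrow> nat \<Rightarrow> ('f, 'p) fm" where
  "upi S X = fsubi (case_nat (V 0) (\<lambda>i. V (Suc (Suc i)))) (S X)"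

definition upp :: "(nat \<Rightarrow> ('f, 'p) fm) \<Rightarrow> nat \<Rightarrow> ('f, 'p) fm" where
  "upp S = case_nat (PVar 0) (\<lambda>X. pshift (S X))"

text \<open>Simultaneous substitution for individual and predicate variables.\<close>

primrec fsub :: "(nat \<Rightarrow> 'f tm) \<Rightarrow> (nat \<Rightarrow> ('f, 'p) fm) \<Rightarrow> ('f, 'p) fm \<Rightarrow> ('f, 'p) fm" where
  "fsub \<rho> S Bot = Bot"
| "fsub \<rho> S (Pr p ms) = Pr p (map (tsub \<rho>) ms)"
| "fsub \<rho> S (PV X m) = finst (S X) (tsub \<rho> m)"
| "fsub \<rho> S (And A B) = And (fsub \<rho> S A) (fsub \<rho> S B)"
| "fsub \<rho> S (Or A B) = Or (fsub \<rho> S A) (fsub \<rho> S B)"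
| "fsub \<rho> S (Imp A B) = Imp (fsub \<rho> S A) (fsub \<rho> S B)"
| "fsub \<rho> S (All A) = All (fsub (up \<rho>) (upi S) A)"
| "fsub \<rho> S (Ex A) = Ex (fsub (up \<rho>) (upi S) A)"
| "fsub \<rho> S (AllP A) = AllP (fsub \<rho> (upp S) A)"

abbreviation fpinst :: "('f, 'p) fm \<Rightarrow> ('f, 'p) fm \<Rightarrow> ('f, 'p) fm" where
  "fpinst A B \<equiv> fsub V (case_nat B PVar) A"

section \<open>Proof terms\<close>

text \<open>All eliminations are postfix applications \<open>El u \<xi>\<close> of a term to a stack element \<open>\<xi>\<close>.
  Injections, existential pairs and \<open>Par\<close> carry the formulas that Church typing leaves implicit,
  so that a term determines its type.  In \<open>Par A B u v\<close> (the term \<open>u \<parallel>\<^sub>a v\<close>) the proof index \<open>0\<close>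
  of both \<open>u\<close> and \<open>v\<close> is \<open>a\<close>, of type \<open>A \<rightarrow> B\<close> in \<open>u\<close> and \<open>B \<rightarrow> A\<close> in \<open>v\<close>.  \<open>Abort A B\<close> is the
  constant \<open>\<A>\<close> of type \<open>A \<rightarrow> B\<close>.\<close>

datatype ('f, 'p) trm =
    Var nat
  | Lam "('f, 'p) fm" "('f, 'p) trm"
  | Pair "('f, 'p) trm" "('f, 'p) trm"
  | Inj0 "('f, 'p) fm" "('f, 'p) trm"
  | Inj1 "('f, 'p) fm" "('f, 'p) trm"
  | ILam "('f, 'p) trm"
  | Pack "('f, 'p) fm" "'f tm" "('f, 'p) trm"
  | Par "('f, 'p) fm" "('f, 'p) fm" "('f, 'p) trm" "('f, 'p) trm"
  | Efq "('f, 'p) fm" "('f, 'p) trm"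
  | PLam "('f, 'p) trm"
  | Abort "('f, 'p) fm" "('f, 'p) fm"
  | El "('f, 'p) trm" "('f, 'p) elm"
and ('f, 'p) elm =
    Arg "('f, 'p) trm"
  | Ind "'f tm"
  | Proj0
  | Proj1
  | Cases "('f, 'p) fm" "('f, 'p) trm" "('f, 'p) fm" "('f, 'p) trm"
  | ExCase "('f, 'p) fm" "('f, 'p) trm"
  | Prd "('f, 'p) fm"

type_synonym ('f, 'p) stack = "('f, 'p) elm list"

definition apps :: "('f, 'p) trm \<Rightarrow> ('f, 'p) stack \<Rightarrow> ('f, 'p) trm" where
  "apps t \<sigma> = foldl El t \<sigma>"

text \<open>Free proof variables.\<close>

primrec fpv :: "('f, 'p) trm \<Rightarrow> nat set" and fpve :: "('f, 'p) elm \<Rightarrow> nat set" where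
  "fpv (Var i) = {i}"
| "fpv (Lam A t) = {i. Suc i \<in> fpv t}"
| "fpv (Pair t u) = fpv t \<union> fpv u"
| "fpv (Inj0 A t) = fpv t"
| "fpv (Inj1 A t) = fpv t"
| "fpv (ILam t) = fpv t"
| "fpv (Pack A m t) = fpv t"
| "fpv (Par A B t u) = {i. Suc i \<in> fpv t \<union> fpv u}"
| "fpv (Efq A t) = fpv t"
| "fpv (PLam t) = fpv t"
| "fpv (Abort A B) = {}"
| "fpv (El t \<xi>) = fpv t \<union> fpve \<xi>"
| "fpve (Arg t) = fpv t"
| "fpve (Ind m) = {}"
| "fpve Proj0 = {}"
| "fpve Proj1 = {}"
| "fpve (Cases A t B u) = {i. Suc i \<in> fpv t \<union> fpv u}"
| "fpve (ExCase A t) = {i. Suc i \<in> fpv t}"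
| "fpve (Prd B) = {}"

text \<open>Renaming of proof variables.\<close>

abbreviation upr :: "(nat \<Rightarrow> nat) \<Rightarrow> nat \<Rightarrow> nat" where
  "upr g \<equiv> case_nat 0 (\<lambda>i. Suc (g i))"

primrec pren :: "(nat \<Rightarrow> nat) \<Rightarrow> ('f, 'p) trm \<Rightarrow> ('f, 'p) trm"
  and prene :: "(nat \<Rightarrow> nat) \<Rightarrow> ('f, 'p) elm \<Rightarrow> ('f, 'p) elm" where
  "pren g (Var i) = Var (g i)"
| "pren g (Lam A t) = Lam A (pren (upr g) t)"
| "pren g (Pair t u) = Pair (pren g t) (pren g u)"
| "pren g (Inj0 A t) = Inj0 A (pren g t)"
| "pren g (Inj1 A t) = Inj1 A (pren g t)"
| "pren g (ILam t) = ILam (pren g t)"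
| "pren g (Pack A m t) = Pack A m (pren g t)"
| "pren g (Par A B t u) = Par A B (pren (upr g) t) (pren (upr g) u)"
| "pren g (Efq A t) = Efq A (pren g t)"
| "pren g (PLam t) = PLam (pren g t)"
| "pren g (Abort A B) = Abort A B"
| "pren g (El t \<xi>) = El (pren g t) (prene g \<xi>)"
| "prene g (Arg t) = Arg (pren g t)"
| "prene g (Ind m) = Ind m"
| "prene g Proj0 = Proj0"
| "prene g Proj1 = Proj1"
| "prene g (Cases A t B u) = Cases A (pren (upr g) t) B (pren (upr g) u)"
| "prene g (ExCase A t) = ExCase A (pren (upr g) t)"
| "prene g (Prd B) = Prd B"

text \<open>Simultaneous substitution for individual and predicate variables in proof terms.  In
  \<open>Prd B\<close>, \<open>Pack A m t\<close> and \<open>ExCase A t\<close> the formula \<open>B\<close>, respectively \<open>A\<close>, is in the scope of an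
  individual binder.\<close>

primrec psubt :: "(nat \<Rightarrow> 'f tm) \<Rightarrow> (nat \<Rightarrow> ('f, 'p) fm) \<Rightarrow> ('f, 'p) trm \<Rightarrow> ('f, 'p) trm"
  and psubte :: "(nat \<Rightarrow> 'f tm) \<Rightarrow> (nat \<Rightarrow> ('f, 'p) fm) \<Rightarrow> ('f, 'p) elm \<Rightarrow> ('f, 'p) elm" where
  "psubt \<rho> S (Var i) = Var i"
| "psubt \<rho> S (Lam A t) = Lam (fsub \<rho> S A) (psubt \<rho> S t)"
| "psubt \<rho> S (Pair t u) = Pair (psubt \<rho> S t) (psubt \<rho> S u)"
| "psubt \<rho> S (Inj0 A t) = Inj0 (fsub \<rho> S A) (psubt \<rho> S t)"
| "psubt \<rho> S (Inj1 A t) = Inj1 (fsub \<rho> S A) (psubt \<rho> S t)"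
| "psubt \<rho> S (ILam t) = ILam (psubt (up \<rho>) (upi S) t)"
| "psubt \<rho> S (Pack A m t) = Pack (fsub (up \<rho>) (upi S) A) (tsub \<rho> m) (psubt \<rho> S t)"
| "psubt \<rho> S (Par A B t u) = Par (fsub \<rho> S A) (fsub \<rho> S B) (psubt \<rho> S t) (psubt \<rho> S u)"
| "psubt \<rho> S (Efq A t) = Efq (fsub \<rho> S A) (psubt \<rho> S t)"
| "psubt \<rho> S (PLam t) = PLam (psubt \<rho> (upp S) t)"
| "psubt \<rho> S (Abort A B) = Abort (fsub \<rho> S A) (fsub \<rho> S B)"
| "psubt \<rho> S (El t \<xi>) = El (psubt \<rho> S t) (psubte \<rho> S \<xi>)"
| "psubte \<rho> S (Arg t) = Arg (psubt \<rho> S t)"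
| "psubte \<rho> S (Ind m) = Ind (tsub \<rho> m)"
| "psubte \<rho> S Proj0 = Proj0"
| "psubte \<rho> S Proj1 = Proj1"
| "psubte \<rho> S (Cases A t B u) = Cases (fsub \<rho> S A) (psubt \<rho> S t) (fsub \<rho> S B) (psubt \<rho> S u)"
| "psubte \<rho> S (ExCase A t) = ExCase (fsub (up \<rho>) (upi S) A) (psubt (up \<rho>) (upi S) t)"
| "psubte \<rho> S (Prd B) = Prd (fsub (up \<rho>) (upi S) B)"

text \<open>Simultaneous substitution for proof variables, and how it moves under the three kinds of
  binders.\<close>

abbreviation up_pf :: "(nat \<Rightarrow> ('f, 'p) trm) \<Rightarrow> nat \<Rightarrow> ('f, 'p) trm" where
  "up_pf \<theta> \<equiv> case_nat (Var 0) (\<lambda>i. pren Suc (\<theta> i))"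

abbreviation up_ind :: "(nat \<Rightarrow> ('f, 'p) trm) \<Rightarrow> nat \<Rightarrow> ('f, 'p) trm" where
  "up_ind \<theta> \<equiv> \<lambda>i. psubt (\<lambda>k. V (Suc k)) PVar (\<theta> i)"

abbreviation up_prd :: "(nat \<Rightarrow> ('f, 'p) trm) \<Rightarrow> nat \<Rightarrow> ('f, 'p) trm" where
  "up_prd \<theta> \<equiv> \<lambda>i. psubt V (\<lambda>X. PVar (Suc X)) (\<theta> i)"

primrec psub :: "(nat \<Rightarrow> ('f, 'p) trm) \<Rightarrow> ('f, 'p) trm \<Rightarrow> ('f, 'p) trm"
  and psube :: "(nat \<Rightarrow> ('f, 'p) trm) \<Rightarrow> ('f, 'p) elm \<Rightarrow> ('f, 'p) elm" where
  "psub \<theta> (Var i) = \<theta> i"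
| "psub \<theta> (Lam A t) = Lam A (psub (up_pf \<theta>) t)"
| "psub \<theta> (Pair t u) = Pair (psub \<theta> t) (psub \<theta> u)"
| "psub \<theta> (Inj0 A t) = Inj0 A (psub \<theta> t)"
| "psub \<theta> (Inj1 A t) = Inj1 A (psub \<theta> t)"
| "psub \<theta> (ILam t) = ILam (psub (up_ind \<theta>) t)"
| "psub \<theta> (Pack A m t) = Pack A m (psub \<theta> t)"
| "psub \<theta> (Par A B t u) = Par A B (psub (up_pf \<theta>) t) (psub (up_pf \<theta>) u)"
| "psub \<theta> (Efq A t) = Efq A (psub \<theta> t)"
| "psub \<theta> (PLam t) = PLam (psub (up_prd \<theta>) t)"
| "psub \<theta> (Abort A B) = Abort A B"
| "psub \<theta> (El t \<xi>) = El (psub \<theta> t) (psube \<theta> \<xi>)"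
| "psube \<theta> (Arg t) = Arg (psub \<theta> t)"
| "psube \<theta> (Ind m) = Ind m"
| "psube \<theta> Proj0 = Proj0"
| "psube \<theta> Proj1 = Proj1"
| "psube \<theta> (Cases A t B u) = Cases A (psub (up_pf \<theta>) t) B (psub (up_pf \<theta>) u)"
| "psube \<theta> (ExCase A t) = ExCase A (psub (up_pf (up_ind \<theta>)) t)"
| "psube \<theta> (Prd B) = Prd B"

abbreviation pinst :: "('f, 'p) trm \<Rightarrow> ('f, 'p) trm \<Rightarrow> ('f, 'p) trm" where
  "pinst u t \<equiv> psub (case_nat t Var) u"

abbreviation pinst_ind :: "('f, 'p) trm \<Rightarrow> 'f tm \<Rightarrow> ('f, 'p) trm" where
  "pinst_ind u m \<equiv> psubt (case_nat m V) PVar u"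

abbreviation pinst_prd :: "('f, 'p) trm \<Rightarrow> ('f, 'p) fm \<Rightarrow> ('f, 'p) trm" where
  "pinst_prd u B \<equiv> psubt V (case_nat B PVar) u"

section \<open>Typing\<close>

text \<open>A context gives the type of every free proof variable.  It is infinite, so that every
  formula can be the type of infinitely many variables \<open>x\<^sup>A\<close>, as Church typing has it.  The
  eigenvariable conditions amount to shifting the context.

  \<open>has_type False\<close> is \<open>LC\<^sub>2\<close> and \<open>has_type True\<close> is \<open>LC\<^sub>2\<^sup>\<star>\<close>.  The substitution of
  \<open>\<lambda>\<alpha> B\<close> for \<open>X\<close> turns \<open>efq\<close> at the atomic formula \<open>X(m)\<close> into \<open>efq\<close> at \<open>B[m/\<alpha>]\<close>; so
  \<open>LC\<^sub>2\<close> has \<open>efq\<close> at atomic formulas, and \<open>LC\<^sub>2\<^sup>\<star>\<close>, which has to be closed under this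
  substitution, has it at the instances of atomic formulas, that is, at all formulas.\<close>

type_synonym ('f, 'p) ctx = "nat \<Rightarrow> ('f, 'p) fm"

inductive has_type :: "bool \<Rightarrow> ('f, 'p) ctx \<Rightarrow> ('f, 'p) trm \<Rightarrow> ('f, 'p) fm \<Rightarrow> bool" for star where
  ty_var: "has_type star \<Gamma> (Var i) (\<Gamma> i)"
| ty_pair: "has_type star \<Gamma> u A \<Longrightarrow> has_type star \<Gamma> t B \<Longrightarrow> has_type star \<Gamma> (Pair u t) (And A B)"
| ty_proj0: "has_type star \<Gamma> u (And A B) \<Longrightarrow> has_type star \<Gamma> (El u Proj0) A"
| ty_proj1: "has_type star \<Gamma> u (And A B) \<Longrightarrow> has_type star \<Gamma> (El u Proj1) B"
| ty_app: "has_type star \<Gamma> t (Imp A B) \<Longrightarrow> has_type star \<Gamma> u A \<Longrightarrow> has_type star \<Gamma> (El t (Arg u)) B"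
| ty_lam: "has_type star (case_nat A \<Gamma>) u B \<Longrightarrow> has_type star \<Gamma> (Lam A u) (Imp A B)"
| ty_inj0: "has_type star \<Gamma> u A \<Longrightarrow> has_type star \<Gamma> (Inj0 B u) (Or A B)"
| ty_inj1: "has_type star \<Gamma> u B \<Longrightarrow> has_type star \<Gamma> (Inj1 A u) (Or A B)"
| ty_cases: "has_type star \<Gamma> u (Or A B) \<Longrightarrow> has_type star (case_nat A \<Gamma>) w1 C \<Longrightarrow>
    has_type star (case_nat B \<Gamma>) w2 C \<Longrightarrow> has_type star \<Gamma> (El u (Cases A w1 B w2)) C"
| ty_ind: "has_type star \<Gamma> u (All A) \<Longrightarrow> has_type star \<Gamma> (El u (Ind m)) (finst A m)"
| ty_ilam: "has_type star (\<lambda>i. ishift (\<Gamma> i)) u A \<Longrightarrow> has_type star \<Gamma> (ILam u) (All A)"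
| ty_pack: "has_type star \<Gamma> u (finst A m) \<Longrightarrow> has_type star \<Gamma> (Pack A m u) (Ex A)"
| ty_excase: "has_type star \<Gamma> u (Ex A) \<Longrightarrow>
    has_type star (case_nat A (\<lambda>i. ishift (\<Gamma> i))) t (ishift C) \<Longrightarrow>
    has_type star \<Gamma> (El u (ExCase A t)) C"
| ty_par: "has_type star (case_nat (Imp A B) \<Gamma>) u C \<Longrightarrow>
    has_type star (case_nat (Imp B A) \<Gamma>) v C \<Longrightarrow> has_type star \<Gamma> (Par A B u v) C"
| ty_efq: "has_type star \<Gamma> u Bot \<Longrightarrow> star \<or> atomic P \<Longrightarrow> has_type star \<Gamma> (Efq P u) P"
| ty_plam: "has_type star (\<lambda>i. pshift (\<Gamma> i)) t A \<Longrightarrow> has_type star \<Gamma> (PLam t) (AllP A)"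
| ty_prd: "has_type star \<Gamma> t (AllP A) \<Longrightarrow> has_type star \<Gamma> (El t (Prd B)) (fpinst A B)"
| ty_abort: "star \<Longrightarrow> has_type star \<Gamma> (Abort A B) (Imp A B)"

abbreviation LC2 :: "('f, 'p) ctx \<Rightarrow> ('f, 'p) trm \<Rightarrow> ('f, 'p) fm \<Rightarrow> bool" where
  "LC2 \<equiv> has_type False"

abbreviation LC2_star :: "('f, 'p) ctx \<Rightarrow> ('f, 'p) trm \<Rightarrow> ('f, 'p) fm \<Rightarrow> bool" where
  "LC2_star \<equiv> has_type True"

section \<open>Head reduction\<close>

text \<open>The redexes \<open>r\<xi>\<close>.  As a parallel term commutes with \<open>\<xi>\<close> only if \<open>\<xi>\<close> is a proof term, a
  projection or a case distinction, \<open>(u \<parallel>\<^sub>a v)m\<close> and \<open>(u \<parallel>\<^sub>a v)(\<lambda>\<alpha> B)\<close> are not redexes.\<close>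

primrec commuting :: "('f, 'p) elm \<Rightarrow> bool" where
  "commuting (Arg t) = True"
| "commuting (Ind m) = False"
| "commuting Proj0 = True"
| "commuting Proj1 = True"
| "commuting (Cases A t B u) = True"
| "commuting (ExCase A t) = True"
| "commuting (Prd B) = False"

inductive basic :: "('f, 'p) trm \<Rightarrow> ('f, 'p) trm \<Rightarrow> bool" where
  "basic (El (Lam A u) (Arg t)) (pinst u t)"
| "basic (El (ILam u) (Ind m)) (pinst_ind u m)"
| "basic (El (PLam u) (Prd B)) (pinst_prd u B)"
| "basic (El (Pair u0 u1) Proj0) u0"
| "basic (El (Pair u0 u1) Proj1) u1"
| "basic (El (Inj0 B' u) (Cases A t0 B t1)) (pinst t0 u)"
| "basic (El (Inj1 A' u) (Cases A t0 B t1)) (pinst t1 u)"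
| "basic (El (Pack A' m u) (ExCase A v)) (pinst (pinst_ind v m) u)"
| "commuting \<xi> \<Longrightarrow> basic (El (Par A B u v) \<xi>) (Par A B (El u (prene Suc \<xi>)) (El v (prene Suc \<xi>)))"

text \<open>Parallel contexts.  \<open>plug K t\<close> may capture free proof variables of \<open>t\<close>: the binders above
  the hole are the \<open>pdepth K\<close> lowest indices there.\<close>

datatype ('f, 'p) pctx =
    Hole
  | ParL "('f, 'p) fm" "('f, 'p) fm" "('f, 'p) pctx" "('f, 'p) trm"
  | ParR "('f, 'p) fm" "('f, 'p) fm" "('f, 'p) trm" "('f, 'p) pctx"

primrec plug :: "('f, 'p) pctx \<Rightarrow> ('f, 'p) trm \<Rightarrow> ('f, 'p) trm" where
  "plug Hole t = t"
| "plug (ParL A B K v) t = Par A B (plug K t) v"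
| "plug (ParR A B u K) t = Par A B u (plug K t)"

primrec pcomp :: "('f, 'p) pctx \<Rightarrow> ('f, 'p) pctx \<Rightarrow> ('f, 'p) pctx" where
  "pcomp Hole K' = K'"
| "pcomp (ParL A B K v) K' = ParL A B (pcomp K K') v"
| "pcomp (ParR A B u K) K' = ParR A B u (pcomp K K')"

primrec pdepth :: "('f, 'p) pctx \<Rightarrow> nat" where
  "pdepth Hole = 0"
| "pdepth (ParL A B K v) = Suc (pdepth K)"
| "pdepth (ParR A B u K) = Suc (pdepth K)"

primrec hole_ctx :: "('f, 'p) pctx \<Rightarrow> ('f, 'p) ctx \<Rightarrow> ('f, 'p) ctx" where
  "hole_ctx Hole \<Gamma> = \<Gamma>"
| "hole_ctx (ParL A B K v) \<Gamma> = hole_ctx K (case_nat (Imp A B) \<Gamma>)"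
| "hole_ctx (ParR A B u K) \<Gamma> = hole_ctx K (case_nat (Imp B A) \<Gamma>)"

text \<open>The order, from left to right, of the holes of two decompositions of the same term.\<close>

fun left_of :: "('f, 'p) pctx \<Rightarrow> ('f, 'p) pctx \<Rightarrow> bool" where
  "left_of (ParL _ _ K _) (ParL _ _ K' _) = left_of K K'"
| "left_of (ParR _ _ _ K) (ParR _ _ _ K') = left_of K K'"
| "left_of (ParL _ _ _ _) (ParR _ _ _ _) = True"
| "left_of _ _ = False"

text \<open>The term \<open>v[\<lambda>y\<^sup>B s/a]\<close> sent into the hole of a parallel context of depth \<open>d\<close>.  It is formed
  from the other component \<open>v\<close> of the parallel term, whose index \<open>0\<close> is \<open>a\<close> and whose other
  indices have to skip the \<open>d\<close> binders above the hole.\<close>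

definition reply :: "nat \<Rightarrow> ('f, 'p) fm \<Rightarrow> ('f, 'p) trm \<Rightarrow> ('f, 'p) trm \<Rightarrow> ('f, 'p) trm" where
  "reply d B s v = psub (case_nat (Lam B (pren Suc s)) (\<lambda>i. Var (Suc (i + d)))) v"

text \<open>\<open>head_redex \<Gamma> t K t'\<close>: some parallel process of \<open>t\<close> has a head redex whose starting symbol
  heads, or is the opening parenthesis of the head redex of, the elementary process of \<open>t\<close> at the
  hole of \<open>K\<close>; contracting it there turns \<open>t\<close> into \<open>t'\<close>.  For a redex \<open>u \<parallel>\<^sub>a v\<close> there is one
  such \<open>K\<close> for every elementary process headed by \<open>a\<close>; only the leftmost can be used by
  \<open>head_step\<close>.\<close>

inductive head_redex ::
  "('f, 'p) ctx \<Rightarrow> ('f, 'p) trm \<Rightarrow> ('f, 'p) pctx \<Rightarrow> ('f, 'p) trm \<Rightarrow> bool" for \<Gamma> where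
  hr_basic: "basic h h' \<Longrightarrow>
    head_redex \<Gamma> (plug K (apps h \<sigma>)) K (plug K (apps h' \<sigma>))"
| hr_abort: "LC2_star (hole_ctx K \<Gamma>) u C \<Longrightarrow>
    LC2_star (hole_ctx K \<Gamma>) (apps (Abort A B) (Arg u # \<sigma>)) C \<Longrightarrow>
    head_redex \<Gamma> (plug K (apps (Abort A B) (Arg u # \<sigma>))) K (plug K u)"
| hr_left: "u = plug K (apps (Var (pdepth K)) (Arg s # \<sigma>)) \<Longrightarrow>
    head_redex \<Gamma> (plug D (Par A B u v)) (pcomp D (ParL A B K v))
      (plug D (Par A B (plug K (reply (pdepth K) B s v)) v))"
| hr_right: "u = plug K (apps (Var (pdepth K)) (Arg s # \<sigma>)) \<Longrightarrow>
    head_redex \<Gamma> (plug D (Par A B v u)) (pcomp D (ParR A B v K))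
      (plug D (Par A B v (plug K (reply (pdepth K) A s v))))"

definition head_step :: "('f, 'p) ctx \<Rightarrow> ('f, 'p) trm \<Rightarrow> ('f, 'p) trm \<Rightarrow> bool" where
  "head_step \<Gamma> t t' \<longleftrightarrow> (\<exists>K. head_redex \<Gamma> t K t' \<and>
     \<not> (\<exists>K' t''. head_redex \<Gamma> t K' t'' \<and> left_of K' K))"

definition HN_star :: "('f, 'p) ctx \<Rightarrow> ('f, 'p) trm set" where
  "HN_star \<Gamma> = {t. (\<exists>A. LC2_star \<Gamma> t A) \<and>
     \<not> (\<exists>s :: nat \<Rightarrow> ('f, 'p) trm. s 0 = t \<and> (\<forall>i. head_step \<Gamma> (s i) (s (Suc i))))}"

section \<open>Realizability\<close>

definition adapted :: "('f, 'p) ctx \<Rightarrow> ('f, 'p) stack \<Rightarrow> ('f, 'p) fm \<Rightarrow> bool" where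
  "adapted \<Gamma> \<sigma> C \<longleftrightarrow> (\<forall>t. LC2_star \<Gamma> t C \<longrightarrow> (\<exists>E. LC2_star \<Gamma> (apps t \<sigma>) E))"

text \<open>An opponent is paired with the body \<open>C\<close> of its type \<open>\<lambda>\<alpha> C\<close>.\<close>

type_synonym ('f, 'p) opp = "('f, 'p) fm \<times> ('f tm \<Rightarrow> ('f, 'p) stack set)"

definition opponent :: "('f, 'p) ctx \<Rightarrow> ('f, 'p) opp \<Rightarrow> bool" where
  "opponent \<Gamma> b \<longleftrightarrow> (\<forall>m. \<forall>\<sigma>\<in>snd b m. adapted \<Gamma> \<sigma> (finst (fst b) m))"

text \<open>Formulas with opponent constants.  These constants cannot be among the predicate constants
  from which proof terms and stacks are built: by Cantor's theorem there are more opponents than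
  such constants.  They only occur in the formulas that are realized.  As the type of a proof term,
  the constant of an opponent of type \<open>\<lambda>\<alpha> C\<close>, applied to \<open>m\<close>, stands for \<open>C[m/\<alpha>]\<close>.\<close>

type_synonym ('f, 'p) ofm = "('f, 'p + ('f, 'p) opp) fm"

abbreviation opp_const :: "('f, 'p) opp \<Rightarrow> ('f, 'p) ofm" where
  "opp_const b \<equiv> Pr (Inr b) [V 0]"

text \<open>\<open>erase i j\<close> replaces the opponent constants by their types, in a formula that is in the
  scope of \<open>i\<close> individual and \<open>j\<close> predicate binders; the types live outside these binders.
  Opponent constants are only ever applied to a single term, which is the head of the list.\<close>

primrec erase :: "nat \<Rightarrow> nat \<Rightarrow> ('f, 'p) ofm \<Rightarrow> ('f, 'p) fm" where
  "erase i j Bot = Bot"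
| "erase i j (Pr P ms) = (case P of Inl p \<Rightarrow> Pr p ms
     | Inr b \<Rightarrow> fsubi (case_nat (hd ms) (\<lambda>k. V (k + i))) (frenp (\<lambda>X. X + j) (fst b)))"
| "erase i j (PV X m) = PV X m"
| "erase i j (And A B) = And (erase i j A) (erase i j B)"
| "erase i j (Or A B) = Or (erase i j A) (erase i j B)"
| "erase i j (Imp A B) = Imp (erase i j A) (erase i j B)"
| "erase i j (All A) = All (erase (Suc i) j A)"
| "erase i j (Ex A) = Ex (erase (Suc i) j A)"
| "erase i j (AllP A) = AllP (erase i (Suc j) A)"

abbreviation has_otype :: "('f, 'p) ctx \<Rightarrow> ('f, 'p) trm \<Rightarrow> ('f, 'p) ofm \<Rightarrow> bool" where
  "has_otype \<Gamma> t C \<equiv> LC2_star \<Gamma> t (erase 0 0 C)"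

text \<open>\<open>realizes_wrt \<Gamma> C Z t\<close> is \<open>t \<tturnstile> C\<close> with \<open>Z\<close> in the place of \<open>\<parallel>C\<parallel>\<close>.\<close>

definition realizes_wrt ::
  "('f, 'p) ctx \<Rightarrow> ('f, 'p) ofm \<Rightarrow> ('f, 'p) stack set \<Rightarrow> ('f, 'p) trm \<Rightarrow> bool" where
  "realizes_wrt \<Gamma> C Z t \<longleftrightarrow> has_otype \<Gamma> t C \<and> (\<forall>\<sigma>\<in>Z. apps t \<sigma> \<in> HN_star \<Gamma>)"

text \<open>A measure for the recursion on formulas, which goes through \<open>A[m/\<alpha>]\<close> and the instances of
  \<open>A\<close> with opponent constants.\<close>

primrec fsz :: "('f, 'p) fm \<Rightarrow> nat" where
  "fsz Bot = 0"
| "fsz (Pr p ms) = 0"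
| "fsz (PV X m) = 0"
| "fsz (And A B) = Suc (fsz A + fsz B)"
| "fsz (Or A B) = Suc (fsz A + fsz B)"
| "fsz (Imp A B) = Suc (fsz A + fsz B)"
| "fsz (All A) = Suc (fsz A)"
| "fsz (Ex A) = Suc (fsz A)"
| "fsz (AllP A) = Suc (fsz A)"

lemma fsz_fsubi [simp]: "fsz (fsubi \<rho> A) = fsz A"
  by (induction A arbitrary: \<rho>) auto

lemma fsz_frenp [simp]: "fsz (frenp g A) = fsz A"
  by (induction A arbitrary: g) auto

lemma fsz_fsub: "(\<And>X. fsz (S X) = 0) \<Longrightarrow> fsz (fsub \<rho> S A) = fsz A"
proof (induction A arbitrary: \<rho> S)
  case (AllP A)
  then show ?case by (simp add: upp_def split: nat.split)
qed (auto simp: upi_def)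

text \<open>The set \<open>\<parallel>C\<parallel>\<close>.  All its elements are adapted to \<open>C\<close>; for \<open>\<or>\<close> and \<open>\<exists>\<close> this has to be said,
  as otherwise the components of a case distinction could have different types.\<close>

function stacks :: "('f, 'p) ctx \<Rightarrow> ('f, 'p) ofm \<Rightarrow> ('f, 'p) stack set" where
  "stacks \<Gamma> Bot = {[]}"
| "stacks \<Gamma> (Pr (Inl p) ms) = {[]}"
| "stacks \<Gamma> (Pr (Inr b) ms) = snd b (hd ms)"
| "stacks \<Gamma> (PV X m) = {[]}"
| "stacks \<Gamma> (Imp A B) =
    {Arg u # \<sigma> | u \<sigma>. realizes_wrt \<Gamma> A (stacks \<Gamma> A) u \<and> \<sigma> \<in> stacks \<Gamma> B} \<union> {[]}"
| "stacks \<Gamma> (And A B) =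
    {Proj0 # \<sigma> | \<sigma>. \<sigma> \<in> stacks \<Gamma> A} \<union> {Proj1 # \<sigma> | \<sigma>. \<sigma> \<in> stacks \<Gamma> B} \<union> {[]}"
| "stacks \<Gamma> (Or A B) =
    {Cases (erase 0 0 A) u (erase 0 0 B) v # \<sigma> | u v \<sigma>.
      adapted \<Gamma> (Cases (erase 0 0 A) u (erase 0 0 B) v # \<sigma>) (erase 0 0 (Or A B)) \<and>
      (\<forall>t. (realizes_wrt \<Gamma> A (stacks \<Gamma> A) t \<longrightarrow> apps (pinst u t) \<sigma> \<in> HN_star \<Gamma>) \<and>
           (realizes_wrt \<Gamma> B (stacks \<Gamma> B) t \<longrightarrow> apps (pinst v t) \<sigma> \<in> HN_star \<Gamma>))} \<union> {[]}"
| "stacks \<Gamma> (All A) = {Ind m # \<sigma> | m \<sigma>. \<sigma> \<in> stacks \<Gamma> (finst A m)} \<union> {[]}"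
| "stacks \<Gamma> (Ex A) =
    {ExCase (erase 1 0 A) v # \<sigma> | v \<sigma>.
      adapted \<Gamma> (ExCase (erase 1 0 A) v # \<sigma>) (erase 0 0 (Ex A)) \<and>
      (\<forall>m t. realizes_wrt \<Gamma> (finst A m) (stacks \<Gamma> (finst A m)) t \<longrightarrow>
         apps (pinst (pinst_ind v m) t) \<sigma> \<in> HN_star \<Gamma>)} \<union> {[]}"
| "stacks \<Gamma> (AllP A) =
    {Prd (fst b) # \<sigma> | b \<sigma>. opponent \<Gamma> b \<and> \<sigma> \<in> stacks \<Gamma> (fpinst A (opp_const b))} \<union> {[]}"
  by pat_completeness auto
termination
  by (relation "measure (\<lambda>(\<Gamma>, A). fsz A)") (auto simp: fsz_fsub split: nat.split)

definition realizes :: "('f, 'p) ctx \<Rightarrow> ('f, 'p) trm \<Rightarrow> ('f, 'p) ofm \<Rightarrow> bool" where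
  "realizes \<Gamma> t C \<longleftrightarrow> has_otype \<Gamma> t C \<and> (\<forall>\<sigma>\<in>stacks \<Gamma> C. apps t \<sigma> \<in> HN_star \<Gamma>)"

section \<open>Substitutions given by lists\<close>

text \<open>\<open>asg d xs ts\<close> maps the variables \<open>xs\<close> to the corresponding \<open>ts\<close>, and any other variable \<open>x\<close>
  to \<open>d x\<close>.\<close>

definition asg :: "(nat \<Rightarrow> 'a) \<Rightarrow> nat list \<Rightarrow> 'a list \<Rightarrow> nat \<Rightarrow> 'a" where
  "asg d xs ts x = (case map_of (zip xs ts) x of None \<Rightarrow> d x | Some t \<Rightarrow> t)"

text \<open>The formula \<open>C\<close> with \<open>rs\<close> for the individual variables \<open>\<alpha>s\<close> and the constants of the
  opponents \<open>bs\<close> for the predicate variables \<open>Xs\<close>.\<close>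

definition bar :: "nat list \<Rightarrow> 'f tm list \<Rightarrow> nat list \<Rightarrow> ('f, 'p) opp list \<Rightarrow>
    ('f, 'p) fm \<Rightarrow> ('f, 'p) ofm" where
  "bar \<alpha>s rs Xs bs C = fsub (asg V \<alpha>s rs) (asg PVar Xs (map opp_const bs)) (map_fm id Inl C)"

end

theory Submission
  imports Defs
begin

text \<open>
  The crux is a parallel term \<open>u \<parallel>\<^sub>a v\<close>, with \<open>a : A \<rightarrow> B\<close> in \<open>u\<close>, applied to a stack \<open>\<sigma>\<close> that gives
  it the type \<open>D\<close>.  Put \<open>p = \<lambda>x\<^sup>A. \<A>\<^sup>D\<^sup>\<rightarrow>\<^sup>B (v\<sigma>[\<lambda>y\<^sup>B x/a])\<close>.  If \<open>x\<close> realizes \<open>A\<close>, then \<open>\<lambda>y\<^sup>B x\<close>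
  realizes \<open>B \<rightarrow> A\<close>, so \<open>v\<sigma>[\<lambda>y\<^sup>B x/a]\<close> is head normalizing by induction; hence \<open>p\<close> realizes
  \<open>A \<rightarrow> B\<close>, and \<open>u[p/a]\<sigma>\<close> is head normalizing too.  Now \<open>p s \<rho>\<close> head reduces to
  \<open>v\<sigma>[\<lambda>y\<^sup>B s/a]\<close> by a \<open>\<beta>\<close>-step and an abort, that is, to what a communication
  puts in the place of the process \<open>a s \<rho>\<close>.  So the reduction of \<open>u[p/a]\<sigma>\<close> simulates the
  reduction of the left side of \<open>u\<sigma> \<parallel>\<^sub>a v\<sigma>\<close>, which is reduced first.  Once the left side has become
  some \<open>u'\<close> without head redexes, \<open>u'[\<lambda>x\<^sup>A y/a]\<close> has none either, so
  \<open>\<lambda>y\<^sup>B. \<A>\<^sup>D\<^sup>\<rightarrow>\<^sup>A (u'[\<lambda>x\<^sup>A y/a])\<close> realizes \<open>B \<rightarrow> A\<close>, and the right side is handled in the same way.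
\<close>

section \<open>Formulas and substitution\<close>

text \<open>The obstacle is that \<open>Abort\<close> returns its argument only when the whole
  process has the type of that argument. Answers are therefore built at the type reached after the
  entire stack, and typing has to be carried through the simulation: all processes of a parallel
  term share this type. A communication copies the other component but leaves the original
  unchanged. While the left component runs, \<open>v\<close> and hence the answer substituted for
  the channel stay fixed; when the right one moves, the left one is frozen in turn. So two separate
  termination arguments suffice, never one about both sides at once. The leftmost strategy is
  defined globally, by comparing holes. The simulation needs induction on reductions inside one
  component, so the strategy is first recast as a relation defined by recursion on parallel terms,
  with a list of the partners of the channels above. For second-order quantifiers, opponents live in
  the realized formulas only, while proof terms see their erasure to types. An arbitrary instance B
  is matched by the opponent that maps m to the stacks of B at m.\<close>

lemma up_simps [simp]: "up \<rho> 0 = V 0" "up \<rho> (Suc i) = tsub (\<lambda>k. V (Suc k)) (\<rho> i)"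
  by (simp_all add: up_def)

lemma tsub_V [simp]: "tsub V m = m"
  by (induction m) (simp_all add: map_idI)

lemma tsub_tsub: "tsub \<rho> (tsub \<rho>' m) = tsub (\<lambda>i. tsub \<rho> (\<rho>' i)) m"
  by (induction m) simp_all

lemma up_V [simp]: "up V = V"
  by (simp add: fun_eq_iff up_def split: nat.split)

lemma up_tsub: "up (\<lambda>i. tsub \<rho> (\<rho>' i)) = (\<lambda>i. tsub (up \<rho>) (up \<rho>' i))"
  by (simp add: fun_eq_iff up_def tsub_tsub split: nat.split)

lemma fsubi_V [simp]: "fsubi V A = A"
  by (induction A) (simp_all add: map_idI)

lemma fsubi_fsubi: "fsubi \<rho> (fsubi \<rho>' A) = fsubi (\<lambda>i. tsub \<rho> (\<rho>' i)) A"
  by (induction A arbitrary: \<rho> \<rho>') (simp_all add: tsub_tsub up_tsub)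

lemma fsubi_frenp: "fsubi \<rho> (frenp g A) = frenp g (fsubi \<rho> A)"
  by (induction A arbitrary: \<rho> g) simp_all

lemma upr_id [simp]: "upr (\<lambda>i. i) = (\<lambda>i. i)"
  by (simp add: fun_eq_iff split: nat.split)

lemma upr_upr: "upr g (upr g' i) = upr (\<lambda>i. g (g' i)) i"
  by (simp split: nat.split)

lemma frenp_id [simp]: "frenp (\<lambda>X. X) A = A"
  by (induction A) simp_all

lemma frenp_frenp: "frenp g (frenp g' A) = frenp (\<lambda>X. g (g' X)) A"
  by (induction A arbitrary: g g') (simp_all add: upr_upr)

lemma upi_frenp: "upi (\<lambda>X. frenp g (S X)) = (\<lambda>X. frenp g (upi S X))"
  by (simp add: fun_eq_iff upi_def fsubi_frenp)

lemma upp_frenp: "upp (\<lambda>X. frenp g (S X)) = (\<lambda>X. frenp (upr g) (upp S X))"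
  by (simp add: fun_eq_iff upp_def frenp_frenp split: nat.split)

lemma frenp_fsub: "frenp g (fsub \<rho> S A) = fsub \<rho> (\<lambda>X. frenp g (S X)) A"
  by (induction A arbitrary: g \<rho> S) (simp_all add: upi_frenp upp_frenp fsubi_frenp)

lemma upp_upr: "(\<lambda>X. upp S (upr g X)) = upp (\<lambda>X. S (g X))"
  by (simp add: fun_eq_iff upp_def split: nat.split)

lemma fsub_frenp: "fsub \<rho> S (frenp g A) = fsub \<rho> (\<lambda>X. S (g X)) A"
  by (induction A arbitrary: g \<rho> S) (simp_all add: upi_def[abs_def] upp_upr)

lemma fsub_fsubi: "fsub \<rho> S (fsubi \<rho>' A) = fsub (\<lambda>i. tsub \<rho> (\<rho>' i)) S A"
  by (induction A arbitrary: \<rho> \<rho>' S) (simp_all add: tsub_tsub up_tsub)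

section \<open>Instances and composition of simultaneous substitutions in formulas\<close>

lemma up_case_nat: "(\<lambda>i. tsub (case_nat m \<rho>) (up \<rho>' i)) = case_nat m (\<lambda>i. tsub \<rho> (\<rho>' i))"
  by (simp add: fun_eq_iff up_def tsub_tsub split: nat.split)

lemma tsub_case_nat:
  "(\<lambda>i. tsub \<rho> (case_nat m \<rho>' i)) = case_nat (tsub \<rho> m) (\<lambda>i. tsub \<rho> (\<rho>' i))"
  by (simp add: fun_eq_iff split: nat.split)

lemma upi_fsubi: "upi (\<lambda>X. fsubi (up \<rho>) (S X)) = (\<lambda>X. fsubi (up (up \<rho>)) (upi S X))"
proof -
  have "(\<lambda>i. tsub (case_nat (V 0) (\<lambda>i. V (Suc (Suc i)))) (up \<rho> i))
      = (\<lambda>i. tsub (up (up \<rho>)) (case_nat (V 0) (\<lambda>i. V (Suc (Suc i))) i))"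
    by (simp add: fun_eq_iff up_def tsub_tsub split: nat.split)
  then show ?thesis
    unfolding fun_eq_iff upi_def fsubi_fsubi by simp
qed

lemma upp_fsubi: "upp (\<lambda>X. fsubi (up \<rho>) (S X)) = (\<lambda>X. fsubi (up \<rho>) (upp S X))"
  by (simp add: fun_eq_iff upp_def fsubi_frenp split: nat.split)

text \<open>Index 0 of a body \<open>S X\<close> is reserved for its argument, so an outer
  substitution reaches the bodies only as \<open>up \<rho>\<close>.\<close>

lemma fsubi_fsub:
  "fsubi \<rho> (fsub \<rho>' S A) = fsub (\<lambda>i. tsub \<rho> (\<rho>' i)) (\<lambda>X. fsubi (up \<rho>) (S X)) A"
  by (induction A arbitrary: \<rho> \<rho>' S)
    (simp_all add: tsub_tsub up_tsub upi_fsubi upp_fsubi fsubi_fsubi up_case_nat tsub_case_nat)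

lemma fsubi_upi [simp]: "fsubi (up (case_nat m V)) (upi S X) = S X"
proof -
  have "(\<lambda>i. tsub (up (case_nat m V)) (case_nat (V 0) (\<lambda>i. V (Suc (Suc i))) i)) = V"
    by (simp add: fun_eq_iff up_def split: nat.split)
  then show ?thesis
    by (simp add: upi_def fsubi_fsubi)
qed

lemma finst_upi [simp]: "finst (upi S X) (V 0) = S X"
  unfolding upi_def fsubi_fsubi
  by (rule trans[OF arg_cong[where f = "\<lambda>r. fsubi r (S X)"] fsubi_V])
    (simp add: fun_eq_iff split: nat.split)

text \<open>Entering a quantifier and then instantiating it amounts to extending the environment. In
  this form the induction hypothesis for the scope of a quantifier applies to each of its
  instances.\<close>

lemma finst_fsub:
  "finst (fsub (up \<rho>) (upi S) A) m = fsub (case_nat m \<rho>) S A"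
  by (simp add: fsubi_fsub up_case_nat)

lemma fsub_finst: "fsub \<rho> S (finst A m) = finst (fsub (up \<rho>) (upi S) A) (tsub \<rho> m)"
  by (simp add: finst_fsub fsub_fsubi tsub_case_nat)

lemma upi_fsub:
  "upi (\<lambda>X. fsub (up \<rho>) (upi S) (S' X)) = (\<lambda>X. fsub (up (up \<rho>)) (upi (upi S)) (upi S' X))"
proof -
  have *: "(\<lambda>i. tsub (case_nat (V 0) (\<lambda>i. V (Suc (Suc i)))) (up \<rho> i))
      = (\<lambda>i. tsub (up (up \<rho>)) (case_nat (V 0) (\<lambda>i. V (Suc (Suc i))) i))"
    by (simp add: fun_eq_iff up_def tsub_tsub split: nat.split)
  have **: "(\<lambda>i. tsub (up (case_nat (V 0) (\<lambda>i. V (Suc (Suc i))))) (case_nat (V 0) (\<lambda>i. V (Suc (Suc i))) i))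
      = (\<lambda>i. tsub (case_nat (V 0) (\<lambda>i. V (Suc (Suc i)))) (case_nat (V 0) (\<lambda>i. V (Suc (Suc i))) i))"
    by (simp add: fun_eq_iff up_def split: nat.split)
  show ?thesis
    unfolding upi_def fsubi_fsub fsub_fsubi * fsubi_fsubi ** ..
qed

lemma upp_fsub:
  "upp (\<lambda>X. fsub (up \<rho>) (upi S) (S' X)) = (\<lambda>X. fsub (up \<rho>) (upi (upp S)) (upp S' X))"
proof
  fix X
  have "(\<lambda>Y. pshift (upi S Y)) = (\<lambda>Y. upi (upp S) (Suc Y))"
    by (simp add: upi_def upp_def fsubi_frenp)
  then show "upp (\<lambda>X. fsub (up \<rho>) (upi S) (S' X)) X = fsub (up \<rho>) (upi (upp S)) (upp S' X)"
    by (cases X) (simp_all add: upp_def upi_def frenp_fsub fsub_frenp)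
qed

lemma fsub_fsub: "fsub \<rho> S (fsub \<rho>' S' A)
    = fsub (\<lambda>i. tsub \<rho> (\<rho>' i)) (\<lambda>X. fsub (up \<rho>) (upi S) (S' X)) A"
  by (induction A arbitrary: \<rho> \<rho>' S S')
    (simp_all add: tsub_tsub up_tsub upi_fsub upp_fsub fsub_finst)

lemma upi_PVar [simp]: "upi (\<lambda>X. PVar (g X)) = (\<lambda>X. PVar (g X))"
  by (simp add: fun_eq_iff upi_def)

lemma upp_PVar: "upp (\<lambda>X. PVar (g X)) = (\<lambda>X. PVar (upr g X))"
  by (simp add: fun_eq_iff upp_def split: nat.split)

lemma upp_PVar_id [simp]: "upp PVar = PVar"
  using upp_PVar[of "\<lambda>X. X"] by simp

lemma fsub_PVar: "fsub \<rho> (\<lambda>X. PVar (g X)) A = fsubi \<rho> (frenp g A)"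
  by (induction A arbitrary: \<rho> g) (simp_all add: upp_PVar fsubi_frenp)

lemma fsub_V_PVar [simp]: "fsub \<rho> PVar A = fsubi \<rho> A"
  using fsub_PVar[of \<rho> "\<lambda>X. X"] by simp

lemma ishift_fsub: "fsub (up \<rho>) (upi S) (ishift A) = ishift (fsub \<rho> S A)"
proof -
  have "(\<lambda>X. fsubi (up (\<lambda>i. V (Suc i))) (S X)) = upi S"
    by (auto simp: upi_def up_def fun_eq_iff intro!: arg_cong[where f = "\<lambda>r. fsubi r _"]
        split: nat.split)
  then show ?thesis
    by (simp add: fsubi_fsub fsub_fsubi)
qed

lemma pshift_fsub: "fsub \<rho> (upp S) (pshift A) = pshift (fsub \<rho> S A)"
  by (simp add: frenp_fsub fsub_frenp upp_def)

lemma finst_ishift [simp]: "finst (ishift A) m = A"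
  by (simp add: fsubi_fsubi)

text \<open>The predicate analogue of \<open>up_case_nat\<close>: instantiating the variable
  reserved by \<open>upp\<close> cancels the shift of all the other bodies.\<close>

lemma fsub_case_upp: "(\<lambda>X. fsub V (upi (case_nat B PVar)) (upp S X)) = case_nat B S"
proof
  fix X
  have *: "(\<lambda>Y. upi (case_nat B PVar) (Suc Y)) = PVar"
    by (simp add: fun_eq_iff upi_def)
  have "fsubi (case_nat (V 0) (\<lambda>i. V (Suc i))) B = B"
    by (rule trans[OF arg_cong[where f = "\<lambda>r. fsubi r B"] fsubi_V])
      (simp add: fun_eq_iff split: nat.split)
  then show "fsub V (upi (case_nat B PVar)) (upp S X) = case_nat B S X"
    by (cases X)
      (simp_all add: upp_def fsub_frenp * fsubi_fsubi upi_def tsub_case_nat)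
qed

lemma fpinst_fsub: "fpinst (fsub \<rho> (upp S) A) B = fsub \<rho> (case_nat B S) A"
  unfolding fsub_fsub up_V tsub_V fsub_case_upp ..

lemma fsub_fpinst: "fsub \<rho> S (fpinst A B) = fpinst (fsub \<rho> (upp S) A) (fsub (up \<rho>) (upi S) B)"
proof -
  have "(\<lambda>X. fsub (up \<rho>) (upi S) (case_nat B PVar X)) = case_nat (fsub (up \<rho>) (upi S) B) S"
  proof
    fix X
    show "fsub (up \<rho>) (upi S) (case_nat B PVar X) = case_nat (fsub (up \<rho>) (upi S) B) S X"
      by (cases X) simp_all
  qed
  then show ?thesis
    by (simp only: fsub_fsub up_V tsub_V tsub.simps fsub_case_upp)
qed

section \<open>Substitution in proof terms\<close>

lemma upr_upr': "(\<lambda>i. upr g (upr g' i)) = upr (\<lambda>i. g (g' i))"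
  by (simp add: fun_eq_iff upr_upr)

lemma
  fixes t :: "('f, 'p) trm" and \<xi> :: "('f, 'p) elm"
  shows pren_id [simp]: "pren (\<lambda>i. i) t = t" and prene_id [simp]: "prene (\<lambda>i. i) \<xi> = \<xi>"
  by (induction t and \<xi> rule: trm.induct elm.induct) simp_all

lemma
  fixes t :: "('f, 'p) trm" and \<xi> :: "('f, 'p) elm"
  shows pren_pren: "pren g (pren g' t) = pren (\<lambda>i. g (g' i)) t"
  and prene_prene: "prene g (prene g' \<xi>) = prene (\<lambda>i. g (g' i)) \<xi>"
  by (induction t and \<xi> arbitrary: g g' and g g' rule: trm.induct elm.induct)
    (simp_all add: upr_upr')

lemma
  fixes t :: "('f, 'p) trm" and \<xi> :: "('f, 'p) elm"
  shows psubt_pren: "psubt \<rho> S (pren g t) = pren g (psubt \<rho> S t)"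
  and psubte_prene: "psubte \<rho> S (prene g \<xi>) = prene g (psubte \<rho> S \<xi>)"
  by (induction t and \<xi> arbitrary: \<rho> S g and \<rho> S g rule: trm.induct elm.induct) simp_all

lemma
  fixes t :: "('f, 'p) trm" and \<xi> :: "('f, 'p) elm"
  shows psubt_id [simp]: "psubt V PVar t = t"
  and psubte_id [simp]: "psubte V PVar \<xi> = \<xi>"
  by (induction t and \<xi> rule: trm.induct elm.induct)
    (simp_all add: upi_PVar[of "\<lambda>X. X"])

lemma
  fixes t :: "('f, 'p) trm" and \<xi> :: "('f, 'p) elm"
  shows psubt_psubt: "psubt \<rho> S (psubt \<rho>' S' t)
    = psubt (\<lambda>i. tsub \<rho> (\<rho>' i)) (\<lambda>X. fsub (up \<rho>) (upi S) (S' X)) t"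
  and psubte_psubte: "psubte \<rho> S (psubte \<rho>' S' \<xi>)
    = psubte (\<lambda>i. tsub \<rho> (\<rho>' i)) (\<lambda>X. fsub (up \<rho>) (upi S) (S' X)) \<xi>"
  by (induction t and \<xi> arbitrary: \<rho> S \<rho>' S' and \<rho> S \<rho>' S' rule: trm.induct elm.induct)
    (simp_all add: tsub_tsub up_tsub upi_fsub upp_fsub fsub_fsub)

lemma up_pf_upr: "(\<lambda>i. up_pf \<theta> (upr g i)) = up_pf (\<lambda>i. \<theta> (g i))"
  by (simp add: fun_eq_iff split: nat.split)

lemma
  fixes t :: "('f, 'p) trm" and \<xi> :: "('f, 'p) elm"
  shows psub_pren: "psub \<theta> (pren g t) = psub (\<lambda>i. \<theta> (g i)) t"
  and psube_prene: "psube \<theta> (prene g \<xi>) = psube (\<lambda>i. \<theta> (g i)) \<xi>"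
  by (induction t and \<xi> arbitrary: \<theta> g and \<theta> g rule: trm.induct elm.induct)
    (simp_all add: up_pf_upr)

lemma up_pf_pren: "(\<lambda>i. pren (upr g) (up_pf \<theta> i)) = up_pf (\<lambda>i. pren g (\<theta> i))"
  by (simp add: fun_eq_iff pren_pren split: nat.split)

lemma
  fixes t :: "('f, 'p) trm" and \<xi> :: "('f, 'p) elm"
  shows pren_psub: "pren g (psub \<theta> t) = psub (\<lambda>i. pren g (\<theta> i)) t"
  and prene_psube: "prene g (psube \<theta> \<xi>) = psube (\<lambda>i. pren g (\<theta> i)) \<xi>"
  by (induction t and \<xi> arbitrary: \<theta> g and \<theta> g rule: trm.induct elm.induct)
    (simp_all add: up_pf_pren psubt_pren)

lemma up_pf_psubt: "(\<lambda>i. psubt \<rho> S (up_pf \<theta> i)) = up_pf (\<lambda>i. psubt \<rho> S (\<theta> i))"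
  by (simp add: fun_eq_iff psubt_pren split: nat.split)

lemma fsub_ishift_body: "fsubi (up (\<lambda>i. V (Suc i))) A = fsubi (case_nat (V 0) (\<lambda>i. V (Suc (Suc i)))) A"
  by (rule arg_cong[where f = "\<lambda>r. fsubi r A"]) (simp add: fun_eq_iff up_def split: nat.split)

text \<open>With its predicate counterpart below, this is what lets substitution of formulas and
  terms pass through \<open>up_ind\<close> and \<open>up_prd\<close> when it is exchanged with
  substitution of proofs.\<close>

lemma psubt_shift_ind: "psubt (up \<rho>) (upi S) (psubt (\<lambda>k. V (Suc k)) PVar t)
    = psubt (\<lambda>k. V (Suc k)) PVar (psubt \<rho> S t)"
proof -
  have "(\<lambda>X. fsub (up (up \<rho>)) (upi (upi S)) (PVar X)) = upi S"
    by (simp add: fun_eq_iff)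
  moreover have "(\<lambda>X. fsub (up (\<lambda>k. V (Suc k))) (upi PVar) (S X)) = upi S"
    by (simp add: fun_eq_iff upi_PVar[of "\<lambda>X. X"] fsub_ishift_body upi_def)
  ultimately show ?thesis
    by (simp add: psubt_psubt)
qed

lemma psubt_shift_prd: "psubt \<rho> (upp S) (psubt V (\<lambda>X. PVar (Suc X)) t)
    = psubt V (\<lambda>X. PVar (Suc X)) (psubt \<rho> S t)"
proof -
  have "(\<lambda>X. fsub (up \<rho>) (upi (upp S)) (PVar (Suc X))) = (\<lambda>X. pshift (S X))"
    by (simp add: fun_eq_iff upp_def)
  moreover have "(\<lambda>X. fsub (up V) (upi (\<lambda>X. PVar (Suc X))) (S X)) = (\<lambda>X. pshift (S X))"
    by (simp add: fsub_PVar)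
  ultimately show ?thesis
    by (simp add: psubt_psubt)
qed

lemma
  fixes t :: "('f, 'p) trm" and \<xi> :: "('f, 'p) elm"
  shows psubt_psub: "psubt \<rho> S (psub \<theta> t) = psub (\<lambda>i. psubt \<rho> S (\<theta> i)) (psubt \<rho> S t)"
  and psubte_psube: "psubte \<rho> S (psube \<theta> \<xi>) = psube (\<lambda>i. psubt \<rho> S (\<theta> i)) (psubte \<rho> S \<xi>)"
  by (induction t and \<xi> arbitrary: \<theta> \<rho> S and \<theta> \<rho> S rule: trm.induct elm.induct)
    (simp_all add: up_pf_psubt psubt_shift_ind psubt_shift_prd)

lemma up_pf_psub: "(\<lambda>i. psub (up_pf \<theta>) (up_pf \<theta>' i)) = up_pf (\<lambda>i. psub \<theta> (\<theta>' i))"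
  by (simp add: fun_eq_iff psub_pren pren_psub split: nat.split)

lemma
  fixes t :: "('f, 'p) trm" and \<xi> :: "('f, 'p) elm"
  shows psub_psub: "psub \<theta> (psub \<theta>' t) = psub (\<lambda>i. psub \<theta> (\<theta>' i)) t"
  and psube_psube: "psube \<theta> (psube \<theta>' \<xi>) = psube (\<lambda>i. psub \<theta> (\<theta>' i)) \<xi>"
  by (induction t and \<xi> arbitrary: \<theta> \<theta>' and \<theta> \<theta>' rule: trm.induct elm.induct)
    (simp_all add: up_pf_psub psubt_psub)

lemma up_pf_Var: "case_nat (Var 0) (\<lambda>i. Var (Suc (g i))) = (\<lambda>i. Var (upr g i))"
  by (simp add: fun_eq_iff split: nat.split)

lemma
  fixes t :: "('f, 'p) trm" and \<xi> :: "('f, 'p) elm"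
  shows psub_Var: "psub (\<lambda>i. Var (g i)) t = pren g t"
  and psube_Var: "psube (\<lambda>i. Var (g i)) \<xi> = prene g \<xi>"
  by (induction t and \<xi> arbitrary: g and g rule: trm.induct elm.induct) (simp_all add: up_pf_Var)

lemma psub_Var_id [simp]: "psub Var t = t" and psube_Var_id [simp]: "psube Var \<xi> = \<xi>"
  using psub_Var[of "\<lambda>i. i"] psube_Var[of "\<lambda>i. i"] by simp_all

lemma psub_case_nat: "(\<lambda>i. psub \<theta> (case_nat t \<theta>' i)) = case_nat (psub \<theta> t) (\<lambda>i. psub \<theta> (\<theta>' i))"
  by (simp add: fun_eq_iff split: nat.split)

section \<open>Instances of proof terms\<close>

lemma psub_case_nat_up: "(\<lambda>i. psub (case_nat t \<theta>) (up_pf \<theta>' i)) = case_nat t (\<lambda>i. psub \<theta> (\<theta>' i))"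
  by (simp add: fun_eq_iff psub_pren split: nat.split)

lemma pinst_psub: "pinst (psub (up_pf \<theta>) t) s = psub (case_nat s \<theta>) t"
  by (simp add: psub_psub psub_case_nat_up)

lemma pinst_pren [simp]: "pinst (pren Suc t) s = t"
  by (simp add: psub_pren)

lemma psub_pinst: "psub \<theta> (pinst t s) = pinst (psub (up_pf \<theta>) t) (psub \<theta> s)"
  by (simp add: pinst_psub psub_psub psub_case_nat)

lemma pinst_ind_shift [simp]: "pinst_ind (psubt (\<lambda>k. V (Suc k)) PVar t) m = t"
  by (simp add: psubt_psubt)

lemma pinst_prd_shift [simp]: "pinst_prd (psubt V (\<lambda>X. PVar (Suc X)) t) B = t"
proof -
  have "(\<lambda>X. fsub (up V) (upi (case_nat B PVar)) (PVar (Suc X))) = PVar"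
    by (simp add: fun_eq_iff upi_def)
  then show ?thesis
    by (simp add: psubt_psubt)
qed

lemma psub_pinst_ind: "psub \<theta> (pinst_ind t m) = pinst_ind (psub (up_ind \<theta>) t) m"
  by (simp add: psubt_psub)

lemma psub_pinst_prd: "psub \<theta> (pinst_prd t B) = pinst_prd (psub (up_prd \<theta>) t) B"
  by (simp add: psubt_psub)

lemma pinst_ind_psubt: "pinst_ind (psubt (up \<rho>) (upi S) t) m = psubt (case_nat m \<rho>) S t"
proof -
  have "(\<lambda>X. fsub (up (case_nat m V)) (upi PVar) (upi S X)) = S"
    by (simp add: fun_eq_iff upi_PVar[of "\<lambda>X. X"])
  then show ?thesis
    by (simp add: psubt_psubt up_case_nat)
qed

lemma pinst_prd_psubt: "pinst_prd (psubt \<rho> (upp S) t) B = psubt \<rho> (case_nat B S) t"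
  by (simp add: psubt_psubt fsub_case_upp)

lemma psube_prene_Suc: "psube (up_pf \<theta>) (prene Suc \<xi>) = prene Suc (psube \<theta> \<xi>)"
  by (simp add: psube_prene prene_psube)

lemma psub_pren_Suc: "psub (up_pf \<theta>) (pren Suc t) = pren Suc (psub \<theta> t)"
  by (simp add: psub_pren pren_psub)

section \<open>Typing\<close>

inductive_cases ty_VarE [elim!]: "has_type s \<Gamma> (Var i) A"
inductive_cases ty_LamE [elim!]: "has_type s \<Gamma> (Lam B t) A"
inductive_cases ty_PairE [elim!]: "has_type s \<Gamma> (Pair t u) A"
inductive_cases ty_Inj0E [elim!]: "has_type s \<Gamma> (Inj0 B t) A"
inductive_cases ty_Inj1E [elim!]: "has_type s \<Gamma> (Inj1 B t) A"
inductive_cases ty_ILamE [elim!]: "has_type s \<Gamma> (ILam t) A"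
inductive_cases ty_PackE [elim!]: "has_type s \<Gamma> (Pack B m t) A"
inductive_cases ty_ParE [elim!]: "has_type s \<Gamma> (Par B C t u) A"
inductive_cases ty_EfqE [elim!]: "has_type s \<Gamma> (Efq B t) A"
inductive_cases ty_PLamE [elim!]: "has_type s \<Gamma> (PLam t) A"
inductive_cases ty_AbortE [elim!]: "has_type s \<Gamma> (Abort B C) A"
inductive_cases ty_ArgE [elim!]: "has_type s \<Gamma> (El t (Arg u)) A"
inductive_cases ty_IndE [elim!]: "has_type s \<Gamma> (El t (Ind m)) A"
inductive_cases ty_Proj0E [elim!]: "has_type s \<Gamma> (El t Proj0) A"
inductive_cases ty_Proj1E [elim!]: "has_type s \<Gamma> (El t Proj1) A"
inductive_cases ty_CasesE [elim!]: "has_type s \<Gamma> (El t (Cases B u C v)) A"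
inductive_cases ty_ExCaseE [elim!]: "has_type s \<Gamma> (El t (ExCase B u)) A"
inductive_cases ty_PrdE [elim!]: "has_type s \<Gamma> (El t (Prd B)) A"

lemma ishift_inject [simp]: "ishift A = ishift B \<longleftrightarrow> A = B"
  by (metis finst_ishift)

text \<open>The formulas stored in injections, pairs, parallel terms and constants make typing
  deterministic, even across the two systems. It serves to recover the type of a head from the shape
  of the element applied to it, and to decide when \<open>Abort\<close> can fire.\<close>

lemma has_type_unique: "has_type s \<Gamma> t A \<Longrightarrow> has_type s' \<Gamma> t B \<Longrightarrow> A = B"
proof (induction arbitrary: B rule: has_type.induct)
  case ty_var
  then show ?case by blast
next
  case ty_pair
  then show ?case by (metis ty_PairE)
next
  case ty_proj0
  then show ?case by (metis ty_Proj0E fm.inject)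
next
  case ty_proj1
  then show ?case by (metis ty_Proj1E fm.inject)
next
  case ty_app
  then show ?case by (metis ty_ArgE fm.inject)
next
  case ty_lam
  then show ?case by (metis ty_LamE)
next
  case ty_inj0
  then show ?case by (metis ty_Inj0E)
next
  case ty_inj1
  then show ?case by (metis ty_Inj1E)
next
  case ty_cases
  then show ?case by (metis ty_CasesE)
next
  case ty_ind
  then show ?case by (metis ty_IndE fm.inject)
next
  case ty_ilam
  then show ?case by (metis ty_ILamE)
next
  case ty_pack
  then show ?case by (metis ty_PackE)
next
  case ty_excase
  then show ?case by (metis ishift_inject ty_ExCaseE)
next
  case ty_par
  then show ?case by (metis ty_ParE)
next
  case ty_efq
  then show ?case by (metis ty_EfqE)
next
  case ty_plam
  then show ?case by (metis ty_PLamE)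
next
  case ty_prd
  then show ?case by (metis ty_PrdE fm.inject)
next
  case ty_abort
  then show ?case by blast
qed

lemma case_nat_comp: "(\<lambda>i. f (case_nat a b i)) = case_nat (f a) (\<lambda>i. f (b i))"
  by (simp add: fun_eq_iff split: nat.split)

lemma has_type_pren:
  "has_type s \<Gamma> t A \<Longrightarrow> (\<And>i. \<Delta> (g i) = \<Gamma> i) \<Longrightarrow> has_type s \<Delta> (pren g t) A"
proof (induction arbitrary: \<Delta> g rule: has_type.induct)
  case (ty_var \<Gamma> i)
  then show ?case
    by (metis has_type.ty_var pren.simps(1))
next
  case (ty_lam A \<Gamma> u B)
  then show ?case
    by (auto intro!: has_type.intros split: nat.split)
next
  case (ty_cases \<Gamma> u A B w1 C w2)
  then show ?case
    by (auto intro!: has_type.ty_cases split: nat.split)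
next
  case (ty_ilam \<Gamma> u A)
  then show ?case
    by (auto intro!: has_type.ty_ilam)
next
  case (ty_plam \<Gamma> u A)
  then show ?case
    by (auto intro!: has_type.ty_plam)
next
  case (ty_excase \<Gamma> u A t C)
  then show ?case
    by (auto intro!: has_type.ty_excase split: nat.split)
next
  case (ty_par A B \<Gamma> u C v)
  then show ?case
    by (auto intro!: has_type.ty_par split: nat.split)
next
  case (ty_app \<Gamma> t A B u)
  show ?case
    using ty_app.IH(1)[of \<Delta> g] ty_app.IH(2)[of \<Delta> g] ty_app.prems
    by (simp add: has_type.ty_app[of _ _ _ A])
qed (auto intro: has_type.intros)

lemma has_type_pren_Suc: "has_type s \<Gamma> t A \<Longrightarrow> has_type s (case_nat B \<Gamma>) (pren Suc t) A"
  by (erule has_type_pren) simp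

lemma case_nat_ishift_fsub:
  "(\<lambda>i. fsub (up \<rho>) (upi S) (case_nat A (\<lambda>i. ishift (\<Gamma> i)) i))
    = case_nat (fsub (up \<rho>) (upi S) A) (\<lambda>i. ishift (fsub \<rho> S (\<Gamma> i)))"
  by (simp add: fun_eq_iff ishift_fsub split: nat.split)

text \<open>The result lies in the larger system whatever \<open>s\<close> is, because a body put
  for a predicate variable can turn \<open>Efq\<close> at an atomic formula into \<open>Efq\<close>
  at a compound one.\<close>

lemma has_type_psubt: "has_type s \<Gamma> t A \<Longrightarrow>
    has_type True (\<lambda>i. fsub \<rho> S (\<Gamma> i)) (psubt \<rho> S t) (fsub \<rho> S A)"
proof (induction arbitrary: \<rho> S rule: has_type.induct)
  case (ty_var \<Gamma> i)
  show ?case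
    using has_type.ty_var[of True "\<lambda>i. fsub \<rho> S (\<Gamma> i)" i] by simp
next
  case (ty_lam A \<Gamma> u B)
  show ?case
    using ty_lam.IH[of \<rho> S] by (simp add: case_nat_comp has_type.ty_lam)
next
  case (ty_cases \<Gamma> u A B w1 C w2)
  show ?case
    using ty_cases.IH(1)[of \<rho> S] ty_cases.IH(2,3)[of \<rho> S]
    by (simp add: case_nat_comp has_type.ty_cases)
next
  case (ty_ind \<Gamma> u A m)
  show ?case
    using has_type.ty_ind[OF ty_ind.IH[of \<rho> S, simplified], of "tsub \<rho> m"]
    by (simp only: fsub_finst psubt.simps psubte.simps)
next
  case (ty_ilam \<Gamma> u A)
  show ?case
    using ty_ilam.IH[of "up \<rho>" "upi S"] by (simp add: ishift_fsub has_type.ty_ilam)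
next
  case (ty_pack \<Gamma> u A m)
  show ?case
    using ty_pack.IH[of \<rho> S] by (simp add: fsub_finst has_type.ty_pack)
next
  case (ty_excase \<Gamma> u A t C)
  show ?case
    using ty_excase.IH(1)[of \<rho> S] ty_excase.IH(2)[of "up \<rho>" "upi S"]
    by (simp add: case_nat_ishift_fsub ishift_fsub has_type.ty_excase)
next
  case (ty_par A B \<Gamma> u C v)
  show ?case
    using ty_par.IH[of \<rho> S] unfolding case_nat_comp by (simp add: has_type.ty_par)
next
  case (ty_plam \<Gamma> t A)
  show ?case
    using ty_plam.IH[of \<rho> "upp S"] by (simp add: pshift_fsub has_type.ty_plam)
next
  case (ty_prd \<Gamma> t A B)
  show ?case
    using has_type.ty_prd[OF ty_prd.IH[of \<rho> S, simplified], of "fsub (up \<rho>) (upi S) B"]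
    by (simp only: fsub_fpinst psubt.simps psubte.simps)
next
  case (ty_app \<Gamma> t A B u)
  show ?case
    using ty_app.IH[of \<rho> S] by (simp add: has_type.ty_app[of _ _ _ "fsub \<rho> S A"])
qed (auto intro: has_type.intros)

lemma has_type_up_ind:
  "has_type s \<Gamma> t A \<Longrightarrow> has_type True (\<lambda>i. ishift (\<Gamma> i)) (psubt (\<lambda>k. V (Suc k)) PVar t) (ishift A)"
  using has_type_psubt[of s \<Gamma> t A "\<lambda>k. V (Suc k)" PVar] by simp

lemma has_type_up_prd:
  "has_type s \<Gamma> t A \<Longrightarrow> has_type True (\<lambda>i. pshift (\<Gamma> i)) (psubt V (\<lambda>X. PVar (Suc X)) t) (pshift A)"
  using has_type_psubt[of s \<Gamma> t A V "\<lambda>X. PVar (Suc X)"] by (simp add: fsub_PVar)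

lemma has_type_up_pf:
  "(\<And>i. Suc i \<in> X \<Longrightarrow> has_type True \<Delta> (\<theta> i) (\<Gamma> i)) \<Longrightarrow> i \<in> X \<Longrightarrow>
    has_type True (case_nat A \<Delta>) (up_pf \<theta> i) (case_nat A \<Gamma> i)"
  using has_type.ty_var[of True "case_nat A \<Delta>" 0]
  by (cases i) (simp_all add: has_type_pren_Suc)

text \<open>Only the free variables of \<open>t\<close> are constrained, since realizers will be
  supplied for those alone. Under a proof binder, the membership condition is passed on with indices
  lowered by one.\<close>

lemma has_type_psub: "has_type s \<Gamma> t A \<Longrightarrow> (\<And>i. i \<in> fpv t \<Longrightarrow> has_type True \<Delta> (\<theta> i) (\<Gamma> i)) \<Longrightarrow>
    has_type True \<Delta> (psub \<theta> t) A"
proof (induction arbitrary: \<Delta> \<theta> rule: has_type.induct)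
  case (ty_app \<Gamma> t A B u)
  show ?case
    using ty_app.IH(1)[of \<Delta> \<theta>] ty_app.IH(2)[of \<Delta> \<theta>] ty_app.prems
    by (simp add: has_type.ty_app[of _ _ _ A])
next
  case (ty_lam A \<Gamma> u B)
  have "has_type True (case_nat A \<Delta>) (psub (up_pf \<theta>) u) B"
    by (rule ty_lam.IH, erule has_type_up_pf[rotated]) (simp add: ty_lam.prems)
  then show ?case
    by (simp add: has_type.ty_lam)
next
  case (ty_cases \<Gamma> u A B w1 C w2)
  have "has_type True (case_nat A \<Delta>) (psub (up_pf \<theta>) w1) C"
    by (rule ty_cases.IH(2), erule has_type_up_pf[rotated]) (simp add: ty_cases.prems)
  moreover have "has_type True (case_nat B \<Delta>) (psub (up_pf \<theta>) w2) C"
    by (rule ty_cases.IH(3), erule has_type_up_pf[rotated]) (simp add: ty_cases.prems)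
  moreover have "has_type True \<Delta> (psub \<theta> u) (Or A B)"
    by (rule ty_cases.IH(1)) (simp add: ty_cases.prems)
  ultimately show ?case
    by (simp add: has_type.ty_cases)
next
  case (ty_ilam \<Gamma> u A)
  have "has_type True (\<lambda>i. ishift (\<Delta> i)) (psub (up_ind \<theta>) u) A"
    by (rule ty_ilam.IH, rule has_type_up_ind[where s = True]) (simp add: ty_ilam.prems)
  then show ?case
    by (simp add: has_type.ty_ilam)
next
  case (ty_excase \<Gamma> u A t C)
  have "has_type True (case_nat A (\<lambda>i. ishift (\<Delta> i))) (psub (up_pf (up_ind \<theta>)) t) (ishift C)"
    by (rule ty_excase.IH(2), erule has_type_up_pf[rotated], rule has_type_up_ind[where s = True])
      (simp add: ty_excase.prems)
  moreover have "has_type True \<Delta> (psub \<theta> u) (Ex A)"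
    by (rule ty_excase.IH(1)) (simp add: ty_excase.prems)
  ultimately show ?case
    by (simp add: has_type.ty_excase)
next
  case (ty_par A B \<Gamma> u C v)
  have "has_type True (case_nat (Imp A B) \<Delta>) (psub (up_pf \<theta>) u) C"
    by (rule ty_par.IH(1), erule has_type_up_pf[rotated]) (simp add: ty_par.prems)
  moreover have "has_type True (case_nat (Imp B A) \<Delta>) (psub (up_pf \<theta>) v) C"
    by (rule ty_par.IH(2), erule has_type_up_pf[rotated]) (simp add: ty_par.prems)
  ultimately show ?case
    by (simp add: has_type.ty_par)
next
  case (ty_plam \<Gamma> t A)
  have "has_type True (\<lambda>i. pshift (\<Delta> i)) (psub (up_prd \<theta>) t) A"
    by (rule ty_plam.IH, rule has_type_up_prd[where s = True]) (simp add: ty_plam.prems)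
  then show ?case
    by (simp add: has_type.ty_plam)
qed (auto intro: has_type.intros)

section \<open>Subject reduction for basic reductions\<close>

lemma has_type_pinst:
  "has_type s (case_nat B \<Gamma>) t A \<Longrightarrow> has_type True \<Gamma> u B \<Longrightarrow> has_type True \<Gamma> (pinst t u) A"
  by (erule has_type_psub) (auto intro: has_type.ty_var split: nat.split)

lemma has_type_pinst_ind:
  "has_type s (\<lambda>i. ishift (\<Gamma> i)) t A \<Longrightarrow> has_type True \<Gamma> (pinst_ind t m) (finst A m)"
  using has_type_psubt[of s "\<lambda>i. ishift (\<Gamma> i)" t A "case_nat m V" PVar] by simp

lemma has_type_pinst_prd:
  "has_type s (\<lambda>i. pshift (\<Gamma> i)) t A \<Longrightarrow> has_type True \<Gamma> (pinst_prd t B) (fpinst A B)"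
  using has_type_psubt[of s "\<lambda>i. pshift (\<Gamma> i)" t A V "case_nat B PVar"]
  by (simp add: fsub_frenp)

text \<open>This types the commutation of a stack element with a parallel term. The term
  \<open>u\<close> records the type \<open>U\<close> that \<open>\<xi>\<close> eliminates;
  uniqueness of types then forces the formulas in \<open>\<xi>\<close> to fit every other term of
  type \<open>U\<close>, also below the channel.\<close>

lemma has_type_elm_shift: "LC2_star \<Gamma> (El u \<xi>) C \<Longrightarrow> LC2_star \<Gamma> u U \<Longrightarrow>
    LC2_star (case_nat A \<Gamma>) t U \<Longrightarrow> LC2_star (case_nat A \<Gamma>) (El t (prene Suc \<xi>)) C"
proof (cases \<xi>)
  case (Cases B u1 D u2)
  have *: "LC2_star (case_nat B (case_nat A \<Gamma>)) (pren (upr Suc) u') C"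
    if "LC2_star (case_nat B \<Gamma>) u' C" for u' B
    using that by (rule has_type_pren) (simp split: nat.split)
  assume a: "LC2_star \<Gamma> (El u \<xi>) C" "LC2_star \<Gamma> u U" "LC2_star (case_nat A \<Gamma>) t U"
  then have "U = Or B D"
    using Cases by (metis has_type_unique ty_CasesE)
  then show ?thesis
    using a Cases * by (auto intro!: has_type.ty_cases)
next
  case (ExCase B u1)
  have *: "LC2_star (case_nat B (\<lambda>i. ishift (case_nat A \<Gamma> i))) (pren (upr Suc) u') D"
    if "LC2_star (case_nat B (\<lambda>i. ishift (\<Gamma> i))) u' D" for u' D
    using that by (rule has_type_pren) (simp split: nat.split)
  assume a: "LC2_star \<Gamma> (El u \<xi>) C" "LC2_star \<Gamma> u U" "LC2_star (case_nat A \<Gamma>) t U"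
  then have "U = Ex B"
    using ExCase by (metis has_type_unique ty_ExCaseE)
  then show ?thesis
    using a ExCase * by (auto intro!: has_type.ty_excase)
qed (auto intro: has_type.intros has_type_pren_Suc dest: has_type_unique)

lemma has_type_El_head:
  "has_type s \<Gamma> (El t \<xi>) C \<Longrightarrow> \<exists>T. has_type s \<Gamma> t T"
  by (cases \<xi>) auto

lemma has_type_basic: "basic h h' \<Longrightarrow> LC2_star \<Gamma> h C \<Longrightarrow> LC2_star \<Gamma> h' C"
proof (induction rule: basic.induct)
  case (8 A' m u A v)
  then have "LC2_star (case_nat A (\<lambda>i. ishift (\<Gamma> i))) v (ishift C)" "LC2_star \<Gamma> u (finst A m)"
    by auto
  \<comment> \<open>Instantiating the eigenvariable cancels the shift of the context and of
    \<open>C\<close>, and leaves the witness hypothesis at the instance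
    \<open>finst A m\<close>.\<close>
  then have "LC2_star (case_nat (finst A m) \<Gamma>) (pinst_ind v m) C"
    using has_type_psubt[of True "case_nat A (\<lambda>i. ishift (\<Gamma> i))" v "ishift C" "case_nat m V" PVar]
    by (simp add: case_nat_comp)
  then show ?case
    using \<open>LC2_star \<Gamma> u (finst A m)\<close> by (rule has_type_pinst)
next
  case (9 \<xi> A B u v)
  obtain U where "LC2_star \<Gamma> (Par A B u v) U"
    using has_type_El_head[OF 9(2)] ..
  then show ?case
    using 9 by (auto intro!: has_type.ty_par elim!: has_type_elm_shift)
qed (auto intro: has_type_pinst has_type_pinst_ind has_type_pinst_prd)

section \<open>Terms applied to stacks\<close>

lemma apps_simps [simp]: "apps t [] = t" "apps t (\<xi> # \<sigma>) = apps (El t \<xi>) \<sigma>"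
  by (simp_all add: apps_def)

lemma apps_append: "apps t (\<sigma> @ \<tau>) = apps (apps t \<sigma>) \<tau>"
  by (simp add: apps_def)

lemma has_type_El_replace: "LC2_star \<Gamma> (El t \<xi>) C \<Longrightarrow> LC2_star \<Gamma> t T \<Longrightarrow> LC2_star \<Gamma> t' T \<Longrightarrow>
    LC2_star \<Gamma> (El t' \<xi>) C"
proof (cases \<xi>)
  case (ExCase B u1)
  assume a: "LC2_star \<Gamma> (El t \<xi>) C" "LC2_star \<Gamma> t T" "LC2_star \<Gamma> t' T"
  then have "T = Ex B"
    using ExCase by (metis has_type_unique ty_ExCaseE)
  then show ?thesis
    using a ExCase by (auto intro!: has_type.ty_excase)
next
  case (Cases B u1 D u2)
  assume a: "LC2_star \<Gamma> (El t \<xi>) C" "LC2_star \<Gamma> t T" "LC2_star \<Gamma> t' T"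
  then have "T = Or B D"
    using Cases by (metis has_type_unique ty_CasesE)
  then show ?thesis
    using a Cases by (auto intro!: has_type.ty_cases)
qed (auto intro: has_type.intros dest: has_type_unique)

lemma has_type_apps_head:
  "has_type s \<Gamma> (apps t \<sigma>) C \<Longrightarrow> \<exists>T. has_type s \<Gamma> t T"
  by (induction \<sigma> arbitrary: t) (auto dest: has_type_El_head)

lemma has_type_apps_replace: "LC2_star \<Gamma> (apps t \<sigma>) C \<Longrightarrow> LC2_star \<Gamma> t T \<Longrightarrow> LC2_star \<Gamma> t' T \<Longrightarrow>
    LC2_star \<Gamma> (apps t' \<sigma>) C"
proof (induction \<sigma> arbitrary: t t' T)
  case Nil
  then show ?case
    by (auto dest: has_type_unique)
next
  case (Cons \<xi> \<sigma>)
  obtain U where U: "LC2_star \<Gamma> (El t \<xi>) U"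
    using Cons.prems has_type_apps_head by (metis apps_simps(2))
  then have "LC2_star \<Gamma> (El t' \<xi>) U"
    using Cons.prems by (blast intro: has_type_El_replace)
  then show ?case
    using Cons U by simp
qed

section \<open>Head reduction by recursion on parallel terms\<close>

text \<open>A term can be written as \<open>apps h \<sigma>\<close> in several ways. Its head and
  spine are canonical, so two such presentations are compared through them.\<close>

fun hd_of :: "('f, 'p) trm \<Rightarrow> ('f, 'p) trm" where
  "hd_of (El t \<xi>) = hd_of t"
| "hd_of t = t"

fun sp :: "('f, 'p) trm \<Rightarrow> ('f, 'p) stack" where
  "sp (El t \<xi>) = sp t @ [\<xi>]"
| "sp t = []"

lemma hd_of_apps [simp]: "hd_of (apps t \<sigma>) = hd_of t"
  by (induction \<sigma> arbitrary: t) auto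

lemma sp_apps [simp]: "sp (apps t \<sigma>) = sp t @ \<sigma>"
  by (induction \<sigma> arbitrary: t) auto

lemma apps_hd_sp: "apps (hd_of t) (sp t) = t"
  by (induction t rule: hd_of.induct) (simp_all add: apps_append)

text \<open>A basic redex has a spine of length one and a head that is neither a variable nor a
  constant. Hence the three kinds of contraction never compete for the same process.\<close>

lemma basic_spine: "basic h h' \<Longrightarrow> \<exists>r \<xi>. h = El r \<xi> \<and> hd_of r = r \<and> sp r = [] \<and>
    (\<forall>i. r \<noteq> Var i) \<and> (\<forall>A B. r \<noteq> Abort A B)"
  by (induction rule: basic.induct) auto

lemma basic_det: "basic h a \<Longrightarrow> basic h b \<Longrightarrow> a = b"
  by (induction rule: basic.induct) (auto elim: basic.cases)

text \<open>For each channel \<open>j\<close> bound above a process, \<open>E ! j\<close> is the pair \<open>(B, v)\<close> to which \<open>reply\<close> is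
  applied: \<open>v\<close> is the other component of the parallel term that binds \<open>j\<close>, and \<open>B\<close> the conclusion
  of the type of \<open>j\<close>.\<close>

inductive contracts ::
  "('f, 'p) ctx \<Rightarrow> (('f, 'p) fm \<times> ('f, 'p) trm) list \<Rightarrow> ('f, 'p) trm \<Rightarrow> ('f, 'p) trm \<Rightarrow> bool"
  for \<Gamma> E where
  ct_basic: "basic h h' \<Longrightarrow> contracts \<Gamma> E (apps h \<sigma>) (apps h' \<sigma>)"
| ct_abort: "LC2_star \<Gamma> u C \<Longrightarrow> LC2_star \<Gamma> (apps (Abort A B) (Arg u # \<sigma>)) C \<Longrightarrow>
    contracts \<Gamma> E (apps (Abort A B) (Arg u # \<sigma>)) u"
| ct_comm: "j < length E \<Longrightarrow> E ! j = (B, v) \<Longrightarrow>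
    contracts \<Gamma> E (apps (Var j) (Arg s # \<sigma>)) (reply j B s v)"

text \<open>Whether a process can be contracted depends only on how many channels are bound above
  it, not on what their partners are. Keeping the number \<open>n\<close> in place of the partners
  makes normality independent of the other components.\<close>

definition active :: "('f, 'p) ctx \<Rightarrow> nat \<Rightarrow> ('f, 'p) trm \<Rightarrow> bool" where
  "active \<Gamma> n t \<longleftrightarrow> (\<exists>h h' \<sigma>. t = apps h \<sigma> \<and> basic h h') \<or>
    (\<exists>A B u \<sigma> C. t = apps (Abort A B) (Arg u # \<sigma>) \<and> LC2_star \<Gamma> u C \<and> LC2_star \<Gamma> t C) \<or>
    (\<exists>j<n. \<exists>s \<sigma>. t = apps (Var j) (Arg s # \<sigma>))"

lemma contracts_active: "contracts \<Gamma> E t t' \<Longrightarrow> active \<Gamma> (length E) t"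
  unfolding active_def by (induction rule: contracts.induct) blast+

lemma active_sp: "active \<Gamma> n t \<Longrightarrow> sp t \<noteq> []"
  unfolding active_def by (auto dest!: basic_spine)

lemma active_not_Par: "\<not> active \<Gamma> n (Par A B u v)"
  using active_sp by fastforce

lemma contracts_not_Par: "\<not> contracts \<Gamma> E (Par A B u v) t'"
  using contracts_active active_not_Par by blast

lemma contracts_det: "contracts \<Gamma> E t a \<Longrightarrow> contracts \<Gamma> E t b \<Longrightarrow> a = b"
proof (induction rule: contracts.induct)
  case (ct_basic h h' \<sigma>)
  obtain r \<xi> where r: "h = El r \<xi>" "hd_of r = r" "sp r = []" "\<And>i. r \<noteq> Var i" "\<And>A B. r \<noteq> Abort A B"
    using basic_spine[OF ct_basic(1)] by blast
  have hd: "hd_of (apps h \<sigma>) = r" "sp (apps h \<sigma>) = \<xi> # \<sigma>"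
    using r by auto
  from ct_basic(2) show ?case
  proof cases
    case (ct_basic g g' \<tau>)
    obtain r' \<xi>' where r': "g = El r' \<xi>'" "hd_of r' = r'" "sp r' = []"
      using basic_spine[OF ct_basic(3)] by blast
    then have "r' = r" "\<xi>' # \<tau> = \<xi> # \<sigma>"
      using hd ct_basic(1) by auto
    then show ?thesis
      using basic_det \<open>basic h h'\<close> ct_basic r r' by auto
  next
    case ct_abort
    then show ?thesis
      using hd r by auto
  next
    case ct_comm
    then show ?thesis
      using hd r by auto
  qed
next
  case (ct_abort u C A B \<sigma>)
  have hd: "hd_of (apps (Abort A B) (Arg u # \<sigma>)) = Abort A B"
    "sp (apps (Abort A B) (Arg u # \<sigma>)) = Arg u # \<sigma>"
    by simp_all
  from ct_abort(3) show ?case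
  proof cases
    case (ct_basic g g' \<tau>)
    then show ?thesis
      using basic_spine[OF ct_basic(3)] hd by auto
  next
    case ct_abort
    then show ?thesis
      using hd by auto
  next
    case ct_comm
    then show ?thesis
      using hd by auto
  qed
next
  case (ct_comm j B v s \<sigma>)
  have hd: "hd_of (apps (Var j) (Arg s # \<sigma>)) = Var j"
    "sp (apps (Var j) (Arg s # \<sigma>)) = Arg s # \<sigma>"
    by simp_all
  from ct_comm(3) show ?case
  proof cases
    case (ct_basic g g' \<tau>)
    then show ?thesis
      using basic_spine[OF ct_basic(3)] hd by auto
  next
    case ct_abort
    then show ?thesis
      using hd by auto
  next
    case (ct_comm j' B' v' s' \<sigma>')
    then show ?thesis
      using hd \<open>E ! j = (B, v)\<close> by auto
  qed
qed

text \<open>The context is a parameter because the rule for \<open>Abort\<close> compares types, and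
  the channels bound on the way contribute to them.\<close>

inductive hnf :: "('f, 'p) ctx \<Rightarrow> nat \<Rightarrow> ('f, 'p) trm \<Rightarrow> bool" where
  hnf_Par: "hnf (case_nat (Imp A B) \<Gamma>) (Suc n) u \<Longrightarrow> hnf (case_nat (Imp B A) \<Gamma>) (Suc n) v \<Longrightarrow>
    hnf \<Gamma> n (Par A B u v)"
| hnf_elem: "\<forall>A B u v. t \<noteq> Par A B u v \<Longrightarrow> \<not> active \<Gamma> n t \<Longrightarrow> hnf \<Gamma> n t"

text \<open>The leftmost strategy is built into the rules: the right component may move only when
  the left one is in head normal form, with the new channel counted among those that can
  send.\<close>

inductive hst :: "('f, 'p) ctx \<Rightarrow> (('f, 'p) fm \<times> ('f, 'p) trm) list \<Rightarrow>
    ('f, 'p) trm \<Rightarrow> ('f, 'p) trm \<Rightarrow> bool" where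
  hst_elem: "contracts \<Gamma> E t t' \<Longrightarrow> hst \<Gamma> E t t'"
| hst_left: "hst (case_nat (Imp A B) \<Gamma>) ((B, v) # E) u u' \<Longrightarrow>
    hst \<Gamma> E (Par A B u v) (Par A B u' v)"
| hst_right: "hnf (case_nat (Imp A B) \<Gamma>) (Suc (length E)) u \<Longrightarrow>
    hst (case_nat (Imp B A) \<Gamma>) ((A, u) # E) v v' \<Longrightarrow>
    hst \<Gamma> E (Par A B u v) (Par A B u v')"

lemma hnf_not_active: "hnf \<Gamma> n t \<Longrightarrow> \<not> active \<Gamma> n t"
  by (erule hnf.cases) (auto simp: active_not_Par)

inductive_cases hnf_ParE: "hnf \<Gamma> n (Par A B u v)"

lemma hnf_Par_iff: "hnf \<Gamma> n (Par A B u v) \<longleftrightarrow>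
    hnf (case_nat (Imp A B) \<Gamma>) (Suc n) u \<and> hnf (case_nat (Imp B A) \<Gamma>) (Suc n) v"
  by (blast intro: hnf_Par elim: hnf_ParE)

lemma hst_not_hnf: "hst \<Gamma> E t t' \<Longrightarrow> \<not> hnf \<Gamma> (length E) t"
  by (induction rule: hst.induct) (auto simp: hnf_Par_iff dest: contracts_active hnf_not_active)

inductive_cases hst_ParE: "hst \<Gamma> E (Par A B u v) t'"

text \<open>A parallel term is never contracted as an elementary process, and
  \<open>hst_not_hnf\<close> separates the rule for the left component from the rule for the right
  one.\<close>

lemma hst_det: "hst \<Gamma> E t a \<Longrightarrow> hst \<Gamma> E t b \<Longrightarrow> a = b"
proof (induction arbitrary: b rule: hst.induct)
  case (hst_elem \<Gamma> E t t')
  from hst_elem(2,1) show ?case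
    by cases (auto dest: contracts_det simp: contracts_not_Par)
next
  case (hst_left A B \<Gamma> v E u u')
  have "\<not> hnf (case_nat (Imp A B) \<Gamma>) (Suc (length E)) u"
    using hst_not_hnf[OF hst_left.hyps] by simp
  with hst_left.prems obtain b' where "b = Par A B b' v" "hst (case_nat (Imp A B) \<Gamma>) ((B, v) # E) u b'"
    by (elim hst_ParE) (simp_all add: contracts_not_Par)
  then show ?case
    using hst_left.IH[of b'] by simp
next
  case (hst_right A B \<Gamma> E u v v')
  have "\<not> hst (case_nat (Imp A B) \<Gamma>) ((B, v) # E) u u'" for u'
    using hst_not_hnf[of _ "(B, v) # E" u] hst_right.hyps by auto
  with hst_right.prems obtain b' where "b = Par A B u b'" "hst (case_nat (Imp B A) \<Gamma>) ((A, u) # E) v b'"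
    by (elim hst_ParE) (simp_all add: contracts_not_Par)
  then show ?case
    using hst_right.IH[of b'] by simp
qed

section \<open>Agreement with leftmost head reduction\<close>

primrec partners :: "('f, 'p) pctx \<Rightarrow> (('f, 'p) fm \<times> ('f, 'p) trm) list \<Rightarrow>
    (('f, 'p) fm \<times> ('f, 'p) trm) list" where
  "partners Hole E = E"
| "partners (ParL A B K v) E = partners K ((B, v) # E)"
| "partners (ParR A B u K) E = partners K ((A, u) # E)"

lemma length_partners [simp]: "length (partners K E) = pdepth K + length E"
  by (induction K arbitrary: E) auto

lemma partners_nth [simp]: "partners K E ! (pdepth K + i) = E ! i"
proof (induction K arbitrary: E i)
  case (ParL A B K v)
  then show ?case
    using ParL.IH[of "(B, v) # E" "Suc i"] by simp
next
  case (ParR A B u K)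
  then show ?case
    using ParR.IH[of "(A, u) # E" "Suc i"] by simp
qed simp

lemma partners_nth0 [simp]: "partners K (x # E) ! pdepth K = x"
  using partners_nth[of K "x # E" 0] by simp

lemma partners_pcomp [simp]: "partners (pcomp D K) E = partners K (partners D E)"
  by (induction D arbitrary: E) auto

lemma plug_pcomp [simp]: "plug (pcomp D K) t = plug D (plug K t)"
  by (induction D) auto

text \<open>The binder of index \<open>j\<close> sits \<open>j\<close> levels above the hole.
  Cutting the context there exhibits the parallel redex to which a communication on \<open>j\<close>
  belongs, and the side on which the hole lies.\<close>

lemma partners_split: "j < pdepth K \<Longrightarrow> partners K E ! j = (B, v) \<Longrightarrow>
    (\<exists>D A K'. K = pcomp D (ParL A B K' v) \<and> pdepth K' = j) \<or>
    (\<exists>D A K'. K = pcomp D (ParR B A v K') \<and> pdepth K' = j)"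
proof (induction K arbitrary: E)
  case Hole
  then show ?case
    by simp
next
  case (ParL A' B' K v')
  show ?case
  proof (cases "j < pdepth K")
    case True
    with ParL show ?thesis
      by (metis partners.simps(2) pcomp.simps(2))
  next
    case False
    then have "j = pdepth K"
      using ParL.prems by simp
    then have "ParL A' B' K v' = pcomp Hole (ParL A' B K v) \<and> pdepth K = j"
      using ParL.prems by simp
    then show ?thesis
      by blast
  qed
next
  case (ParR A' B' u' K)
  show ?case
  proof (cases "j < pdepth K")
    case True
    with ParR show ?thesis
      by (metis partners.simps(3) pcomp.simps(3))
  next
    case False
    then have "j = pdepth K"
      using ParR.prems by simp
    then have "ParR A' B' u' K = pcomp Hole (ParR B B' v K) \<and> pdepth K = j"
      using ParR.prems by simp
    then show ?thesis
      by blast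
  qed
qed

text \<open>The original rules locate a communication at the binder of its channel, whereas
  \<open>contracts\<close> locates it at the sending process. The two views meet because the partner
  found in the list is the sibling at that binder; starting from the empty list restricts
  communications to channels bound inside \<open>t\<close>.\<close>

lemma head_redex_iff: "head_redex \<Gamma> t K t' \<longleftrightarrow>
    (\<exists>e e'. t = plug K e \<and> t' = plug K e' \<and> contracts (hole_ctx K \<Gamma>) (partners K []) e e')"
proof
  assume "head_redex \<Gamma> t K t'"
  then show "\<exists>e e'. t = plug K e \<and> t' = plug K e' \<and> contracts (hole_ctx K \<Gamma>) (partners K []) e e'"
  proof cases
    case (hr_left u K' s \<sigma> D A B v)
    have "contracts (hole_ctx K \<Gamma>) (partners K []) (apps (Var (pdepth K')) (Arg s # \<sigma>))
        (reply (pdepth K') B s v)"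
      by (rule ct_comm) (simp_all add: hr_left)
    moreover have "t = plug K (apps (Var (pdepth K')) (Arg s # \<sigma>))"
      "t' = plug K (reply (pdepth K') B s v)"
      by (simp_all add: hr_left)
    ultimately show ?thesis
      by blast
  next
    case (hr_right u K' s \<sigma> D A B v)
    have "contracts (hole_ctx K \<Gamma>) (partners K []) (apps (Var (pdepth K')) (Arg s # \<sigma>))
        (reply (pdepth K') A s v)"
      by (rule ct_comm) (simp_all add: hr_right)
    moreover have "t = plug K (apps (Var (pdepth K')) (Arg s # \<sigma>))"
      "t' = plug K (reply (pdepth K') A s v)"
      by (simp_all add: hr_right)
    ultimately show ?thesis
      by blast
  qed (blast intro: contracts.intros)+
next
  assume "\<exists>e e'. t = plug K e \<and> t' = plug K e' \<and> contracts (hole_ctx K \<Gamma>) (partners K []) e e'"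
  then obtain e e' where t: "t = plug K e" "t' = plug K e'"
    and c: "contracts (hole_ctx K \<Gamma>) (partners K []) e e'"
    by blast
  from c show "head_redex \<Gamma> t K t'"
  proof cases
    case (ct_basic h h' \<sigma>)
    then show ?thesis
      unfolding t by (simp add: head_redex.hr_basic)
  next
    case (ct_abort C A B \<sigma>)
    then show ?thesis
      unfolding t by (metis head_redex.hr_abort)
  next
    case (ct_comm j B v s \<sigma>)
    then have "j < pdepth K"
      by simp
    then consider D A K' where "K = pcomp D (ParL A B K' v)" "pdepth K' = j"
      | D A K' where "K = pcomp D (ParR B A v K')" "pdepth K' = j"
      using partners_split ct_comm by blast
    then show ?thesis
    proof cases
      case 1
      then show ?thesis
        using head_redex.hr_left[OF refl, of \<Gamma> D A B K' s \<sigma> v] ct_comm unfolding t by simp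
    next
      case 2
      then show ?thesis
        using head_redex.hr_right[OF refl, of \<Gamma> D B A v K' s \<sigma>] ct_comm unfolding t by simp
    qed
  qed
qed

lemma active_contracts:
  assumes "active \<Gamma> (length E) t"
  shows "\<exists>t'. contracts \<Gamma> E t t'"
  using assms unfolding active_def by (metis contracts.intros surj_pair)

lemma hnf_plug: "hnf \<Gamma> n (plug K e) \<Longrightarrow> \<not> active (hole_ctx K \<Gamma>) (n + pdepth K) e"
proof (induction K arbitrary: \<Gamma> n)
  case Hole
  then show ?case
    by (simp add: hnf_not_active)
next
  case (ParL A B K v)
  then show ?case
    by (metis ParL.IH add_Suc_shift hnf_Par_iff hole_ctx.simps(2) pdepth.simps(2) plug.simps(2))
next
  case (ParR A B u K)
  then show ?case
    by (metis ParR.IH add_Suc_shift hnf_Par_iff hole_ctx.simps(3) pdepth.simps(3) plug.simps(3))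
qed

text \<open>With \<open>hnf_plug\<close> this identifies \<open>hnf\<close> with the absence of
  active processes at every hole. Decompositions whose filler is itself parallel do no harm, as such
  a filler is never active.\<close>

lemma hnfI_plug:
  "(\<And>K e. t = plug K e \<Longrightarrow> \<not> active (hole_ctx K \<Gamma>) (n + pdepth K) e) \<Longrightarrow> hnf \<Gamma> n t"
proof (induction t arbitrary: \<Gamma> n rule: measure_induct_rule[where f = size])
  case (less t)
  show ?case
  proof (cases "\<exists>A B u v. t = Par A B u v")
    case True
    then obtain A B u v where t: "t = Par A B u v"
      by blast
    have "hnf (case_nat (Imp A B) \<Gamma>) (Suc n) u"
    proof (rule less.IH)
      fix K e
      assume "u = plug K e"
      then show "\<not> active (hole_ctx K (case_nat (Imp A B) \<Gamma>)) (Suc n + pdepth K) e"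
        using less.prems[of "ParL A B K v" e] t by simp
    qed (simp add: t)
    moreover have "hnf (case_nat (Imp B A) \<Gamma>) (Suc n) v"
    proof (rule less.IH)
      fix K e
      assume "v = plug K e"
      then show "\<not> active (hole_ctx K (case_nat (Imp B A) \<Gamma>)) (Suc n + pdepth K) e"
        using less.prems[of "ParR A B u K" e] t by simp
    qed (simp add: t)
    ultimately show ?thesis
      unfolding t by (rule hnf_Par)
  next
    case False
    then show ?thesis
      using less.prems[of Hole t] by (intro hnf_elem) simp_all
  qed
qed

text \<open>The recursion in \<open>hst\<close> is unfolded into a context. The normality premises
  collected at right turns say exactly that every hole further left is inactive.\<close>

lemma hst_iff_plug: "hst \<Gamma> E t t' \<longleftrightarrow> (\<exists>K e e'. t = plug K e \<and> t' = plug K e' \<and>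
    contracts (hole_ctx K \<Gamma>) (partners K E) e e' \<and>
    (\<forall>K' e'. t = plug K' e' \<longrightarrow> left_of K' K \<longrightarrow> \<not> active (hole_ctx K' \<Gamma>) (length E + pdepth K') e'))"
    (is "_ \<longleftrightarrow> ?R \<Gamma> E t t'")
proof
  assume "hst \<Gamma> E t t'"
  then show "?R \<Gamma> E t t'"
  proof (induction rule: hst.induct)
    case (hst_elem \<Gamma> E t t')
    have "\<not> left_of K' Hole" for K' :: "('a, 'b) pctx"
      by (cases K') auto
    then show ?case
      using hst_elem by (intro exI[of _ Hole] exI[of _ t] exI[of _ t']) auto
  next
    case (hst_left A B \<Gamma> v E u u')
    then obtain K e e' where *: "u = plug K e" "u' = plug K e'"
      "contracts (hole_ctx K (case_nat (Imp A B) \<Gamma>)) (partners K ((B, v) # E)) e e'"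
      and n: "\<And>K' e'. u = plug K' e' \<Longrightarrow> left_of K' K \<Longrightarrow>
        \<not> active (hole_ctx K' (case_nat (Imp A B) \<Gamma>)) (Suc (length E) + pdepth K') e'"
      by auto
    \<comment> \<open>Only a context that also enters the left component can lie to the left of
      \<open>ParL A B K v\<close>.\<close>
    have "\<not> active (hole_ctx K' \<Gamma>) (length E + pdepth K') e'"
      if "Par A B u v = plug K' e'" "left_of K' (ParL A B K v)" for K' e'
      using that n by (cases K') auto
    then show ?case
      using * by (intro exI[of _ "ParL A B K v"] exI[of _ e] exI[of _ e']) auto
  next
    case (hst_right A B \<Gamma> E u v v')
    then obtain K e e' where *: "v = plug K e" "v' = plug K e'"
      "contracts (hole_ctx K (case_nat (Imp B A) \<Gamma>)) (partners K ((A, u) # E)) e e'"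
      and n: "\<And>K' e'. v = plug K' e' \<Longrightarrow> left_of K' K \<Longrightarrow>
        \<not> active (hole_ctx K' (case_nat (Imp B A) \<Gamma>)) (Suc (length E) + pdepth K') e'"
      by auto
    have "\<not> active (hole_ctx K' (case_nat (Imp A B) \<Gamma>)) (Suc (length E) + pdepth K') e'"
      if "u = plug K' e'" for K' e'
      using hst_right(1) that hnf_plug by blast
    \<comment> \<open>A hole further left is either in \<open>u\<close>, which is normal, or in
      \<open>v\<close> and left of the hole of \<open>K\<close>.\<close>
    then have "\<not> active (hole_ctx K' \<Gamma>) (length E + pdepth K') e'"
      if "Par A B u v = plug K' e'" "left_of K' (ParR A B u K)" for K' e'
      using that n by (cases K') auto
    then show ?case
      using * by (intro exI[of _ "ParR A B u K"] exI[of _ e] exI[of _ e']) auto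
  qed
next
  have "hst \<Gamma> E (plug K e) (plug K e')"
    if "contracts (hole_ctx K \<Gamma>) (partners K E) e e'"
      "\<And>K' e'. plug K e = plug K' e' \<Longrightarrow> left_of K' K \<Longrightarrow>
        \<not> active (hole_ctx K' \<Gamma>) (length E + pdepth K') e'" for K e e'
    using that
  proof (induction K arbitrary: \<Gamma> E)
    case Hole
    then show ?case
      by (simp add: hst_elem)
  next
    case (ParL A B K v)
    have "hst (case_nat (Imp A B) \<Gamma>) ((B, v) # E) (plug K e) (plug K e')"
    proof (rule ParL.IH)
      fix K' e''
      assume "plug K e = plug K' e''" "left_of K' K"
      then show "\<not> active (hole_ctx K' (case_nat (Imp A B) \<Gamma>)) (length ((B, v) # E) + pdepth K') e''"
        using ParL.prems(2)[of "ParL A B K' v" e''] by simp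
    qed (use ParL.prems(1) in simp)
    then show ?case
      by (simp add: hst_left)
  next
    case (ParR A B u K)
    have "hst (case_nat (Imp B A) \<Gamma>) ((A, u) # E) (plug K e) (plug K e')"
    proof (rule ParR.IH)
      fix K' e''
      assume "plug K e = plug K' e''" "left_of K' K"
      then show "\<not> active (hole_ctx K' (case_nat (Imp B A) \<Gamma>)) (length ((A, u) # E) + pdepth K') e''"
        using ParR.prems(2)[of "ParR A B u K'" e''] by simp
    qed (use ParR.prems(1) in simp)
    \<comment> \<open>All holes of the left component precede the hole on the right, so leftmostness
      makes each of them inactive.\<close>
    moreover have "hnf (case_nat (Imp A B) \<Gamma>) (Suc (length E)) u"
    proof (rule hnfI_plug)
      fix K' e''
      assume "u = plug K' e''"
      then show "\<not> active (hole_ctx K' (case_nat (Imp A B) \<Gamma>)) (Suc (length E) + pdepth K') e''"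
        using ParR.prems(2)[of "ParL A B K' (plug K e)" e''] by simp
    qed
    ultimately show ?case
      by (simp add: hst_right)
  qed
  then show "?R \<Gamma> E t t' \<Longrightarrow> hst \<Gamma> E t t'"
    by blast
qed

lemma head_step_iff_hst: "head_step \<Gamma> t t' \<longleftrightarrow> hst \<Gamma> [] t t'"
proof -
  \<comment> \<open>The minimality clause of \<open>head_step\<close> only asks whether some
    contractum exists, and that is activity of the filler.\<close>
  have "(\<exists>t'. head_redex \<Gamma> t K t') \<longleftrightarrow> (\<exists>e. t = plug K e \<and> active (hole_ctx K \<Gamma>) (pdepth K) e)" for K
    unfolding head_redex_iff
    using contracts_active[of _ "partners K []"] active_contracts[of _ "partners K []"]
    by simp metis
  then show ?thesis
    unfolding head_step_def hst_iff_plug head_redex_iff by simp metis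
qed

section \<open>Simulating one side of a parallel term\<close>

text \<open>All components of a parallel term have the same type, so one \<open>D\<close> serves for
  every partner. The partner of channel \<open>j\<close> lives outside that channel: its context
  drops the first \<open>j + 1\<close> entries of \<open>\<Gamma>\<close> and begins with the dual
  channel instead.\<close>

definition well_partnered ::
  "('f, 'p) ctx \<Rightarrow> (('f, 'p) fm \<times> ('f, 'p) trm) list \<Rightarrow> ('f, 'p) fm \<Rightarrow> bool" where
  "well_partnered \<Gamma> E D \<longleftrightarrow> (\<forall>j<length E. \<exists>A B v. E ! j = (B, v) \<and> \<Gamma> j = Imp A B \<and>
    LC2_star (case_nat (Imp B A) (\<lambda>i. \<Gamma> (Suc (i + j)))) v D)"

lemma well_partnered_Nil [simp]: "well_partnered \<Gamma> [] D"
  by (simp add: well_partnered_def)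

lemma well_partnered_Cons:
  assumes "well_partnered \<Gamma> E D" "LC2_star (case_nat (Imp B A) \<Gamma>) v D"
  shows "well_partnered (case_nat (Imp A B) \<Gamma>) ((B, v) # E) D"
  unfolding well_partnered_def
proof (intro allI impI)
  fix j
  assume "j < length ((B, v) # E)"
  then show "\<exists>A' B' v'. ((B, v) # E) ! j = (B', v') \<and> case_nat (Imp A B) \<Gamma> j = Imp A' B' \<and>
      LC2_star (case_nat (Imp B' A') (\<lambda>i. case_nat (Imp A B) \<Gamma> (Suc (i + j)))) v' D"
    using assms by (cases j) (simp_all add: well_partnered_def)
qed

lemma has_type_reply:
  assumes "LC2_star (case_nat (Imp B A) (\<lambda>i. \<Gamma> (Suc (i + d)))) v D" "LC2_star \<Gamma> s A"
  shows "LC2_star \<Gamma> (reply d B s v) D"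
  unfolding reply_def
proof (rule has_type_psub[OF assms(1)])
  fix i
  show "LC2_star \<Gamma> (case_nat (Lam B (pren Suc s)) (\<lambda>i. Var (Suc (i + d))) i)
      (case_nat (Imp B A) (\<lambda>i. \<Gamma> (Suc (i + d))) i)"
    using assms(2) has_type.ty_var[of True \<Gamma>]
    by (cases i) (simp_all add: has_type.ty_lam has_type_pren_Suc)
qed

text \<open>In a communication, the process that is replaced and the reply have the common type
  \<open>D\<close> of all components, which is what \<open>well_partnered\<close> provides.\<close>

lemma hst_type:
  "hst \<Gamma> E t t' \<Longrightarrow> well_partnered \<Gamma> E D \<Longrightarrow> LC2_star \<Gamma> t D \<Longrightarrow> LC2_star \<Gamma> t' D"
proof (induction rule: hst.induct)
  case (hst_elem \<Gamma> E t t')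
  from hst_elem(1) show ?case
  proof cases
    case (ct_basic h h' \<sigma>)
    moreover obtain T where "LC2_star \<Gamma> h T"
      using has_type_apps_head hst_elem(3) ct_basic(1) by blast
    ultimately show ?thesis
      using has_type_apps_replace has_type_basic hst_elem(3) by blast
  next
    case (ct_abort C A B \<sigma>)
    then show ?thesis
      using has_type_unique hst_elem(3) by blast
  next
    case (ct_comm j B v s \<sigma>)
    have "\<exists>T. LC2_star \<Gamma> (El (Var j) (Arg s)) T"
      using has_type_apps_head[of True \<Gamma> "El (Var j) (Arg s)" \<sigma> D] hst_elem(3) ct_comm(1) by simp
    then obtain T where "LC2_star \<Gamma> (El (Var j) (Arg s)) T" ..
    moreover obtain A where "\<Gamma> j = Imp A B"
      "LC2_star (case_nat (Imp B A) (\<lambda>i. \<Gamma> (Suc (i + j)))) v D"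
      using hst_elem(2) ct_comm unfolding well_partnered_def by fastforce
    ultimately show ?thesis
      unfolding ct_comm(2) by (intro has_type_reply) auto
  qed
next
  case (hst_left A B \<Gamma> v E u u')
  then have "LC2_star (case_nat (Imp A B) \<Gamma>) u D" "LC2_star (case_nat (Imp B A) \<Gamma>) v D"
    by blast+
  then show ?case
    using hst_left well_partnered_Cons by (intro has_type.ty_par) blast+
next
  case (hst_right A B \<Gamma> E u v v')
  then have "LC2_star (case_nat (Imp A B) \<Gamma>) u D" "LC2_star (case_nat (Imp B A) \<Gamma>) v D"
    by blast+
  then show ?case
    using hst_right well_partnered_Cons by (intro has_type.ty_par) blast+
qed

section \<open>Head redexes and substitution for a channel\<close>

lemma psub_apps: "psub \<theta> (apps t \<sigma>) = apps (psub \<theta> t) (map (psube \<theta>) \<sigma>)"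
  by (induction \<sigma> arbitrary: t) simp_all

lemma commuting_psube [simp]: "commuting (psube \<theta> \<xi>) = commuting \<xi>"
  by (cases \<xi>) simp_all

lemma basic_psub: "basic h h' \<Longrightarrow> basic (psub \<theta> h) (psub \<theta> h')"
proof (induction rule: basic.induct)
  case (1 A u t)
  show ?case
    unfolding psub_pinst by (simp add: basic.intros)
next
  case (2 u m)
  show ?case
    unfolding psub_pinst_ind by (simp add: basic.intros)
next
  case (3 u B)
  show ?case
    unfolding psub_pinst_prd by (simp add: basic.intros)
next
  case (6 B' u A t0 B t1)
  show ?case
    unfolding psub_pinst by (simp add: basic.intros)
next
  case (7 A' u A t0 B t1)
  show ?case
    unfolding psub_pinst by (simp add: basic.intros)
next
  case (8 A' m u A v)
  show ?case
    unfolding psub_pinst[of \<theta> _ "pinst_ind v m"] psub_pinst_ind[of "up_pf \<theta>"] up_pf_psubt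
    by (simp add: basic.intros)
next
  case (9 \<xi> A B u v)
  then show ?case
    using basic.intros(9)[of "psube \<theta> \<xi>" A B "psub (up_pf \<theta>) u" "psub (up_pf \<theta>) v"]
    by (simp add: psube_prene_Suc)
qed (simp_all add: basic.intros)

lemma basic_ParI: "commuting \<xi> \<Longrightarrow> \<exists>h. basic (El (Par A B u v) \<xi>) h"
  by (blast intro: basic.intros)

text \<open>Substitution keeps the outermost constructor of anything but a variable, and keeps the
  kind of a stack element. These two decide whether a basic rule applies, so no redex is created at
  such a head.\<close>

lemma basic_psub_reflect:
  "basic (El (psub \<theta> r) (psube \<theta> \<xi>)) h' \<Longrightarrow> \<forall>i. r \<noteq> Var i \<Longrightarrow> hd_of r = r \<Longrightarrow> \<exists>h. basic (El r \<xi>) h"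
  by (cases r; cases \<xi>) (auto elim!: basic.cases intro: basic.intros basic_ParI)

text \<open>\<open>chan n p\<close> substitutes \<open>p\<close> for the index \<open>n\<close>, where \<open>p\<close> lives outside the \<open>n\<close> innermost binders.\<close>

definition chan :: "nat \<Rightarrow> ('f, 'p) trm \<Rightarrow> nat \<Rightarrow> ('f, 'p) trm" where
  "chan n p i = (if i < n then Var i else if i = n then pren (\<lambda>k. k + n) p else Var (i - 1))"

definition cdel :: "nat \<Rightarrow> ('f, 'p) ctx \<Rightarrow> ('f, 'p) ctx" where
  "cdel n \<Gamma> i = (if i < n then \<Gamma> i else \<Gamma> (Suc i))"

lemma chan_0: "chan 0 p = case_nat p Var"
  by (simp add: fun_eq_iff chan_def split: nat.split)

lemma cdel_0 [simp]: "cdel 0 (case_nat A \<Gamma>) = \<Gamma>"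
  by (simp add: fun_eq_iff cdel_def)

lemma up_chan [simp]: "up_pf (chan n p) = chan (Suc n) p"
  by (auto simp: fun_eq_iff chan_def pren_pren split: nat.split)

lemma cdel_Suc [simp]: "cdel (Suc n) (case_nat A \<Gamma>) = case_nat A (cdel n \<Gamma>)"
  by (simp add: fun_eq_iff cdel_def split: nat.split)

lemma chan_cases:
  obtains j where "chan n p i = Var j" "i \<noteq> n" "j < n \<Longrightarrow> i = j" | "i = n" "chan n p i = pren (\<lambda>k. k + n) p"
proof (cases "i = n")
  case False
  then show ?thesis
    using that(1)[of i] that(1)[of "i - 1"] by (cases "i < n") (auto simp: chan_def)
qed (use that(2) in \<open>simp add: chan_def\<close>)

lemma has_type_Var: "\<Gamma> i = A \<Longrightarrow> has_type s \<Gamma> (Var i) A"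
  using has_type.ty_var by metis

lemma has_type_chan:
  assumes "LC2_star \<Gamma> t T" "LC2_star (\<lambda>k. \<Gamma> (Suc (k + n))) p (\<Gamma> n)"
  shows "LC2_star (cdel n \<Gamma>) (psub (chan n p) t) T"
proof (rule has_type_psub[OF assms(1)])
  fix i
  have "LC2_star (cdel n \<Gamma>) (pren (\<lambda>k. k + n) p) (\<Gamma> n)"
    by (rule has_type_pren[OF assms(2)]) (simp add: cdel_def)
  moreover have "LC2_star (cdel n \<Gamma>) (Var i) (\<Gamma> i)" if "i < n"
    using has_type.ty_var[of True "cdel n \<Gamma>" i] that by (simp add: cdel_def)
  moreover have "LC2_star (cdel n \<Gamma>) (Var (i - 1)) (\<Gamma> i)" if "i > n"
    using has_type.ty_var[of True "cdel n \<Gamma>" "i - 1"] that by (simp add: cdel_def split: if_splits)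
  ultimately show "LC2_star (cdel n \<Gamma>) (chan n p i) (\<Gamma> i)"
    by (simp add: chan_def)
qed

lemma hd_of_hd_of [simp]: "hd_of (hd_of t) = hd_of t" "sp (hd_of t) = []"
  by (induction t rule: hd_of.induct) simp_all

lemma hd_of_not_El: "hd_of t \<noteq> El u \<xi>"
  by (induction t rule: hd_of.induct) simp_all

lemma hd_of_psub: "\<forall>i. r \<noteq> Var i \<Longrightarrow> hd_of r = r \<Longrightarrow> hd_of (psub \<theta> r) = psub \<theta> r \<and> sp (psub \<theta> r) = []"
  by (cases r) (auto simp: hd_of_not_El)

text \<open>The only head redexes that an abstraction put for a channel can create come from
  messages on that channel, and these count as active before the substitution. Typing is needed for
  \<open>Abort\<close>, whose activity is a condition on types.\<close>

lemma active_chan_reflect: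
  assumes act: "active (cdel n \<Gamma>) n (psub (chan n (Lam A b)) t)"
    and t: "LC2_star \<Gamma> t T" and p: "LC2_star (\<lambda>k. \<Gamma> (Suc (k + n))) (Lam A b) (\<Gamma> n)"
  shows "active \<Gamma> (Suc n) t"
proof -
  let ?\<theta> = "chan n (Lam A b)"
  define r \<sigma> where "r = hd_of t" and "\<sigma> = sp t"
  have teq: "t = apps r \<sigma>" and r: "hd_of r = r" "sp r = []"
    by (simp_all add: r_def \<sigma>_def apps_hd_sp)
  have *: "hd_of (psub ?\<theta> r) = psub ?\<theta> r" "sp (psub ?\<theta> r) = []"
  proof -
    have "hd_of (psub ?\<theta> r) = psub ?\<theta> r \<and> sp (psub ?\<theta> r) = []"
    proof (cases "\<exists>i. r = Var i")
      case True
      then obtain i where "r = Var i" ..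
      then show ?thesis
        by (cases rule: chan_cases[of n "Lam A b" i]) simp_all
    next
      case False
      then show ?thesis
        using hd_of_psub r by blast
    qed
    then show "hd_of (psub ?\<theta> r) = psub ?\<theta> r" "sp (psub ?\<theta> r) = []"
      by auto
  qed
  have im: "hd_of (psub ?\<theta> t) = psub ?\<theta> r" "sp (psub ?\<theta> t) = map (psube ?\<theta>) \<sigma>"
    unfolding teq psub_apps by (simp_all add: *)
  have var: "active \<Gamma> (Suc n) t" if "r = Var i" "i \<le> n" "\<sigma> = Arg s # \<tau>" for i s \<tau>
    unfolding active_def teq that(1,3) using that(2) less_Suc_eq_le by blast
  consider h h' \<tau> where "psub ?\<theta> t = apps h \<tau>" "basic h h'"
    | A' B' u \<tau> C where "psub ?\<theta> t = apps (Abort A' B') (Arg u # \<tau>)" "LC2_star (cdel n \<Gamma>) u C"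
      "LC2_star (cdel n \<Gamma>) (psub ?\<theta> t) C"
    | j s \<tau> where "j < n" "psub ?\<theta> t = apps (Var j) (Arg s # \<tau>)"
    using act unfolding active_def by blast
  then show ?thesis
  proof cases
    case 1
    obtain r' \<xi>' where h: "h = El r' \<xi>'" "hd_of r' = r'" "sp r' = []" "\<And>i. r' \<noteq> Var i"
      using basic_spine[OF 1(2)] by blast
    then have "r' = psub ?\<theta> r" "map (psube ?\<theta>) \<sigma> = \<xi>' # \<tau>"
      using im 1(1) by auto
    then obtain \<xi> \<sigma>' where \<sigma>: "\<sigma> = \<xi> # \<sigma>'" "\<xi>' = psube ?\<theta> \<xi>"
      by auto
    show ?thesis
    proof (cases "\<exists>i. r = Var i")
      case True
      then obtain i where i: "r = Var i" ..
      show ?thesis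
      proof (cases rule: chan_cases[of n "Lam A b" i])
        \<comment> \<open>Every other variable is mapped to a variable, which cannot head a basic
          redex.\<close>
        case (1 j)
        then have "r' = Var j"
          using i \<open>r' = psub ?\<theta> r\<close> by simp
        then show ?thesis
          using h(4) by blast
      next
        \<comment> \<open>The channel has become an abstraction over a proof variable; a basic redex
          with this head must have a proof as its argument, so \<open>t\<close> was a message on the
          channel.\<close>
        case 2
        then have "r' = Lam A (pren (upr (\<lambda>k. k + n)) b)"
          using i \<open>r' = psub ?\<theta> r\<close> by simp
        then obtain s where "\<xi> = Arg s"
          using \<open>basic h h'\<close> h(1) \<sigma> by (cases \<xi>) (auto elim: basic.cases)
        then show ?thesis
          using var[OF i _ \<sigma>(1)[unfolded \<open>\<xi> = Arg s\<close>]] \<open>i = n\<close> by simp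
      qed
    next
      case False
      then obtain h'' where "basic (El r \<xi>) h''"
        using basic_psub_reflect 1(2) h(1) \<sigma> \<open>r' = psub ?\<theta> r\<close> r(1) by blast
      moreover have "t = apps (El r \<xi>) \<sigma>'"
        using teq \<sigma> by simp
      ultimately show ?thesis
        unfolding active_def by blast
    qed
  next
    case 2
    have "hd_of (psub ?\<theta> t) = Abort A' B'" "sp (psub ?\<theta> t) = Arg u # \<tau>"
      unfolding 2(1) by simp_all
    then have "psub ?\<theta> r = Abort A' B'" "map (psube ?\<theta>) \<sigma> = Arg u # \<tau>"
      using im by simp_all
    moreover have "r \<noteq> Var i" for i
      using \<open>psub ?\<theta> r = Abort A' B'\<close> by (cases rule: chan_cases[of n "Lam A b" i]) auto
    ultimately have "r = Abort A' B'"
      by (cases r) auto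
    obtain \<xi> \<sigma>' where "\<sigma> = \<xi> # \<sigma>'" "psube ?\<theta> \<xi> = Arg u"
      using \<open>map (psube ?\<theta>) \<sigma> = Arg u # \<tau>\<close> by auto
    then obtain u0 where u0: "\<sigma> = Arg u0 # \<sigma>'" "u = psub ?\<theta> u0"
      by (cases \<xi>) auto
    have t': "t = apps (El (Abort A' B') (Arg u0)) \<sigma>'"
      using teq u0 \<open>r = Abort A' B'\<close> by simp
    \<comment> \<open>Typing is not reflected by substitution in general. Here inversion gives
      \<open>u0\<close> the type \<open>A'\<close>, and comparing types after the substitution shows
      that \<open>t\<close> has type \<open>A'\<close> as well.\<close>
    have "\<exists>U. LC2_star \<Gamma> (El (Abort A' B') (Arg u0)) U"
      using has_type_apps_head t unfolding t' by metis
    then have u0A: "LC2_star \<Gamma> u0 A'"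
      by auto
    then have "LC2_star (cdel n \<Gamma>) u A'" "LC2_star (cdel n \<Gamma>) (psub ?\<theta> t) T"
      using has_type_chan[OF _ p] t u0 by auto
    then have "T = A'"
      using 2 has_type_unique by blast
    then show ?thesis
      unfolding active_def using u0A t t' apps_simps(2) by metis
  next
    case 3
    have "hd_of (psub ?\<theta> t) = Var j" "sp (psub ?\<theta> t) = Arg s # \<tau>"
      unfolding 3(2) by simp_all
    then have "psub ?\<theta> r = Var j" "map (psube ?\<theta>) \<sigma> = Arg s # \<tau>"
      using im by simp_all
    obtain i where i: "r = Var i"
      using \<open>psub ?\<theta> r = Var j\<close> r by (cases r) auto
    then have "i = j"
      using \<open>psub ?\<theta> r = Var j\<close> \<open>j < n\<close> by (cases rule: chan_cases[of n "Lam A b" i]) auto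
    obtain \<xi> \<sigma>' where "\<sigma> = \<xi> # \<sigma>'" "psube ?\<theta> \<xi> = Arg s"
      using \<open>map (psube ?\<theta>) \<sigma> = Arg s # \<tau>\<close> by auto
    then obtain s0 where "\<sigma> = Arg s0 # \<sigma>'"
      by (cases \<xi>) auto
    then show ?thesis
      using var i \<open>i = j\<close> \<open>j < n\<close> by auto
  qed
qed

text \<open>This is used in two places: to keep frozen left components normal during the simulation,
  so that the right ones may still move, and to show that a normal component stays normal when its
  channel receives a constant abstraction.\<close>

lemma hnf_chan:
  "hnf \<Gamma> m u \<Longrightarrow> m = Suc n \<Longrightarrow> LC2_star \<Gamma> u D \<Longrightarrow>
    LC2_star (\<lambda>k. \<Gamma> (Suc (k + n))) (Lam A b) (\<Gamma> n) \<Longrightarrow>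
    hnf (cdel n \<Gamma>) n (psub (chan n (Lam A b)) u)"
proof (induction arbitrary: n rule: hnf.induct)
  case (hnf_Par A' B' \<Gamma> m u v)
  have "LC2_star (case_nat (Imp A' B') \<Gamma>) u D" "LC2_star (case_nat (Imp B' A') \<Gamma>) v D"
    using hnf_Par.prems by blast+
  then show ?case
    using hnf_Par.IH[of "Suc n"] hnf_Par.prems by (simp add: hnf.hnf_Par)
next
  case (hnf_elem t \<Gamma> m)
  have "psub (chan n (Lam A b)) t \<noteq> Par A' B' u v" for A' B' u v
    using hnf_elem(1) by (cases t) (auto simp: chan_def)
  moreover have "\<not> active (cdel n \<Gamma>) n (psub (chan n (Lam A b)) t)"
    using active_chan_reflect[of n \<Gamma> A b t D] hnf_elem by auto
  ultimately show ?case
    by (simp add: hnf.hnf_elem)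
qed

text \<open>For \<open>v : D\<close> with \<open>a : B \<rightarrow> A\<close> at index \<open>0\<close>, this is
  \<open>\<lambda>x\<^sup>A. \<A>\<^sup>D\<^sup>\<rightarrow>\<^sup>B (v[\<lambda>y\<^sup>B x/a])\<close>, which answers a message \<open>a s\<close> just as \<open>v\<close> does.\<close>

definition answer :: "('f, 'p) fm \<Rightarrow> ('f, 'p) fm \<Rightarrow> ('f, 'p) fm \<Rightarrow> ('f, 'p) trm \<Rightarrow> ('f, 'p) trm" where
  "answer D A B v = Lam A (El (Abort D B)
    (Arg (psub (case_nat (Lam B (Var 1)) (\<lambda>i. Var (Suc i))) v)))"

section \<open>Answers and the simulation of communication\<close>

lemma has_type_answer:
  assumes "LC2_star (case_nat (Imp B A) \<Gamma>) v D"
  shows "LC2_star \<Gamma> (answer D A B v) (Imp A B)"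
proof -
  have "LC2_star (case_nat A \<Gamma>) (psub (case_nat (Lam B (Var 1)) (\<lambda>i. Var (Suc i))) v) D"
  proof (rule has_type_psub[OF assms])
    fix i
    show "LC2_star (case_nat A \<Gamma>) (case_nat (Lam B (Var 1)) (\<lambda>i. Var (Suc i)) i) (case_nat (Imp B A) \<Gamma> i)"
      by (cases i) (auto intro!: has_type.ty_lam has_type_Var)
  qed
  then show ?thesis
    unfolding answer_def by (auto intro!: has_type.ty_lam intro: has_type.ty_app has_type.ty_abort)
qed

lemma pinst_answer:
  "pinst (psub (case_nat (Lam B (Var 1)) (\<lambda>i. Var (Suc i))) v) s
    = pinst v (Lam B (pren Suc s))"
  unfolding psub_psub
  by (rule arg_cong[where f = "\<lambda>\<theta>. psub \<theta> v"]) (simp add: fun_eq_iff split: nat.split)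

text \<open>The list \<open>E\<close> is arbitrary, as neither step communicates. The second step
  discards the remaining stack because the reply already has the type \<open>D\<close> of the entire
  process.\<close>

lemma answer_steps:
  assumes \<Gamma>: "\<Gamma> n = Imp A B" and v: "LC2_star (case_nat (Imp B A) (\<lambda>i. \<Gamma> (Suc (i + n)))) v D"
    and t: "LC2_star \<Gamma> (apps (Var n) (Arg s # \<sigma>)) D"
  defines "\<theta> \<equiv> chan n (answer D A B v)"
  shows "(hst (cdel n \<Gamma>) E)\<^sup>+\<^sup>+ (psub \<theta> (apps (Var n) (Arg s # \<sigma>))) (psub \<theta> (reply n B s v))"
proof -
  define w where "w = psub (case_nat (Lam B (Var 1)) (\<lambda>i. Var (Suc i))) v"
  define R where "R = psub \<theta> (reply n B s v)"
  have p: "LC2_star (\<lambda>k. \<Gamma> (Suc (k + n))) (answer D A B v) (\<Gamma> n)"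
    using has_type_answer[OF v] \<Gamma> by simp
  have \<theta>n: "\<theta> n = Lam A (El (Abort D B) (Arg (pren (upr (\<lambda>k. k + n)) w)))"
    by (simp add: \<theta>_def chan_def answer_def w_def)
  \<comment> \<open>Both sides send index 0 of \<open>v\<close> to the constant abstraction over the
    image of \<open>s\<close>, and each index \<open>i + 1\<close> to \<open>i + n\<close>.\<close>
  have R: "pinst (pren (upr (\<lambda>k. k + n)) w) (psub \<theta> s) = R"
    unfolding R_def w_def reply_def pren_psub psub_psub
    by (rule arg_cong[where f = "\<lambda>\<theta>. psub \<theta> v"])
      (simp add: fun_eq_iff psub_pren_Suc psub_pren pren_psub \<theta>_def chan_def split: nat.split)
  let ?t = "apps (El (\<theta> n) (Arg (psub \<theta> s))) (map (psube \<theta>) \<sigma>)"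
  have t_eq: "psub \<theta> (apps (Var n) (Arg s # \<sigma>)) = ?t"
    by (simp add: psub_apps)
  have "basic (El (\<theta> n) (Arg (psub \<theta> s))) (El (Abort D B) (Arg R))"
    unfolding \<theta>n R[symmetric] using basic.intros(1)[of A "El (Abort D B) (Arg (pren (upr (\<lambda>k. k + n)) w))" "psub \<theta> s"]
    by simp
  then have "hst (cdel n \<Gamma>) E ?t (apps (El (Abort D B) (Arg R)) (map (psube \<theta>) \<sigma>))"
    by (intro hst_elem ct_basic)
  moreover have "hst (cdel n \<Gamma>) E (apps (El (Abort D B) (Arg R)) (map (psube \<theta>) \<sigma>)) R"
  proof -
    have "\<exists>T. LC2_star \<Gamma> (El (Var n) (Arg s)) T"
      using t has_type_apps_head[of True \<Gamma> "El (Var n) (Arg s)" \<sigma>] by simp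
    then have "LC2_star \<Gamma> s A"
      using \<Gamma> by auto
    then have "LC2_star \<Gamma> (reply n B s v) D" and "LC2_star \<Gamma> (El (Var n) (Arg s)) B"
      using v has_type_reply has_type.ty_app[OF has_type_Var[of \<Gamma> n, OF \<Gamma>]] by blast+
    then have R: "LC2_star (cdel n \<Gamma>) R D" and El: "LC2_star (cdel n \<Gamma>) (El (\<theta> n) (Arg (psub \<theta> s))) B"
      unfolding R_def \<theta>_def
      using has_type_chan[OF _ p, of "reply n B s v" D] has_type_chan[OF _ p, of "El (Var n) (Arg s)" B]
      by simp_all
    \<comment> \<open>The contracted head still has type \<open>B\<close>, so the stack fits it and
      the whole process keeps type \<open>D\<close>; this is the condition for \<open>Abort\<close>
      to fire.\<close>
    have "LC2_star (cdel n \<Gamma>) ?t D"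
      using has_type_chan[OF t p] t_eq \<theta>_def by simp
    moreover have "LC2_star (cdel n \<Gamma>) (El (Abort D B) (Arg R)) B"
      by (rule has_type.ty_app[OF has_type.ty_abort R]) simp
    ultimately have "LC2_star (cdel n \<Gamma>) (apps (El (Abort D B) (Arg R)) (map (psube \<theta>) \<sigma>)) D"
      by (rule has_type_apps_replace[OF _ El])
    then show ?thesis
      using ct_abort[OF R, of D B "map (psube \<theta>) \<sigma>"] by (simp add: hst_elem)
  qed
  ultimately show ?thesis
    unfolding t_eq R_def by (rule tranclp.trancl_into_trancl[OF tranclp.r_into_trancl])
qed

text \<open>The substituted channel lies outside all those in the list. A partner followed by
  \<open>length E\<close> further entries sees its own dual channel at 0 and those
  \<open>length E\<close> channels next, so the substituted one has index
  \<open>Suc (length E)\<close> there.\<close>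

fun sub_partners :: "('f, 'p) trm \<Rightarrow> (('f, 'p) fm \<times> ('f, 'p) trm) list \<Rightarrow>
    (('f, 'p) fm \<times> ('f, 'p) trm) list" where
  "sub_partners p [] = []"
| "sub_partners p ((B, v) # E) = (B, psub (chan (Suc (length E)) p) v) # sub_partners p E"

lemma length_sub_partners [simp]: "length (sub_partners p E) = length E"
  by (induction E rule: sub_partners.induct) auto

lemma nth_sub_partners: "j < length E \<Longrightarrow> E ! j = (B, v) \<Longrightarrow>
    sub_partners p E ! j = (B, psub (chan (length E - j) p) v)"
proof (induction E arbitrary: j rule: sub_partners.induct)
  case (2 p B' v' E)
  then show ?case
    by (cases j) auto
qed simp

text \<open>A communication on an inner channel commutes with substitution for an outer one. The
  partner lives outside the inner channel and the \<open>j\<close> channels below it, which accounts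
  for \<open>n - j\<close>.\<close>

lemma psub_chan_reply:
  assumes "j < n"
  shows "psub (chan n p) (reply j B s v) = reply j B (psub (chan n p) s) (psub (chan (n - j) p) v)"
  unfolding reply_def psub_psub
proof (rule arg_cong[where f = "\<lambda>\<theta>. psub \<theta> v"], rule ext)
  fix i
  show "psub (chan n p) (case_nat (Lam B (pren Suc s)) (\<lambda>i. Var (Suc (i + j))) i)
      = psub (case_nat (Lam B (pren Suc (psub (chan n p) s))) (\<lambda>i. Var (Suc (i + j)))) (chan (n - j) p i)"
  proof (cases i)
    case 0
    then show ?thesis
      using assms psub_pren_Suc[of "chan n p" s] by (simp add: chan_def)
  next
    case (Suc i')
    consider "i < n - j" | "i = n - j" | "i > n - j"
      by linarith
    then show ?thesis
    proof cases
      \<comment> \<open>The index \<open>n - j\<close> of \<open>v\<close> is the substituted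
        channel itself. Forming the reply moves it to \<open>n\<close>, and on either side the
        result is \<open>p\<close> moved under \<open>n\<close> binders.\<close>
      case 2
      have "(\<lambda>k. case_nat (Lam B (pren Suc (psub (chan n p) s))) (\<lambda>i. Var (Suc (i + j))) (k + (n - j)))
          = (\<lambda>k. Var (k + n))"
      proof
        fix k
        have "k + (n - j) = Suc (k + (n - j - 1))" "Suc (k + (n - j - 1) + j) = k + n"
          using assms by auto
        then show "case_nat (Lam B (pren Suc (psub (chan n p) s))) (\<lambda>i. Var (Suc (i + j))) (k + (n - j))
            = Var (k + n)"
          by (metis old.nat.simps(5))
      qed
      moreover have "chan (n - j) p i = pren (\<lambda>k. k + (n - j)) p"
        using 2 by (simp add: chan_def)
      moreover have "Suc (i' + j) = n"
        using 2 Suc assms by simp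
      then have "psub (chan n p) (case_nat (Lam B (pren Suc s)) (\<lambda>i. Var (Suc (i + j))) i)
          = pren (\<lambda>k. k + n) p"
        unfolding Suc by (simp add: chan_def)
      ultimately show ?thesis
        by (simp only: psub_pren psub_Var)
    next
      case 3
      then have "i' = Suc (i' - 1)" "\<not> Suc (i' + j) < n" "Suc (i' + j) \<noteq> n"
        using Suc assms by auto
      then show ?thesis
        using 3 Suc assms by (cases i') (auto simp: chan_def)
    qed (use Suc in \<open>auto simp: chan_def\<close>)
  qed
qed

lemma tranclp_Par_left:
  "(hst (case_nat (Imp A B) \<Gamma>) ((B, v) # E))\<^sup>+\<^sup>+ u u' \<Longrightarrow> (hst \<Gamma> E)\<^sup>+\<^sup>+ (Par A B u v) (Par A B u' v)"
  by (induction rule: tranclp_induct) (blast intro: hst_left tranclp.r_into_trancl tranclp.trancl_into_trancl)+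

lemma tranclp_Par_right:
  "(hst (case_nat (Imp B A) \<Gamma>) ((A, u) # E))\<^sup>+\<^sup>+ v v' \<Longrightarrow>
    hnf (case_nat (Imp A B) \<Gamma>) (Suc (length E)) u \<Longrightarrow> (hst \<Gamma> E)\<^sup>+\<^sup>+ (Par A B u v) (Par A B u v')"
  by (induction rule: tranclp_induct) (blast intro: hst_right tranclp.r_into_trancl tranclp.trancl_into_trancl)+

text \<open>The channel being replaced is the outermost one, hence the last entry of
  \<open>E'\<close>. A communication on it becomes the two steps of \<open>answer_steps\<close>; any
  other contraction is matched by a contraction of the same kind. At least one step is always made,
  so termination can be transferred back.\<close>

lemma hst_simulation:
  "hst \<Gamma> E' u u' \<Longrightarrow> E' = E @ [(B, v)] \<Longrightarrow> LC2_star \<Gamma> u D \<Longrightarrow> \<Gamma> (length E) = Imp A B \<Longrightarrow>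
    LC2_star (case_nat (Imp B A) (\<lambda>i. \<Gamma> (Suc (i + length E)))) v D \<Longrightarrow>
    (hst (cdel (length E) \<Gamma>) (sub_partners (answer D A B v) E))\<^sup>+\<^sup>+
      (psub (chan (length E) (answer D A B v)) u) (psub (chan (length E) (answer D A B v)) u')"
proof (induction arbitrary: E rule: hst.induct)
  case (hst_elem \<Gamma> E' u u')
  let ?p = "answer D A B v"
  let ?\<theta> = "chan (length E) ?p"
  have p: "LC2_star (\<lambda>k. \<Gamma> (Suc (k + length E))) ?p (\<Gamma> (length E))"
    using has_type_answer[OF hst_elem.prems(4)] hst_elem.prems(3) by simp
  from hst_elem.hyps show ?case
  proof cases
    case (ct_basic h h' \<sigma>)
    then show ?thesis
      unfolding ct_basic psub_apps by (intro tranclp.r_into_trancl hst.hst_elem contracts.ct_basic basic_psub)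
  next
    case (ct_abort C A' B' \<sigma>)
    have u: "psub ?\<theta> u = apps (Abort A' B') (Arg (psub ?\<theta> u') # map (psube ?\<theta>) \<sigma>)"
      unfolding ct_abort(1) by (simp add: psub_apps)
    have "LC2_star (cdel (length E) \<Gamma>) (psub ?\<theta> u') C" "LC2_star (cdel (length E) \<Gamma>) (psub ?\<theta> u) C"
      using has_type_chan[OF _ p] ct_abort(2,3) unfolding ct_abort(1) by blast+
    then show ?thesis
      unfolding u by (intro tranclp.r_into_trancl hst.hst_elem contracts.ct_abort)
  next
    case (ct_comm j B' v' s \<sigma>)
    consider "j < length E" | "j = length E"
      using ct_comm(3) hst_elem.prems(1) by fastforce
    then show ?thesis
    proof cases
      case 1
      then have "sub_partners ?p E ! j = (B', psub (chan (length E - j) ?p) v')"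
        using ct_comm(4) hst_elem.prems(1) by (intro nth_sub_partners) (simp_all add: nth_append)
      moreover have "?\<theta> j = Var j"
        using 1 by (simp add: chan_def)
      ultimately have "contracts (cdel (length E) \<Gamma>) (sub_partners ?p E) (psub ?\<theta> u) (psub ?\<theta> u')"
        unfolding ct_comm(1,2) psub_apps psub_chan_reply[OF 1]
        using contracts.ct_comm[of j "sub_partners ?p E" B' _ "cdel (length E) \<Gamma>" "psub ?\<theta> s" "map (psube ?\<theta>) \<sigma>"] 1
        by simp
      then show ?thesis
        by (intro tranclp.r_into_trancl hst.hst_elem)
    next
      case 2
      then have "B' = B" "v' = v"
        using ct_comm(4) hst_elem.prems(1) by simp_all
      then show ?thesis
        using answer_steps[of \<Gamma> "length E" A B v D s \<sigma>] hst_elem.prems ct_comm 2 by simp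
    qed
  qed
next
  case (hst_left A' B' \<Gamma> w E' u u')
  have "LC2_star (case_nat (Imp A' B') \<Gamma>) u D"
    using hst_left.prems by blast
  then show ?case
    using hst_left.IH[of "(B', w) # E"] hst_left.prems by (simp add: tranclp_Par_left)
next
  case (hst_right A' B' \<Gamma> E' u w w')
  have ty: "LC2_star (case_nat (Imp A' B') \<Gamma>) u D" "LC2_star (case_nat (Imp B' A') \<Gamma>) w D"
    using hst_right.prems by blast+
  \<comment> \<open>The image of the right component may move only if the image of the left one is
    still normal.\<close>
  have "hnf (cdel (Suc (length E)) (case_nat (Imp A' B') \<Gamma>)) (Suc (length E)) (psub (chan (Suc (length E)) (answer D A B v)) u)"
    unfolding answer_def
    by (rule hnf_chan[OF hst_right.hyps(1) _ ty(1)])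
      (use hst_right.prems has_type_answer[OF hst_right.prems(4)] in \<open>simp_all add: answer_def\<close>)
  then show ?case
    using hst_right.IH[of "(A', u) # E"] hst_right.prems ty by (simp add: tranclp_Par_right)
qed

section \<open>Termination of parallel terms\<close>

abbreviation terminating :: "('f, 'p) ctx \<Rightarrow> ('f, 'p) trm \<Rightarrow> bool" where
  "terminating \<Gamma> \<equiv> Wellfounded.accp (\<lambda>t' t. hst \<Gamma> [] t t')"

lemma accp_iff_no_chain:
  "Wellfounded.accp (\<lambda>y x. r x y) t \<longleftrightarrow> \<not> (\<exists>s :: nat \<Rightarrow> 'a. s 0 = t \<and> (\<forall>i. r (s i) (s (Suc i))))"
proof
  assume "Wellfounded.accp (\<lambda>y x. r x y) t"
  then show "\<not> (\<exists>s :: nat \<Rightarrow> 'a. s 0 = t \<and> (\<forall>i. r (s i) (s (Suc i))))"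
  proof (induction rule: accp.induct)
    case (accI t)
    show ?case
    proof
      assume "\<exists>s :: nat \<Rightarrow> 'a. s 0 = t \<and> (\<forall>i. r (s i) (s (Suc i)))"
      then obtain s where s: "s 0 = t" "\<And>i. r (s i) (s (Suc i))"
        by blast
      then have "r t (s 1)"
        by (metis One_nat_def)
      moreover have "\<exists>s' :: nat \<Rightarrow> 'a. s' 0 = s 1 \<and> (\<forall>i. r (s' i) (s' (Suc i)))"
        using s by (intro exI[of _ "\<lambda>i. s (Suc i)"]) auto
      ultimately show False
        using accI by blast
    qed
  qed
next
  assume *: "\<not> (\<exists>s :: nat \<Rightarrow> 'a. s 0 = t \<and> (\<forall>i. r (s i) (s (Suc i))))"
  show "Wellfounded.accp (\<lambda>y x. r x y) t"
  proof (rule ccontr)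
    assume "\<not> Wellfounded.accp (\<lambda>y x. r x y) t"
    moreover have "\<exists>y. \<not> Wellfounded.accp (\<lambda>y x. r x y) y \<and> r x y"
      if "\<not> Wellfounded.accp (\<lambda>y x. r x y) x" for x
      using that accp.accI[of "\<lambda>y x. r x y" x] by blast
    ultimately have "\<exists>s. s 0 = t \<and> (\<forall>i. \<not> Wellfounded.accp (\<lambda>y x. r x y) (s i) \<and> r (s i) (s (Suc i)))"
      using dependent_nat_choice[of "\<lambda>n x. \<not> Wellfounded.accp (\<lambda>y x. r x y) x \<and> (n = 0 \<longrightarrow> x = t)" "\<lambda>_. r"]
      by (metis nat.distinct(1))
    then show False
      using * by blast
  qed
qed

text \<open>The transitive closure is used because one step of a parallel term can correspond to
  several steps of the term that simulates it.\<close>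

lemma terminating_induct [consumes 1, case_names step]:
  assumes "Wellfounded.accp (\<lambda>y x. r x y) t" "\<And>t. (\<And>u. r\<^sup>+\<^sup>+ t u \<Longrightarrow> P u) \<Longrightarrow> P t"
  shows "P t"
proof -
  from assms(1) have "\<forall>u. r\<^sup>*\<^sup>* t u \<longrightarrow> P u"
  proof (induction rule: accp.induct)
    case (accI t)
    have *: "P u" if tu: "r\<^sup>+\<^sup>+ t u" for u
    proof -
      obtain v where "r t v" "r\<^sup>*\<^sup>* v u"
        using tranclpD[OF tu] by (elim exE conjE)
      then show ?thesis
        using accI.IH[of v] by simp
    qed
    show ?case
    proof (intro allI impI)
      fix u
      assume "r\<^sup>*\<^sup>* t u"
      then consider "u = t" | "r\<^sup>+\<^sup>+ t u"
        by (auto dest: rtranclpD)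
      then show "P u"
        using * assms(2)[of t] by cases simp_all
    qed
  qed
  then show ?thesis
    by blast
qed

section \<open>Head normalizing terms and their closure properties\<close>

lemma HN_star_iff: "t \<in> HN_star \<Gamma> \<longleftrightarrow> (\<exists>A. LC2_star \<Gamma> t A) \<and> terminating \<Gamma> t"
  unfolding HN_star_def head_step_iff_hst accp_iff_no_chain by blast

text \<open>Determinism of head reduction makes \<open>t'\<close> the only successor of
  \<open>t\<close>.\<close>

lemma HN_star_expand:
  assumes "hst \<Gamma> [] t t'" "LC2_star \<Gamma> t A" "t' \<in> HN_star \<Gamma>"
  shows "t \<in> HN_star \<Gamma>"
proof -
  have "terminating \<Gamma> t"
  proof (rule accp.accI)
    fix u
    assume "hst \<Gamma> [] t u"
    then have "u = t'"
      using hst_det assms(1) by blast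
    then show "terminating \<Gamma> u"
      using assms(3) by (simp add: HN_star_iff)
  qed
  then show ?thesis
    using assms(2) by (auto simp: HN_star_iff)
qed

lemma HN_star_basic:
  assumes "basic h h'" "LC2_star \<Gamma> (apps h \<sigma>) A" "apps h' \<sigma> \<in> HN_star \<Gamma>"
  shows "apps h \<sigma> \<in> HN_star \<Gamma>"
  using HN_star_expand[OF hst_elem[OF ct_basic[OF assms(1)]]] assms by blast

lemma HN_star_hnf:
  assumes "hnf \<Gamma> 0 t" "LC2_star \<Gamma> t A"
  shows "t \<in> HN_star \<Gamma>"
proof -
  have "terminating \<Gamma> t"
    by (rule accp.accI) (use hst_not_hnf[of \<Gamma> "[]" t] assms(1) in auto)
  then show ?thesis
    using assms(2) by (auto simp: HN_star_iff)
qed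

text \<open>This covers values on the empty stack, \<open>Efq\<close> on any stack, and parallel
  terms that meet an individual term or a predicate, with which they do not commute.\<close>

lemma HN_star_stuck:
  assumes t: "LC2_star \<Gamma> (apps r \<sigma>) A" and r: "hd_of r = r" "\<forall>A B. r \<noteq> Abort A B"
    and Par: "\<And>A B u v. r = Par A B u v \<Longrightarrow> \<sigma> \<noteq> []"
    and no_redex: "\<And>\<xi> \<sigma>' h. \<sigma> = \<xi> # \<sigma>' \<Longrightarrow> \<not> basic (El r \<xi>) h"
  shows "apps r \<sigma> \<in> HN_star \<Gamma>"
proof -
  have spr: "sp r = []"
    using r(1) hd_of_hd_of(2) by metis
  have False if eq: "apps r \<sigma> = apps h \<tau>" and h_red: "basic h h'" for h h' \<tau>
  proof -
    obtain r' \<xi> where h: "h = El r' \<xi>" "hd_of r' = r'" "sp r' = []"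
      using basic_spine[OF h_red] by blast
    then have "r' = r" "\<sigma> = \<xi> # \<tau>"
      using arg_cong[OF eq, of hd_of] arg_cong[OF eq, of sp] r spr by auto
    then show False
      using no_redex h_red h by blast
  qed
  moreover have False if "apps r \<sigma> = apps (Abort A B) (Arg u # \<tau>)" for A B u \<tau>
  proof -
    have "hd_of (apps r \<sigma>) = Abort A B"
      unfolding that by simp
    then show False
      using r by simp
  qed
  ultimately have "\<not> active \<Gamma> 0 (apps r \<sigma>)"
    unfolding active_def by blast
  moreover have "apps r \<sigma> \<noteq> Par B C u v" for B C u v
  proof
    assume *: "apps r \<sigma> = Par B C u v"
    then have "sp (apps r \<sigma>) = []" "hd_of (apps r \<sigma>) = Par B C u v"
      by simp_all
    then show False
      using Par r by simp
  qed
  ultimately show ?thesis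
    using HN_star_hnf[OF hnf_elem t] by blast
qed

text \<open>A normal left component never moves again: the right component cannot change it. So the
  answer made from \<open>u\<close> is the same at every step, and the instance of \<open>v\<close>
  at this answer bounds the reduction.\<close>

lemma terminating_Par_right:
  assumes U: "hnf (case_nat (Imp A B) \<Gamma>) (Suc 0) u" "LC2_star (case_nat (Imp A B) \<Gamma>) u D"
    and V: "LC2_star (case_nat (Imp B A) \<Gamma>) v D" "terminating \<Gamma> (pinst v (answer D B A u))"
  shows "terminating \<Gamma> (Par A B u v)"
proof -
  \<comment> \<open>The induction is on the reduction of the instance, whereas \<open>v\<close>
    changes with each step; hence the quantifier.\<close>
  have "\<forall>v. t = pinst v (answer D B A u) \<longrightarrow> LC2_star (case_nat (Imp B A) \<Gamma>) v D \<longrightarrow>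
      terminating \<Gamma> (Par A B u v)" if "terminating \<Gamma> t" for t
    using that
  proof (induction t rule: terminating_induct)
    case (step t)
    show ?case
    proof (intro allI impI, rule accp.accI)
      fix v t'
      assume t: "t = pinst v (answer D B A u)" and v: "LC2_star (case_nat (Imp B A) \<Gamma>) v D"
        and red: "hst \<Gamma> [] (Par A B u v) t'"
      have "\<not> hst (case_nat (Imp A B) \<Gamma>) [(B, v)] u u'" for u'
        using hst_not_hnf[of _ "[(B, v)]" u u'] U(1) by auto
      with red obtain v' where v': "t' = Par A B u v'" "hst (case_nat (Imp B A) \<Gamma>) [(A, u)] v v'"
        by (elim hst_ParE) (simp_all add: contracts_not_Par)
      have "LC2_star (case_nat (Imp B A) \<Gamma>) v' D"
        by (rule hst_type[OF v'(2) _ v]) (simp add: well_partnered_Cons U)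
      moreover have "(hst \<Gamma> [])\<^sup>+\<^sup>+ t (pinst v' (answer D B A u))"
        using hst_simulation[OF v'(2), of "[]" A u D B] v U(2) by (simp add: chan_0 t)
      ultimately show "terminating \<Gamma> t'"
        using step v'(1) by blast
    qed
  qed
  then show ?thesis
    using V by blast
qed

text \<open>During the first phase \<open>v\<close> does not change, so one answer simulates it
  throughout. Which normal form the left component reaches is not known in advance, and therefore
  the hypothesis on the second phase ranges over all typed normal \<open>u\<close>.\<close>

lemma terminating_Par:
  assumes U: "LC2_star (case_nat (Imp A B) \<Gamma>) u D" "terminating \<Gamma> (pinst u (answer D A B v))"
    and V: "LC2_star (case_nat (Imp B A) \<Gamma>) v D"
      "\<And>u. hnf (case_nat (Imp A B) \<Gamma>) (Suc 0) u \<Longrightarrow> LC2_star (case_nat (Imp A B) \<Gamma>) u D \<Longrightarrow>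
        terminating \<Gamma> (pinst v (answer D B A u))"
  shows "terminating \<Gamma> (Par A B u v)"
proof -
  have "\<forall>u. t = pinst u (answer D A B v) \<longrightarrow> LC2_star (case_nat (Imp A B) \<Gamma>) u D \<longrightarrow>
      terminating \<Gamma> (Par A B u v)" if "terminating \<Gamma> t" for t
    using that
  proof (induction t rule: terminating_induct)
    case (step t)
    show ?case
    proof (intro allI impI)
      fix u
      assume t: "t = pinst u (answer D A B v)" and u: "LC2_star (case_nat (Imp A B) \<Gamma>) u D"
      show "terminating \<Gamma> (Par A B u v)"
      proof (cases "hnf (case_nat (Imp A B) \<Gamma>) (Suc 0) u")
        case True
        then show ?thesis
          using terminating_Par_right u V by blast
      next
        case False
        show ?thesis
        proof (rule accp.accI)
          fix t'
          assume "hst \<Gamma> [] (Par A B u v) t'"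
          then obtain u' where u': "t' = Par A B u' v" "hst (case_nat (Imp A B) \<Gamma>) [(B, v)] u u'"
            using False by (elim hst_ParE) (simp_all add: contracts_not_Par)
          have "LC2_star (case_nat (Imp A B) \<Gamma>) u' D"
            by (rule hst_type[OF u'(2) _ u]) (simp add: well_partnered_Cons V)
          moreover have "(hst \<Gamma> [])\<^sup>+\<^sup>+ t (pinst u' (answer D A B v))"
            using hst_simulation[OF u'(2), of "[]" B v D A] u V(1) by (simp add: chan_0 t)
          ultimately show "terminating \<Gamma> t'"
            using step u'(1) by blast
        qed
      qed
    qed
  qed
  then show ?thesis
    using U by blast
qed

text \<open>The stack is pushed into both components element by element. The answers already contain
  the component applied to the remaining stack, so they are the same at each stage, and
  \<open>D\<close> is the type after the last element.\<close>

lemma HN_star_Par: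
  "LC2_star \<Gamma> (apps (Par A B u v) \<sigma>) D \<Longrightarrow>
    apps (pinst u (answer D A B (apps v (map (prene Suc) \<sigma>)))) \<sigma> \<in> HN_star \<Gamma> \<Longrightarrow>
    (\<And>u. hnf (case_nat (Imp A B) \<Gamma>) (Suc 0) u \<Longrightarrow> LC2_star (case_nat (Imp A B) \<Gamma>) u D \<Longrightarrow>
      apps (pinst v (answer D B A u)) \<sigma> \<in> HN_star \<Gamma>) \<Longrightarrow>
    apps (Par A B u v) \<sigma> \<in> HN_star \<Gamma>"
proof (induction \<sigma> arbitrary: u v)
  case Nil
  then have "LC2_star (case_nat (Imp A B) \<Gamma>) u D" "LC2_star (case_nat (Imp B A) \<Gamma>) v D"
    by auto
  then have "terminating \<Gamma> (Par A B u v)"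
    using Nil.prems(2,3) by (intro terminating_Par) (auto simp: HN_star_iff)
  then show ?case
    using Nil.prems(1) unfolding HN_star_iff apps_simps by (intro conjI exI)
next
  case (Cons \<xi> \<sigma>)
  show ?case
  proof (cases "commuting \<xi>")
    case True
    let ?t = "Par A B (El u (prene Suc \<xi>)) (El v (prene Suc \<xi>))"
    have basic: "basic (El (Par A B u v) \<xi>) ?t"
      by (rule basic.intros(9)[OF True])
    have "\<exists>T. LC2_star \<Gamma> (El (Par A B u v) \<xi>) T"
      using Cons.prems(1) has_type_apps_head[of True \<Gamma> "El (Par A B u v) \<xi>" \<sigma>] by simp
    then obtain T where T: "LC2_star \<Gamma> (El (Par A B u v) \<xi>) T" ..
    have "LC2_star \<Gamma> (apps ?t \<sigma>) D"
      using has_type_apps_replace[OF _ T has_type_basic[OF basic T]] Cons.prems(1) by simp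
    then have "apps ?t \<sigma> \<in> HN_star \<Gamma>"
    proof (rule Cons.IH)
      show "apps (pinst (El u (prene Suc \<xi>)) (answer D A B (apps (El v (prene Suc \<xi>)) (map (prene Suc) \<sigma>)))) \<sigma>
          \<in> HN_star \<Gamma>"
        using Cons.prems(2) unfolding list.map apps_simps by (simp add: psube_prene)
    next
      fix u
      assume "hnf (case_nat (Imp A B) \<Gamma>) (Suc 0) u" "LC2_star (case_nat (Imp A B) \<Gamma>) u D"
      then show "apps (pinst (El v (prene Suc \<xi>)) (answer D B A u)) \<sigma> \<in> HN_star \<Gamma>"
        using Cons.prems(3)[of u] by (simp add: psube_prene)
    qed
    then show ?thesis
      using HN_star_basic[OF basic] Cons.prems(1) by simp
  next
    \<comment> \<open>An individual term or a predicate does not commute with a parallel term, so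
      the process is stuck and normal.\<close>
    case False
    then have "\<not> basic (El (Par A B u v) \<xi>) h" for h
      by (auto elim: basic.cases)
    then show ?thesis
      using Cons.prems(1) by (intro HN_star_stuck) auto
  qed
qed

section \<open>Opponents and stacks\<close>

text \<open>Nonemptiness of the argument list gives a meaning to \<open>hd ms\<close> and lets
  \<open>hd\<close> commute with substitution.\<close>

primrec opponents_ok :: "('f, 'p) ctx \<Rightarrow> ('f, 'p) ofm \<Rightarrow> bool" where
  "opponents_ok \<Gamma> Bot = True"
| "opponents_ok \<Gamma> (Pr P ms) = (case P of Inl p \<Rightarrow> True | Inr b \<Rightarrow> ms \<noteq> [] \<and> opponent \<Gamma> b)"
| "opponents_ok \<Gamma> (PV X m) = True"
| "opponents_ok \<Gamma> (And A B) = (opponents_ok \<Gamma> A \<and> opponents_ok \<Gamma> B)"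
| "opponents_ok \<Gamma> (Or A B) = (opponents_ok \<Gamma> A \<and> opponents_ok \<Gamma> B)"
| "opponents_ok \<Gamma> (Imp A B) = (opponents_ok \<Gamma> A \<and> opponents_ok \<Gamma> B)"
| "opponents_ok \<Gamma> (All A) = opponents_ok \<Gamma> A"
| "opponents_ok \<Gamma> (Ex A) = opponents_ok \<Gamma> A"
| "opponents_ok \<Gamma> (AllP A) = opponents_ok \<Gamma> A"

section \<open>Formulas with opponents and their erasure\<close>

definition embed :: "('f, 'p) fm \<Rightarrow> ('f, 'p) ofm" where
  "embed = map_fm id Inl"

lemma embed_simps [simp]:
  "embed Bot = Bot" "embed (Pr p ms) = Pr (Inl p) ms" "embed (PV X m) = PV X m"
  "embed (And A B) = And (embed A) (embed B)" "embed (Or A B) = Or (embed A) (embed B)"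
  "embed (Imp A B) = Imp (embed A) (embed B)" "embed (All A) = All (embed A)"
  "embed (Ex A) = Ex (embed A)" "embed (AllP A) = AllP (embed A)"
  by (simp_all add: embed_def tm.map_id0 tm.map_id)

lemma opponents_ok_fsubi [simp]: "opponents_ok \<Gamma> (fsubi \<rho> A) = opponents_ok \<Gamma> A"
  by (induction A arbitrary: \<rho>) (auto split: sum.split)

lemma opponents_ok_frenp [simp]: "opponents_ok \<Gamma> (frenp g A) = opponents_ok \<Gamma> A"
  by (induction A arbitrary: g) (auto split: sum.split)

lemma opponents_ok_fsub:
  "opponents_ok \<Gamma> A \<Longrightarrow> (\<And>X. opponents_ok \<Gamma> (S X)) \<Longrightarrow> opponents_ok \<Gamma> (fsub \<rho> S A)"
proof (induction A arbitrary: \<rho> S)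
  case (AllP A)
  then show ?case
    by (simp add: upp_def split: nat.split)
qed (auto simp: upi_def split: sum.split)

lemma opponents_ok_embed [simp]: "opponents_ok \<Gamma> (embed A)"
  by (induction A) simp_all

lemma embed_fsubi: "embed (fsubi \<rho> A) = fsubi \<rho> (embed A)"
  by (induction A arbitrary: \<rho>) (simp_all)

lemma embed_frenp: "embed (frenp g A) = frenp g (embed A)"
  by (induction A arbitrary: g) (simp_all)

lemma embed_upi: "(\<lambda>X. embed (upi S X)) = upi (\<lambda>X. embed (S X))"
  by (simp add: fun_eq_iff upi_def embed_fsubi)

lemma embed_upp: "(\<lambda>X. embed (upp S X)) = upp (\<lambda>X. embed (S X))"
  by (simp add: fun_eq_iff upp_def embed_frenp split: nat.split)

lemma embed_fsub: "embed (fsub \<rho> S A) = fsub \<rho> (\<lambda>X. embed (S X)) (embed A)"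
  by (induction A arbitrary: \<rho> S) (simp_all add: embed_upi embed_upp embed_fsubi)

lemma embed_fpinst: "embed (fpinst A B) = fpinst (embed A) (embed B)"
proof -
  have "(\<lambda>X. embed (case_nat B PVar X)) = case_nat (embed B) PVar"
    by (simp add: fun_eq_iff split: nat.split)
  then show ?thesis
    by (simp add: embed_fsub)
qed

text \<open>The type of an opponent lives outside the binders crossed so far. The condition makes
  \<open>\<rho>\<close> act on the outer variables as the mere change from \<open>i\<close> to
  \<open>i'\<close> binders, so the type itself is not altered.\<close>

lemma erase_fsubi: "opponents_ok \<Gamma> A \<Longrightarrow> (\<And>k. \<rho> (k + i) = V (k + i')) \<Longrightarrow>
    erase i' j (fsubi \<rho> A) = fsubi \<rho> (erase i j A)"
proof (induction A arbitrary: \<rho> i i' j)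
  case (Pr P ms)
  then show ?case
    by (auto simp: fsubi_fsubi hd_map tsub_case_nat split: sum.split)
next
  case (All A)
  then show ?case
    using All.IH[of "up \<rho>" "Suc i" "Suc i'"] by simp
next
  case (Ex A)
  then show ?case
    using Ex.IH[of "up \<rho>" "Suc i" "Suc i'"] by simp
qed simp_all

lemma erase_frenp: "(\<And>X. g (X + j) = X + j') \<Longrightarrow>
    erase i j' (frenp g A) = frenp g (erase i j A)"
proof (induction A arbitrary: g i j j')
  case (Pr P ms)
  then show ?case
    by (auto simp: fsubi_frenp[symmetric] frenp_frenp split: sum.split)
next
  case (AllP A)
  then show ?case
    using AllP.IH[of "upr g" "Suc j" "Suc j'"] by simp
qed simp_all

lemma erase_upi: "(\<And>X. opponents_ok \<Gamma> (S X)) \<Longrightarrow>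
    (\<lambda>X. erase (Suc (Suc i)) j (upi S X)) = upi (\<lambda>X. erase (Suc i) j (S X))"
  unfolding upi_def fun_eq_iff by (intro allI erase_fsubi[of \<Gamma>]) simp_all

lemma erase_upp: "(\<lambda>X. erase i (Suc j) (upp S X)) = upp (\<lambda>X. erase i j (S X))"
  by (simp add: fun_eq_iff upp_def erase_frenp[of Suc j "Suc j"] split: nat.split)

lemma opponents_ok_upi: "(\<And>X. opponents_ok \<Gamma> (S X)) \<Longrightarrow> opponents_ok \<Gamma> (upi S X)"
  by (simp add: upi_def)

lemma opponents_ok_upp: "(\<And>X. opponents_ok \<Gamma> (S X)) \<Longrightarrow> opponents_ok \<Gamma> (upp S X)"
  by (simp add: upp_def split: nat.split)

text \<open>Both substitutions must fix the variables outside the binders, up to the change of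
  depth, since the types of the opponents in \<open>A\<close> may mention them.\<close>

lemma erase_fsub: "opponents_ok \<Gamma> A \<Longrightarrow> (\<And>X. opponents_ok \<Gamma> (S X)) \<Longrightarrow>
    (\<And>k. \<rho> (k + i) = V (k + i')) \<Longrightarrow> (\<And>X. S (X + j) = PVar (X + j')) \<Longrightarrow>
    erase i' j' (fsub \<rho> S A) = fsub \<rho> (\<lambda>X. erase (Suc i') j' (S X)) (erase i j A)"
proof (induction A arbitrary: \<rho> S i i' j j')
  case (Pr P ms)
  then show ?case
    by (auto simp: fsub_fsubi fsub_frenp hd_map tsub_case_nat fsub_PVar split: sum.split)
next
  case (PV X m)
  then show ?case
    by (simp add: erase_fsubi[of \<Gamma> _ _ "Suc i'"])
next
  case (All A)
  then show ?case
    using All.IH[of "upi S" "up \<rho>" "Suc i" "Suc i'"]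
    by (simp add: erase_upi[of \<Gamma>] opponents_ok_upi) (simp add: upi_def)
next
  case (Ex A)
  then show ?case
    using Ex.IH[of "upi S" "up \<rho>" "Suc i" "Suc i'"]
    by (simp add: erase_upi[of \<Gamma>] opponents_ok_upi) (simp add: upi_def)
next
  case (AllP A)
  then show ?case
    using AllP.IH[of "upp S" \<rho> i i' "Suc j" "Suc j'"]
    by (simp add: erase_upp opponents_ok_upp) (simp add: upp_def)
qed simp_all

text \<open>An embedded formula contains no opponents of its own, only those brought in by
  \<open>S\<close>; so there is no type that \<open>\<rho>\<close> or \<open>S\<close> could
  disturb.\<close>

lemma erase_fsub_embed: "(\<And>X. opponents_ok \<Gamma> (S X)) \<Longrightarrow>
    erase i j (fsub \<rho> S (embed A)) = fsub \<rho> (\<lambda>X. erase (Suc i) j (S X)) A"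
proof (induction A arbitrary: \<rho> S i j)
  case (PV X m)
  then show ?case
    by (simp add: erase_fsubi[of \<Gamma> _ _ "Suc i"])
qed (simp_all add: erase_upi[of \<Gamma>] erase_upp opponents_ok_upi opponents_ok_upp)

lemma erase_finst: "opponents_ok \<Gamma> A \<Longrightarrow> erase 0 0 (finst A m) = finst (erase (Suc 0) 0 A) m"
  by (rule erase_fsubi) simp_all

lemma erase_opp_const [simp]: "erase (Suc 0) 0 (opp_const b) = fst b"
proof -
  have "fsubi (case_nat (V 0) (\<lambda>k. V (Suc k))) (fst b) = fst b"
    by (rule trans[OF arg_cong[where f = "\<lambda>r. fsubi r (fst b)"] fsubi_V])
      (simp add: fun_eq_iff split: nat.split)
  then show ?thesis
    by simp
qed

lemma erase_fpinst:
  assumes "opponents_ok \<Gamma> A" "opponent \<Gamma> b"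
  shows "erase 0 0 (fpinst A (opp_const b)) = fpinst (erase 0 (Suc 0) A) (fst b)"
proof -
  have "(\<lambda>X. erase (Suc 0) 0 (case_nat (opp_const b) PVar X)) = case_nat (fst b) PVar"
    using erase_opp_const[of b] by (simp only: fun_eq_iff split: nat.split) simp
  then show ?thesis
    using erase_fsub[of \<Gamma> A "case_nat (opp_const b) PVar" V 0 0 "Suc 0" 0] assms
    by (simp split: nat.split)
qed

section \<open>Typing of stacks and transfer between predicate environments\<close>

lemma adapted_Nil [simp]: "adapted \<Gamma> [] C"
  by (auto simp: adapted_def)

lemma adapted_Cons:
  "(\<And>t. LC2_star \<Gamma> t C \<Longrightarrow> LC2_star \<Gamma> (El t \<xi>) D) \<Longrightarrow> adapted \<Gamma> \<sigma> D \<Longrightarrow> adapted \<Gamma> (\<xi> # \<sigma>) C"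
  by (simp add: adapted_def)

text \<open>Induction on size rather than structure, because the quantifier cases descend to
  instances. For disjunction and existential quantification adaptedness is part of the definition,
  and opponents supply it at their constants.\<close>

lemma stacks_adapted: "opponents_ok \<Gamma> A \<Longrightarrow> \<sigma> \<in> stacks \<Gamma> A \<Longrightarrow> adapted \<Gamma> \<sigma> (erase 0 0 A)"
proof (induction "fsz A" arbitrary: A \<sigma> rule: less_induct)
  case less
  show ?case
  proof (cases A)
    case (Pr P ms)
    then show ?thesis
      using less.prems by (cases P) (auto simp: opponent_def)
  next
    case (And A1 A2)
    then show ?thesis
      using less.prems less.hyps[of A1] less.hyps[of A2]
      by (auto intro: adapted_Cons has_type.intros)
  next
    case (Or A1 A2)
    then show ?thesis
      using less.prems by auto
  next
    case (Imp A1 A2)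
    then show ?thesis
      using less.prems less.hyps[of A2]
      by (auto simp: realizes_wrt_def intro!: adapted_Cons intro: has_type.ty_app)
  next
    case (All A1)
    consider "\<sigma> = []" | m \<sigma>' where "\<sigma> = Ind m # \<sigma>'" "\<sigma>' \<in> stacks \<Gamma> (finst A1 m)"
      using less.prems All by auto
    then show ?thesis
    proof cases
      case 2
      then have "adapted \<Gamma> \<sigma>' (finst (erase (Suc 0) 0 A1) m)"
        using less.hyps[of "finst A1 m" \<sigma>'] less.prems All by (simp add: erase_finst[of \<Gamma>])
      then show ?thesis
        unfolding 2(1) All by (intro adapted_Cons[OF has_type.ty_ind]) simp_all
    qed simp
  next
    case (Ex A1)
    then show ?thesis
      using less.prems by auto
  next
    case (AllP A1)
    consider "\<sigma> = []" | b \<sigma>' where "\<sigma> = Prd (fst b) # \<sigma>'" "opponent \<Gamma> b"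
        "\<sigma>' \<in> stacks \<Gamma> (fpinst A1 (opp_const b))"
      using less.prems AllP by auto
    then show ?thesis
    proof cases
      case 2
      \<comment> \<open>A predicate variable and an opponent constant both have size 0, so
        instantiation leaves the size unchanged.\<close>
      have "fsz (fpinst A1 (opp_const b)) = fsz A1"
        by (simp add: fsz_fsub split: nat.split)
      moreover have "opponents_ok \<Gamma> (fpinst A1 (opp_const b))"
        using less.prems AllP 2(2) by (intro opponents_ok_fsub) (auto split: nat.split)
      ultimately have "adapted \<Gamma> \<sigma>' (fpinst (erase 0 (Suc 0) A1) (fst b))"
        using less.hyps[of "fpinst A1 (opp_const b)" \<sigma>'] less.prems AllP 2
        by (simp add: erase_fpinst[of \<Gamma>])
      then show ?thesis
        unfolding 2(1) AllP by (intro adapted_Cons[OF has_type.ty_prd]) simp_all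
    qed simp
  qed (use less.prems in simp_all)
qed

text \<open>This allows a formula to be exchanged for the opponent that collects its stacks.
  Equality of the erasures is required as well, since realizability and the case distinctions in
  stacks mention types. Induction is on the embedded formula, so the bodies in the environment may
  be arbitrarily large.\<close>

lemma stacks_fsub_cong:
  "(\<And>X. opponents_ok \<Gamma> (S X)) \<Longrightarrow> (\<And>X. opponents_ok \<Gamma> (S' X)) \<Longrightarrow>
    (\<And>X. erase (Suc 0) 0 (S X) = erase (Suc 0) 0 (S' X)) \<Longrightarrow>
    (\<And>X m. stacks \<Gamma> (finst (S X) m) = stacks \<Gamma> (finst (S' X) m)) \<Longrightarrow>
    stacks \<Gamma> (fsub \<rho> S (embed A)) = stacks \<Gamma> (fsub \<rho> S' (embed A))"
proof (induction A arbitrary: \<rho> S S')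
  case (And A B)
  show ?case
    using And.IH[of S S' \<rho>] And.prems by simp
next
  case (Or A B)
  show ?case
    using Or.IH[of S S' \<rho>] Or.prems
    by (simp add: realizes_wrt_def erase_fsub_embed[of \<Gamma>])
next
  case (Imp A B)
  show ?case
    using Imp.IH[of S S' \<rho>] Imp.prems
    by (simp add: realizes_wrt_def erase_fsub_embed[of \<Gamma>])
next
  case (All A)
  have "stacks \<Gamma> (fsub (case_nat m \<rho>) S (embed A)) = stacks \<Gamma> (fsub (case_nat m \<rho>) S' (embed A))" for m
    using All.prems by (rule All.IH)
  then show ?case
    by (simp add: finst_fsub)
next
  case (Ex A)
  have "stacks \<Gamma> (fsub (case_nat m \<rho>) S (embed A)) = stacks \<Gamma> (fsub (case_nat m \<rho>) S' (embed A))" for m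
    using Ex.prems by (rule Ex.IH)
  moreover have "erase (Suc 0) 0 (fsub (up \<rho>) (upi S) (embed A)) = erase (Suc 0) 0 (fsub (up \<rho>) (upi S') (embed A))"
    using Ex.prems by (simp add: erase_fsub_embed[of \<Gamma>] erase_upi[of \<Gamma>] opponents_ok_upi)
  ultimately show ?case
    using Ex.prems by (simp add: finst_fsub realizes_wrt_def erase_fsub_embed[of \<Gamma>])
next
  case (AllP A)
  \<comment> \<open>Both environments are extended by the same constant, for which the agreement
    conditions are trivial.\<close>
  have "stacks \<Gamma> (fsub \<rho> (case_nat (opp_const b) S) (embed A))
      = stacks \<Gamma> (fsub \<rho> (case_nat (opp_const b) S') (embed A))" if "opponent \<Gamma> b" for b
    using AllP.prems that by (intro AllP.IH) (auto split: nat.split)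
  then show ?case
    by (simp add: fpinst_fsub cong: conj_cong del: split_paired_Ex)
qed simp_all

lemma realizes_wrt_stacks [simp]: "realizes_wrt \<Gamma> A (stacks \<Gamma> A) t = realizes \<Gamma> t A"
  by (simp add: realizes_wrt_def realizes_def)

text \<open>Adaptedness makes every process formed with a stack of \<open>C\<close> typable, so a
  type \<open>E\<close> of the process can be assumed in each normalization proof.\<close>

lemma realizesI:
  assumes "opponents_ok \<Gamma> C" "LC2_star \<Gamma> t (erase 0 0 C)"
    "\<And>\<sigma> E. \<sigma> \<in> stacks \<Gamma> C \<Longrightarrow> LC2_star \<Gamma> (apps t \<sigma>) E \<Longrightarrow> apps t \<sigma> \<in> HN_star \<Gamma>"
  shows "realizes \<Gamma> t C"
  unfolding realizes_def using assms stacks_adapted unfolding adapted_def by blast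

section \<open>Adequacy\<close>

lemma
  fixes t :: "('f, 'p) trm" and \<xi> :: "('f, 'p) elm"
  shows fpv_psubt [simp]: "fpv (psubt \<rho> S t) = fpv t"
    and fpve_psubte [simp]: "fpve (psubte \<rho> S \<xi>) = fpve \<xi>"
  by (induction t and \<xi> arbitrary: \<rho> S and \<rho> S rule: trm.induct elm.induct) simp_all

lemma realizes_HN: "realizes \<Gamma> t C \<Longrightarrow> \<sigma> \<in> stacks \<Gamma> C \<Longrightarrow> apps t \<sigma> \<in> HN_star \<Gamma>"
  by (simp add: realizes_def)

lemma realizes_type: "realizes \<Gamma> t C \<Longrightarrow> LC2_star \<Gamma> t (erase 0 0 C)"
  by (simp add: realizes_def)

text \<open>These are the terms that replies put for the dual channel. Any argument is thrown away,
  and \<open>s\<close> is left facing a stack of its own formula.\<close>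

lemma realizes_const_Lam:
  assumes "opponents_ok \<Gamma> (Imp B A)" "realizes \<Gamma> s A"
  shows "realizes \<Gamma> (Lam (erase 0 0 B) (pren Suc s)) (Imp B A)"
proof (rule realizesI[OF assms(1)])
  show ty: "has_otype \<Gamma> (Lam (erase 0 0 B) (pren Suc s)) (Imp B A)"
    using realizes_type[OF assms(2)] by (simp add: has_type.ty_lam has_type_pren_Suc)
  fix \<sigma> E
  assume \<sigma>: "\<sigma> \<in> stacks \<Gamma> (Imp B A)" and E: "LC2_star \<Gamma> (apps (Lam (erase 0 0 B) (pren Suc s)) \<sigma>) E"
  consider "\<sigma> = []" | u \<tau> where "\<sigma> = Arg u # \<tau>" "\<tau> \<in> stacks \<Gamma> A"
    using \<sigma> by auto
  then show "apps (Lam (erase 0 0 B) (pren Suc s)) \<sigma> \<in> HN_star \<Gamma>"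
  proof cases
    case 1
    show ?thesis
      using E 1 by (intro HN_star_stuck) simp_all
  next
    case 2
    have "apps s \<tau> \<in> HN_star \<Gamma>"
      using realizes_HN assms(2) 2(2) by blast
    then show ?thesis
      using HN_star_basic[OF basic.intros(1), of \<Gamma> "erase 0 0 B" "pren Suc s" u \<tau>] E 2(1) by simp
  qed
qed

text \<open>If the process has the type of \<open>u\<close>, its only step leads to
  \<open>u\<close>. If the types differ, \<open>Abort\<close> cannot fire and the process is already
  normal.\<close>

lemma HN_star_Abort:
  assumes t: "LC2_star \<Gamma> (apps (El (Abort D B) (Arg u)) \<sigma>) E" and u: "u \<in> HN_star \<Gamma>"
  shows "apps (El (Abort D B) (Arg u)) \<sigma> \<in> HN_star \<Gamma>"
proof (cases "LC2_star \<Gamma> u E")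
  case True
  then have "hst \<Gamma> [] (apps (El (Abort D B) (Arg u)) \<sigma>) u"
    using ct_abort[OF True, of D B \<sigma> "[]"] t by (simp add: hst_elem)
  then show ?thesis
    using HN_star_expand t u by blast
next
  case False
  have "\<not> active \<Gamma> 0 (apps (El (Abort D B) (Arg u)) \<sigma>)"
  proof
    assume "active \<Gamma> 0 (apps (El (Abort D B) (Arg u)) \<sigma>)"
    then consider h h' \<tau> where "apps (El (Abort D B) (Arg u)) \<sigma> = apps h \<tau>" "basic h h'"
      | A' B' u' \<tau> C where "apps (El (Abort D B) (Arg u)) \<sigma> = apps (El (Abort A' B') (Arg u')) \<tau>"
        "LC2_star \<Gamma> u' C" "LC2_star \<Gamma> (apps (El (Abort D B) (Arg u)) \<sigma>) C"
      unfolding active_def by (auto simp del: ex_simps)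
    then show False
    proof cases
      case 1
      obtain r \<xi> where r: "h = El r \<xi>" "hd_of r = r" "\<And>A B. r \<noteq> Abort A B"
        using basic_spine[OF 1(2)] by blast
      have "hd_of (apps h \<tau>) = Abort D B"
        unfolding 1(1)[symmetric] by simp
      then show False
        using r by simp
    next
      case 2
      have "u' = u"
        using arg_cong[OF 2(1), of sp] by simp
      then show False
        using 2 t False has_type_unique by blast
    qed
  qed
  moreover have "apps (El (Abort D B) (Arg u)) \<sigma> \<noteq> Par A C v w" for A C v w
  proof
    assume "apps (El (Abort D B) (Arg u)) \<sigma> = Par A C v w"
    then have "hd_of (apps (El (Abort D B) (Arg u)) \<sigma>) = Par A C v w"
      by simp
    then show False
      by simp
  qed
  ultimately show ?thesis
    using HN_star_hnf[OF hnf_elem t] by blast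
qed

text \<open>After the beta step, \<open>Abort\<close> either discards the rest of the stack or is
  stuck. So normalization of the instance of \<open>v\<close> on the empty stack is enough, even
  when the type of the process is not \<open>D\<close>.\<close>

lemma realizes_answer:
  assumes ok: "opponents_ok \<Gamma> (Imp A B)" and v: "LC2_star (case_nat (Imp (erase 0 0 B) (erase 0 0 A)) \<Gamma>) v D"
    and HN: "\<And>s. realizes \<Gamma> s A \<Longrightarrow> pinst v (Lam (erase 0 0 B) (pren Suc s)) \<in> HN_star \<Gamma>"
  shows "realizes \<Gamma> (answer D (erase 0 0 A) (erase 0 0 B) v) (Imp A B)"
proof (rule realizesI[OF ok])
  let ?A = "erase 0 0 A" and ?B = "erase 0 0 B"
  show "has_otype \<Gamma> (answer D ?A ?B v) (Imp A B)"
    using has_type_answer[OF v] by simp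
  fix \<sigma> E
  assume \<sigma>: "\<sigma> \<in> stacks \<Gamma> (Imp A B)" and E: "LC2_star \<Gamma> (apps (answer D ?A ?B v) \<sigma>) E"
  consider "\<sigma> = []" | s \<tau> where "\<sigma> = Arg s # \<tau>" "realizes \<Gamma> s A"
    using \<sigma> by auto
  then show "apps (answer D ?A ?B v) \<sigma> \<in> HN_star \<Gamma>"
  proof cases
    case 1
    show ?thesis
      using E 1 unfolding answer_def by (intro HN_star_stuck) simp_all
  next
    case 2
    let ?h = "El (answer D ?A ?B v) (Arg s)"
      and ?h' = "El (Abort D ?B) (Arg (pinst v (Lam ?B (pren Suc s))))"
    have basic: "basic ?h ?h'"
      using basic.intros(1)[of ?A "El (Abort D ?B) (Arg (psub (case_nat (Lam ?B (Var 1)) (\<lambda>i. Var (Suc i))) v))" s]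
      unfolding psub.simps psube.simps pinst_answer answer_def .
    have E': "LC2_star \<Gamma> (apps ?h \<tau>) E"
      using E 2(1) by simp
    have "\<exists>T. LC2_star \<Gamma> ?h T"
      using has_type_apps_head[OF E'] .
    then obtain T where T: "LC2_star \<Gamma> ?h T" ..
    have "LC2_star \<Gamma> (apps ?h' \<tau>) E"
      by (rule has_type_apps_replace[OF E' T has_type_basic[OF basic T]])
    then have "apps ?h' \<tau> \<in> HN_star \<Gamma>"
      using HN_star_Abort HN[OF 2(2)] by blast
    then show ?thesis
      using HN_star_basic[OF basic E'] 2(1) by simp
  qed
qed

section \<open>Substitution instances as realizers\<close>

lemma psub_psubt_type:
  assumes w: "has_type s \<Delta> w A" and S: "\<And>X. opponents_ok \<Gamma> (S X)"
    and \<theta>: "\<And>i. i \<in> fpv w \<Longrightarrow> realizes \<Gamma> (\<theta> i) (fsub \<rho> S (embed (\<Delta> i)))"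
  shows "LC2_star \<Gamma> (psub \<theta> (psubt \<rho> (\<lambda>X. erase (Suc 0) 0 (S X)) w)) (erase 0 0 (fsub \<rho> S (embed A)))"
  unfolding erase_fsub_embed[OF S]
proof (rule has_type_psub[OF has_type_psubt[OF w]])
  fix i
  assume "i \<in> fpv (psubt \<rho> (\<lambda>X. erase (Suc 0) 0 (S X)) w)"
  then show "LC2_star \<Gamma> (\<theta> i) (fsub \<rho> (\<lambda>X. erase (Suc 0) 0 (S X)) (\<Delta> i))"
    using realizes_type[OF \<theta>] by (simp add: erase_fsub_embed[OF S])
qed

lemma has_type_apps_shift: "LC2_star \<Gamma> (apps t \<sigma>) D \<Longrightarrow> LC2_star \<Gamma> t T \<Longrightarrow>
    LC2_star (case_nat A \<Gamma>) t' T \<Longrightarrow> LC2_star (case_nat A \<Gamma>) (apps t' (map (prene Suc) \<sigma>)) D"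
proof (induction \<sigma> arbitrary: t t' T)
  case Nil
  then show ?case
    using has_type_unique[OF Nil.prems(1)[simplified] Nil.prems(2)] by simp
next
  case (Cons \<xi> \<sigma>)
  have "\<exists>U. LC2_star \<Gamma> (El t \<xi>) U"
    using has_type_apps_head[of True \<Gamma> "El t \<xi>" \<sigma>] Cons.prems(1) by simp
  then obtain U where U: "LC2_star \<Gamma> (El t \<xi>) U" ..
  show ?case
    using Cons.IH[OF _ U has_type_elm_shift[OF U Cons.prems(2,3)]] Cons.prems(1) by simp
qed

lemma psub_apps_shift: "pinst (apps t (map (prene Suc) \<sigma>)) s = apps (pinst t s) \<sigma>"
proof -
  have "map (psube (case_nat s Var) \<circ> prene Suc) \<sigma> = \<sigma>"
    by (simp add: map_idI psube_prene)
  then show ?thesis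
    by (simp add: psub_apps)
qed

lemma HN_star_value:
  assumes "LC2_star \<Gamma> (apps t []) E" "hd_of t = t" "\<forall>A B. t \<noteq> Abort A B" "\<forall>A B u v. t \<noteq> Par A B u v"
  shows "apps t [] \<in> HN_star \<Gamma>"
  using assms by (intro HN_star_stuck) auto

lemma pinst_ind_psub:
  "pinst_ind (psub (up_ind \<theta>) (psubt (up \<rho>) (upi S) t)) m = psub \<theta> (psubt (case_nat m \<rho>) S t)"
  by (simp add: psubt_psub pinst_ind_psubt)

lemma pinst_pinst_ind_psub:
  "pinst (pinst_ind (psub (up_pf (up_ind \<theta>)) (psubt (up \<rho>) (upi S) t)) m) s
    = psub (case_nat s \<theta>) (psubt (case_nat m \<rho>) S t)"
proof -
  have "(\<lambda>i. pinst_ind (up_pf (up_ind \<theta>) i) m) = up_pf \<theta>"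
    unfolding up_pf_psubt by simp
  then show ?thesis
    unfolding psubt_psub pinst_ind_psubt by (simp add: pinst_psub)
qed

lemma pinst_prd_psub:
  "pinst_prd (psub (up_prd \<theta>) (psubt \<rho> (upp S) t)) B = psub \<theta> (psubt \<rho> (case_nat B S) t)"
  by (simp add: psubt_psub pinst_prd_psubt)

lemma realizes_case_nat:
  assumes "realizes \<Gamma> t (fsub \<rho> S (embed A))"
    "\<And>i. Suc i \<in> I \<Longrightarrow> realizes \<Gamma> (\<theta> i) (fsub \<rho> S (embed (\<Delta> i)))" "i \<in> I"
  shows "realizes \<Gamma> (case_nat t \<theta> i) (fsub \<rho> S (embed (case_nat A \<Delta> i)))"
  using assms by (cases i) simp_all

lemma fsub_embed_ishift:
  "fsub (case_nat m \<rho>) S (embed (ishift A)) = fsub \<rho> S (embed A)"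
  by (simp add: embed_fsubi fsub_fsubi)

lemma fsub_embed_pshift:
  "fsub \<rho> (case_nat B S) (embed (pshift A)) = fsub \<rho> S (embed A)"
  by (simp add: embed_frenp fsub_frenp)

text \<open>Typing of the instance is settled once for all typing rules, leaving only the processes
  to be examined.\<close>

lemma realizes_psub_psubtI:
  assumes "has_type s \<Delta> w A" "\<And>X. opponents_ok \<Gamma> (S X)"
    "\<And>i. i \<in> fpv w \<Longrightarrow> realizes \<Gamma> (\<theta> i) (fsub \<rho> S (embed (\<Delta> i)))"
    "\<And>\<sigma> E. \<sigma> \<in> stacks \<Gamma> (fsub \<rho> S (embed A)) \<Longrightarrow>
      LC2_star \<Gamma> (apps (psub \<theta> (psubt \<rho> (\<lambda>X. erase (Suc 0) 0 (S X)) w)) \<sigma>) E \<Longrightarrow>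
      apps (psub \<theta> (psubt \<rho> (\<lambda>X. erase (Suc 0) 0 (S X)) w)) \<sigma> \<in> HN_star \<Gamma>"
  shows "realizes \<Gamma> (psub \<theta> (psubt \<rho> (\<lambda>X. erase (Suc 0) 0 (S X)) w)) (fsub \<rho> S (embed A))"
proof (rule realizesI)
  show "opponents_ok \<Gamma> (fsub \<rho> S (embed A))"
    using assms(2) by (simp add: opponents_ok_fsub)
  show "has_otype \<Gamma> (psub \<theta> (psubt \<rho> (\<lambda>X. erase (Suc 0) 0 (S X)) w)) (fsub \<rho> S (embed A))"
    using assms(1-3) by (rule psub_psubt_type)
qed (rule assms(4))

text \<open>The three environments are arbitrary because each kind of binder extends one of them:
  \<open>\<theta>\<close> for proofs, \<open>\<rho>\<close> for individuals, \<open>S\<close> for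
  predicates. The formula keeps the opponents in \<open>S\<close>, while the proof term receives
  their erasures.\<close>

theorem adequacy:
  assumes "LC2 \<Delta> w A" "\<And>X. opponents_ok \<Gamma> (S X)"
    "\<And>i. i \<in> fpv w \<Longrightarrow> realizes \<Gamma> (\<theta> i) (fsub \<rho> S (embed (\<Delta> i)))"
  shows "realizes \<Gamma> (psub \<theta> (psubt \<rho> (\<lambda>X. erase (Suc 0) 0 (S X)) w)) (fsub \<rho> S (embed A))"
  using assms
proof (induction \<Delta> w A arbitrary: \<theta> \<rho> S rule: has_type.induct)
  case (ty_var \<Delta> i)
  then show ?case
    by simp
next
  case (ty_pair \<Delta> u A t B)
  let ?S = "\<lambda>X. erase (Suc 0) 0 (S X)"
  let ?u = "psub \<theta> (psubt \<rho> ?S u)" and ?t = "psub \<theta> (psubt \<rho> ?S t)"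
  have IH: "realizes \<Gamma> ?u (fsub \<rho> S (embed A))" "realizes \<Gamma> ?t (fsub \<rho> S (embed B))"
    using ty_pair.prems by (intro ty_pair.IH; simp)+
  show ?case
  proof (rule realizes_psub_psubtI[OF has_type.ty_pair[OF ty_pair.hyps] ty_pair.prems])
    fix \<sigma> E
    assume \<sigma>: "\<sigma> \<in> stacks \<Gamma> (fsub \<rho> S (embed (And A B)))"
      and E: "LC2_star \<Gamma> (apps (psub \<theta> (psubt \<rho> ?S (Pair u t))) \<sigma>) E"
    consider "\<sigma> = []" | \<tau> where "\<sigma> = Proj0 # \<tau>" "\<tau> \<in> stacks \<Gamma> (fsub \<rho> S (embed A))"
      | \<tau> where "\<sigma> = Proj1 # \<tau>" "\<tau> \<in> stacks \<Gamma> (fsub \<rho> S (embed B))"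
      using \<sigma> by auto
    then show "apps (psub \<theta> (psubt \<rho> ?S (Pair u t))) \<sigma> \<in> HN_star \<Gamma>"
    proof cases
      case 1
      show ?thesis
        using E unfolding 1 by (rule HN_star_value) simp_all
    next
      case 2
      show ?thesis
        using HN_star_basic[OF basic.intros(4)[of ?u ?t], of \<Gamma> \<tau> E] E realizes_HN[OF IH(1) 2(2)]
        unfolding 2(1) by simp
    next
      case 3
      show ?thesis
        using HN_star_basic[OF basic.intros(5)[of ?u ?t], of \<Gamma> \<tau> E] E realizes_HN[OF IH(2) 3(2)]
        unfolding 3(1) by simp
    qed
  qed
next
  case (ty_proj0 \<Delta> u A B)
  let ?S = "\<lambda>X. erase (Suc 0) 0 (S X)"
  have IH: "realizes \<Gamma> (psub \<theta> (psubt \<rho> ?S u)) (fsub \<rho> S (embed (And A B)))"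
    using ty_proj0.prems by (intro ty_proj0.IH) simp_all
  show ?case
  proof (rule realizes_psub_psubtI[OF has_type.ty_proj0[OF ty_proj0.hyps] ty_proj0.prems])
    fix \<sigma>
    assume "\<sigma> \<in> stacks \<Gamma> (fsub \<rho> S (embed A))"
    then show "apps (psub \<theta> (psubt \<rho> ?S (El u Proj0))) \<sigma> \<in> HN_star \<Gamma>"
      using realizes_HN[OF IH, of "Proj0 # \<sigma>"] by simp
  qed
next
  case (ty_proj1 \<Delta> u A B)
  let ?S = "\<lambda>X. erase (Suc 0) 0 (S X)"
  have IH: "realizes \<Gamma> (psub \<theta> (psubt \<rho> ?S u)) (fsub \<rho> S (embed (And A B)))"
    using ty_proj1.prems by (intro ty_proj1.IH) simp_all
  show ?case
  proof (rule realizes_psub_psubtI[OF has_type.ty_proj1[OF ty_proj1.hyps] ty_proj1.prems])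
    fix \<sigma>
    assume "\<sigma> \<in> stacks \<Gamma> (fsub \<rho> S (embed B))"
    then show "apps (psub \<theta> (psubt \<rho> ?S (El u Proj1))) \<sigma> \<in> HN_star \<Gamma>"
      using realizes_HN[OF IH, of "Proj1 # \<sigma>"] by simp
  qed
next
  case (ty_app \<Delta> t A B u)
  let ?S = "\<lambda>X. erase (Suc 0) 0 (S X)"
  have IH: "realizes \<Gamma> (psub \<theta> (psubt \<rho> ?S t)) (fsub \<rho> S (embed (Imp A B)))"
    "realizes \<Gamma> (psub \<theta> (psubt \<rho> ?S u)) (fsub \<rho> S (embed A))"
    using ty_app.prems by (intro ty_app.IH; simp)+
  show ?case
  proof (rule realizes_psub_psubtI[OF has_type.ty_app[OF ty_app.hyps] ty_app.prems])
    fix \<sigma>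
    assume "\<sigma> \<in> stacks \<Gamma> (fsub \<rho> S (embed B))"
    then show "apps (psub \<theta> (psubt \<rho> ?S (El t (Arg u)))) \<sigma> \<in> HN_star \<Gamma>"
      using realizes_HN[OF IH(1), of "Arg (psub \<theta> (psubt \<rho> ?S u)) # \<sigma>"] IH(2) by simp
  qed
next
  case (ty_lam A \<Delta> u B)
  let ?S = "\<lambda>X. erase (Suc 0) 0 (S X)"
  show ?case
  proof (rule realizes_psub_psubtI[OF has_type.ty_lam[OF ty_lam.hyps] ty_lam.prems])
    fix \<sigma> E
    assume \<sigma>: "\<sigma> \<in> stacks \<Gamma> (fsub \<rho> S (embed (Imp A B)))"
      and E: "LC2_star \<Gamma> (apps (psub \<theta> (psubt \<rho> ?S (Lam A u))) \<sigma>) E"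
    consider "\<sigma> = []" | s \<tau> where "\<sigma> = Arg s # \<tau>" "realizes \<Gamma> s (fsub \<rho> S (embed A))"
        "\<tau> \<in> stacks \<Gamma> (fsub \<rho> S (embed B))"
      using \<sigma> by auto
    then show "apps (psub \<theta> (psubt \<rho> ?S (Lam A u))) \<sigma> \<in> HN_star \<Gamma>"
    proof cases
      case 1
      show ?thesis
        using E unfolding 1 by (rule HN_star_value) simp_all
    next
      case 2
      \<comment> \<open>The argument found on the stack extends \<open>\<theta>\<close>; this
        instance is the beta contractum.\<close>
      have "realizes \<Gamma> (psub (case_nat s \<theta>) (psubt \<rho> ?S u)) (fsub \<rho> S (embed B))"
        by (rule ty_lam.IH[OF ty_lam.prems(1)], erule realizes_case_nat[OF 2(2), rotated])
          (simp add: ty_lam.prems(2))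
      from realizes_HN[OF this 2(3)] show ?thesis
        using HN_star_basic[OF basic.intros(1), of \<Gamma> "fsub \<rho> ?S A" _ s \<tau> E] E
        unfolding 2(1) by (simp add: pinst_psub)
    qed
  qed
next
  case (ty_inj0 \<Delta> u A B)
  let ?S = "\<lambda>X. erase (Suc 0) 0 (S X)"
  let ?u = "psub \<theta> (psubt \<rho> ?S u)"
  have IH: "realizes \<Gamma> ?u (fsub \<rho> S (embed A))"
    using ty_inj0.prems by (intro ty_inj0.IH) simp_all
  show ?case
  proof (rule realizes_psub_psubtI[OF has_type.ty_inj0[OF ty_inj0.hyps] ty_inj0.prems])
    fix \<sigma> E
    assume \<sigma>: "\<sigma> \<in> stacks \<Gamma> (fsub \<rho> S (embed (Or A B)))"
      and E: "LC2_star \<Gamma> (apps (psub \<theta> (psubt \<rho> ?S (Inj0 B u))) \<sigma>) E"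
    consider "\<sigma> = []" | A' v B' w \<tau> where "\<sigma> = Cases A' v B' w # \<tau>" "apps (pinst v ?u) \<tau> \<in> HN_star \<Gamma>"
      using \<sigma> IH by auto
    then show "apps (psub \<theta> (psubt \<rho> ?S (Inj0 B u))) \<sigma> \<in> HN_star \<Gamma>"
    proof cases
      case 1
      show ?thesis
        using E unfolding 1 by (rule HN_star_value) simp_all
    next
      case 2
      show ?thesis
        using HN_star_basic[OF basic.intros(6)[of "fsub \<rho> ?S B" ?u A' v B' w], of \<Gamma> \<tau> E] E 2(2)
        unfolding 2(1) by simp
    qed
  qed
next
  case (ty_inj1 \<Delta> u B A)
  let ?S = "\<lambda>X. erase (Suc 0) 0 (S X)"
  let ?u = "psub \<theta> (psubt \<rho> ?S u)"
  have IH: "realizes \<Gamma> ?u (fsub \<rho> S (embed B))"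
    using ty_inj1.prems by (intro ty_inj1.IH) simp_all
  show ?case
  proof (rule realizes_psub_psubtI[OF has_type.ty_inj1[OF ty_inj1.hyps] ty_inj1.prems])
    fix \<sigma> E
    assume \<sigma>: "\<sigma> \<in> stacks \<Gamma> (fsub \<rho> S (embed (Or A B)))"
      and E: "LC2_star \<Gamma> (apps (psub \<theta> (psubt \<rho> ?S (Inj1 A u))) \<sigma>) E"
    consider "\<sigma> = []" | A' v B' w \<tau> where "\<sigma> = Cases A' v B' w # \<tau>" "apps (pinst w ?u) \<tau> \<in> HN_star \<Gamma>"
      using \<sigma> IH by auto
    then show "apps (psub \<theta> (psubt \<rho> ?S (Inj1 A u))) \<sigma> \<in> HN_star \<Gamma>"
    proof cases
      case 1
      show ?thesis
        using E unfolding 1 by (rule HN_star_value) simp_all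
    next
      case 2
      show ?thesis
        using HN_star_basic[OF basic.intros(7)[of "fsub \<rho> ?S A" ?u A' v B' w], of \<Gamma> \<tau> E] E 2(2)
        unfolding 2(1) by simp
    qed
  qed
next
  case (ty_cases \<Delta> u A B w1 C w2)
  let ?S = "\<lambda>X. erase (Suc 0) 0 (S X)"
  let ?u = "psub \<theta> (psubt \<rho> ?S u)" and ?C = "fsub \<rho> S (embed C)"
  let ?\<xi> = "psube \<theta> (psubte \<rho> ?S (Cases A w1 B w2))"
  have w: "has_type False \<Delta> (El u (Cases A w1 B w2)) C"
    using ty_cases.hyps by (rule has_type.ty_cases)
  have IH: "realizes \<Gamma> ?u (fsub \<rho> S (embed (Or A B)))"
    using ty_cases.prems by (intro ty_cases.IH) simp_all
  have IH1: "realizes \<Gamma> (psub (case_nat s \<theta>) (psubt \<rho> ?S w1)) ?C"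
    if "realizes \<Gamma> s (fsub \<rho> S (embed A))" for s
    by (rule ty_cases.IH(2)[OF ty_cases.prems(1)], erule realizes_case_nat[OF that, rotated])
      (simp add: ty_cases.prems(2))
  have IH2: "realizes \<Gamma> (psub (case_nat s \<theta>) (psubt \<rho> ?S w2)) ?C"
    if "realizes \<Gamma> s (fsub \<rho> S (embed B))" for s
    by (rule ty_cases.IH(3)[OF ty_cases.prems(1)], erule realizes_case_nat[OF that, rotated])
      (simp add: ty_cases.prems(2))
  have ty: "LC2_star \<Gamma> (El ?u ?\<xi>) (erase 0 0 ?C)"
    using psub_psubt_type[OF w ty_cases.prems] by simp
  show ?case
  proof (rule realizes_psub_psubtI[OF w ty_cases.prems])
    fix \<sigma>
    assume \<sigma>: "\<sigma> \<in> stacks \<Gamma> ?C"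
    \<comment> \<open>The case distinction, followed by the given stack, is to be a stack of the
      disjunction. Besides normalization of the branches this asks for adaptedness, which comes from
      the type of the whole elimination.\<close>
    have "adapted \<Gamma> (?\<xi> # \<sigma>) (erase 0 0 (fsub \<rho> S (embed (Or A B))))"
    proof (rule adapted_Cons)
      show "adapted \<Gamma> \<sigma> (erase 0 0 ?C)"
        using ty_cases.prems(1) \<sigma> by (intro stacks_adapted) (simp_all add: opponents_ok_fsub)
    qed (rule has_type_El_replace[OF ty realizes_type[OF IH]])
    then have "?\<xi> # \<sigma> \<in> stacks \<Gamma> (fsub \<rho> S (embed (Or A B)))"
      using realizes_HN[OF IH1 \<sigma>] realizes_HN[OF IH2 \<sigma>]
      by (simp add: erase_fsub_embed[OF ty_cases.prems(1)] pinst_psub)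
    then show "apps (psub \<theta> (psubt \<rho> ?S (El u (Cases A w1 B w2)))) \<sigma> \<in> HN_star \<Gamma>"
      using realizes_HN[OF IH, of "?\<xi> # \<sigma>"] by simp
  qed
next
  case (ty_ind \<Delta> u A m)
  let ?S = "\<lambda>X. erase (Suc 0) 0 (S X)"
  have IH: "realizes \<Gamma> (psub \<theta> (psubt \<rho> ?S u)) (fsub \<rho> S (embed (All A)))"
    using ty_ind.prems by (intro ty_ind.IH) simp_all
  show ?case
  proof (rule realizes_psub_psubtI[OF has_type.ty_ind[OF ty_ind.hyps] ty_ind.prems])
    fix \<sigma>
    assume "\<sigma> \<in> stacks \<Gamma> (fsub \<rho> S (embed (finst A m)))"
    then have "\<sigma> \<in> stacks \<Gamma> (finst (fsub (up \<rho>) (upi S) (embed A)) (tsub \<rho> m))"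
      by (simp only: embed_fsubi fsub_finst)
    then show "apps (psub \<theta> (psubt \<rho> ?S (El u (Ind m)))) \<sigma> \<in> HN_star \<Gamma>"
      using realizes_HN[OF IH, of "Ind (tsub \<rho> m) # \<sigma>"] by simp
  qed
next
  case (ty_ilam \<Delta> u A)
  let ?S = "\<lambda>X. erase (Suc 0) 0 (S X)"
  have upi: "upi ?S = (\<lambda>X. erase (Suc (Suc 0)) 0 (upi S X))"
    using erase_upi[of \<Gamma> S 0 0] ty_ilam.prems(1) by simp
  show ?case
  proof (rule realizes_psub_psubtI[OF has_type.ty_ilam[OF ty_ilam.hyps] ty_ilam.prems])
    fix \<sigma> E
    assume \<sigma>: "\<sigma> \<in> stacks \<Gamma> (fsub \<rho> S (embed (All A)))"
      and E: "LC2_star \<Gamma> (apps (psub \<theta> (psubt \<rho> ?S (ILam u))) \<sigma>) E"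
    consider "\<sigma> = []" | m \<tau> where "\<sigma> = Ind m # \<tau>" "\<tau> \<in> stacks \<Gamma> (fsub (case_nat m \<rho>) S (embed A))"
      using \<sigma> by (auto simp: finst_fsub)
    then show "apps (psub \<theta> (psubt \<rho> ?S (ILam u))) \<sigma> \<in> HN_star \<Gamma>"
    proof cases
      case 1
      show ?thesis
        using E unfolding 1 by (rule HN_star_value) simp_all
    next
      case 2
      \<comment> \<open>The eigenvariable is interpreted by the \<open>m\<close> on the stack; the
        shifted context ignores it, so \<open>\<theta>\<close> still realizes the
        hypotheses.\<close>
      have "realizes \<Gamma> (psub \<theta> (psubt (case_nat m \<rho>) ?S u)) (fsub (case_nat m \<rho>) S (embed A))"
        by (rule ty_ilam.IH[OF ty_ilam.prems(1)]) (simp add: fsub_embed_ishift ty_ilam.prems(2))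
      from realizes_HN[OF this 2(2)] show ?thesis
        using HN_star_basic[OF basic.intros(2), of \<Gamma> "psub (up_ind \<theta>) (psubt (up \<rho>) (upi ?S) u)" m \<tau> E] E
        unfolding 2(1) by (simp add: pinst_ind_psub)
    qed
  qed
next
  case (ty_pack \<Delta> u A m)
  let ?S = "\<lambda>X. erase (Suc 0) 0 (S X)"
  let ?u = "psub \<theta> (psubt \<rho> ?S u)"
  have "realizes \<Gamma> ?u (fsub \<rho> S (embed (finst A m)))"
    using ty_pack.prems by (intro ty_pack.IH) simp_all
  then have IH: "realizes \<Gamma> ?u (finst (fsub (up \<rho>) (upi S) (embed A)) (tsub \<rho> m))"
    by (simp only: embed_fsubi fsub_finst)
  show ?case
  proof (rule realizes_psub_psubtI[OF has_type.ty_pack[OF ty_pack.hyps] ty_pack.prems])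
    fix \<sigma> E
    assume \<sigma>: "\<sigma> \<in> stacks \<Gamma> (fsub \<rho> S (embed (Ex A)))"
      and E: "LC2_star \<Gamma> (apps (psub \<theta> (psubt \<rho> ?S (Pack A m u))) \<sigma>) E"
    consider "\<sigma> = []" | A' v \<tau> where "\<sigma> = ExCase A' v # \<tau>"
        "apps (pinst (pinst_ind v (tsub \<rho> m)) ?u) \<tau> \<in> HN_star \<Gamma>"
      using \<sigma> IH by auto
    then show "apps (psub \<theta> (psubt \<rho> ?S (Pack A m u))) \<sigma> \<in> HN_star \<Gamma>"
    proof cases
      case 1
      show ?thesis
        using E unfolding 1 by (rule HN_star_value) simp_all
    next
      case 2
      show ?thesis
        using HN_star_basic[OF basic.intros(8), of \<Gamma> "fsub (up \<rho>) (upi ?S) A" "tsub \<rho> m" ?u A' v \<tau> E] E 2(2)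
        unfolding 2(1) by simp
    qed
  qed
next
  case (ty_excase \<Delta> u A t C)
  let ?S = "\<lambda>X. erase (Suc 0) 0 (S X)"
  let ?u = "psub \<theta> (psubt \<rho> ?S u)" and ?C = "fsub \<rho> S (embed C)"
  let ?\<xi> = "psube \<theta> (psubte \<rho> ?S (ExCase A t))"
  have w: "has_type False \<Delta> (El u (ExCase A t)) C"
    using ty_excase.hyps by (rule has_type.ty_excase)
  have IH: "realizes \<Gamma> ?u (fsub \<rho> S (embed (Ex A)))"
    using ty_excase.prems by (intro ty_excase.IH) simp_all
  have IH': "realizes \<Gamma> (psub (case_nat s \<theta>) (psubt (case_nat m \<rho>) ?S t)) ?C"
    if "realizes \<Gamma> s (fsub (case_nat m \<rho>) S (embed A))" for s m
    unfolding fsub_embed_ishift[of m \<rho> S C, symmetric]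
    by (rule ty_excase.IH(2)[OF ty_excase.prems(1)], erule realizes_case_nat[OF that, rotated])
      (simp add: fsub_embed_ishift ty_excase.prems(2))
  have ty: "LC2_star \<Gamma> (El ?u ?\<xi>) (erase 0 0 ?C)"
    using psub_psubt_type[OF w ty_excase.prems] by simp
  show ?case
  proof (rule realizes_psub_psubtI[OF w ty_excase.prems])
    fix \<sigma>
    assume \<sigma>: "\<sigma> \<in> stacks \<Gamma> ?C"
    have "adapted \<Gamma> (?\<xi> # \<sigma>) (erase 0 0 (fsub \<rho> S (embed (Ex A))))"
    proof (rule adapted_Cons)
      show "adapted \<Gamma> \<sigma> (erase 0 0 ?C)"
        using ty_excase.prems(1) \<sigma> by (intro stacks_adapted) (simp_all add: opponents_ok_fsub)
    qed (rule has_type_El_replace[OF ty realizes_type[OF IH]])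
    moreover have "fsub (up \<rho>) (upi ?S) A = erase (Suc 0) 0 (fsub (up \<rho>) (upi S) (embed A))"
      using erase_fsub_embed[of \<Gamma> "upi S" "Suc 0" 0 "up \<rho>" A] erase_upi[of \<Gamma> S 0 0] ty_excase.prems(1)
      by (simp add: opponents_ok_upi)
    ultimately have "?\<xi> # \<sigma> \<in> stacks \<Gamma> (fsub \<rho> S (embed (Ex A)))"
      using realizes_HN[OF IH' \<sigma>] by (simp add: finst_fsub pinst_pinst_ind_psub)
    then show "apps (psub \<theta> (psubt \<rho> ?S (El u (ExCase A t)))) \<sigma> \<in> HN_star \<Gamma>"
      using realizes_HN[OF IH, of "?\<xi> # \<sigma>"] by simp
  qed
next
  case (ty_par A B \<Delta> u C v)
  let ?S = "\<lambda>X. erase (Suc 0) 0 (S X)"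
  let ?u = "psub (up_pf \<theta>) (psubt \<rho> ?S u)" and ?v = "psub (up_pf \<theta>) (psubt \<rho> ?S v)"
  let ?A = "fsub \<rho> S (embed A)" and ?B = "fsub \<rho> S (embed B)" and ?C = "fsub \<rho> S (embed C)"
  let ?A' = "erase 0 0 ?A" and ?B' = "erase 0 0 ?B"
  have w: "has_type False \<Delta> (Par A B u v) C"
    using ty_par.hyps by (rule has_type.ty_par)
  have ok: "opponents_ok \<Gamma> (Imp ?A ?B)" "opponents_ok \<Gamma> (Imp ?B ?A)"
    using ty_par.prems(1) by (simp_all add: opponents_ok_fsub)
  have IHu: "realizes \<Gamma> (pinst ?u p) ?C" if "realizes \<Gamma> p (Imp ?A ?B)" for p
    unfolding pinst_psub
    by (rule ty_par.IH(1)[OF ty_par.prems(1)], erule realizes_case_nat[rotated 2])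
      (use that in \<open>simp_all add: ty_par.prems(2)\<close>)
  have IHv: "realizes \<Gamma> (pinst ?v p) ?C" if "realizes \<Gamma> p (Imp ?B ?A)" for p
    unfolding pinst_psub
    by (rule ty_par.IH(2)[OF ty_par.prems(1)], erule realizes_case_nat[rotated 2])
      (use that in \<open>simp_all add: ty_par.prems(2)\<close>)
  have par: "psub \<theta> (psubt \<rho> ?S (Par A B u v)) = Par ?A' ?B' ?u ?v"
    by (simp add: erase_fsub_embed[OF ty_par.prems(1)])
  have ty: "LC2_star \<Gamma> (Par ?A' ?B' ?u ?v) (erase 0 0 ?C)"
    using psub_psubt_type[OF w ty_par.prems] unfolding par .
  then have ty_v: "LC2_star (case_nat (Imp ?B' ?A') \<Gamma>) ?v (erase 0 0 ?C)"
    by blast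
  show ?case
  proof (rule realizes_psub_psubtI[OF w ty_par.prems], unfold par)
    fix \<sigma> E
    assume \<sigma>: "\<sigma> \<in> stacks \<Gamma> ?C" and E: "LC2_star \<Gamma> (apps (Par ?A' ?B' ?u ?v) \<sigma>) E"
    show "apps (Par ?A' ?B' ?u ?v) \<sigma> \<in> HN_star \<Gamma>"
    proof (rule HN_star_Par[OF E])
      \<comment> \<open>The answer is taken at \<open>E\<close>, the type of the full process, and
        made from \<open>?v\<close> already applied to the stack.\<close>
      have "realizes \<Gamma> (answer E ?A' ?B' (apps ?v (map (prene Suc) \<sigma>))) (Imp ?A ?B)"
      proof (rule realizes_answer[OF ok(1) has_type_apps_shift[OF E ty ty_v]])
        fix s
        assume "realizes \<Gamma> s ?A"
        then have "realizes \<Gamma> (pinst ?v (Lam ?B' (pren Suc s))) ?C"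
          by (intro IHv realizes_const_Lam ok)
        from realizes_HN[OF this \<sigma>]
        show "pinst (apps ?v (map (prene Suc) \<sigma>)) (Lam ?B' (pren Suc s)) \<in> HN_star \<Gamma>"
          unfolding psub_apps_shift .
      qed
      from realizes_HN[OF IHu[OF this] \<sigma>]
      show "apps (pinst ?u (answer E ?A' ?B' (apps ?v (map (prene Suc) \<sigma>)))) \<sigma> \<in> HN_star \<Gamma>" .
    next
      fix u'
      assume hnf: "hnf (case_nat (Imp ?A' ?B') \<Gamma>) (Suc 0) u'"
        and u': "LC2_star (case_nat (Imp ?A' ?B') \<Gamma>) u' E"
      \<comment> \<open>All that is known of \<open>u'\<close> is that it is typed and normal. By
        \<open>hnf_chan\<close> it stays normal with a constant abstraction for its channel, and
        this is all that \<open>realizes_answer\<close> asks.\<close>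
      have "realizes \<Gamma> (answer E ?B' ?A' u') (Imp ?B ?A)"
      proof (rule realizes_answer[OF ok(2) u'])
        fix s
        assume "realizes \<Gamma> s ?B"
        then have "LC2_star \<Gamma> (Lam ?A' (pren Suc s)) (Imp ?A' ?B')"
          using realizes_type has_type_pren_Suc has_type.ty_lam by blast
        then have "hnf \<Gamma> 0 (pinst u' (Lam ?A' (pren Suc s)))"
          "LC2_star \<Gamma> (pinst u' (Lam ?A' (pren Suc s))) E"
          using hnf_chan[OF hnf refl u', of ?A' "pren Suc s"] has_type_pinst[OF u']
          by (simp_all add: chan_0)
        then show "pinst u' (Lam ?A' (pren Suc s)) \<in> HN_star \<Gamma>"
          by (rule HN_star_hnf)
      qed
      from realizes_HN[OF IHv[OF this] \<sigma>]
      show "apps (pinst ?v (answer E ?B' ?A' u')) \<sigma> \<in> HN_star \<Gamma>" .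
    qed
  qed
next
  case (ty_efq \<Delta> u P)
  let ?S = "\<lambda>X. erase (Suc 0) 0 (S X)"
  show ?case
  proof (rule realizes_psub_psubtI[OF has_type.ty_efq[OF ty_efq.hyps] ty_efq.prems])
    fix \<sigma> E
    assume "LC2_star \<Gamma> (apps (psub \<theta> (psubt \<rho> ?S (Efq P u))) \<sigma>) E"
    \<comment> \<open>No basic reduction eliminates an \<open>Efq\<close>, so the process is normal
      on every stack.\<close>
    then show "apps (psub \<theta> (psubt \<rho> ?S (Efq P u))) \<sigma> \<in> HN_star \<Gamma>"
      by (rule HN_star_stuck) (auto elim: basic.cases)
  qed
next
  case (ty_plam \<Delta> t A)
  let ?S = "\<lambda>X. erase (Suc 0) 0 (S X)"
  show ?case
  proof (rule realizes_psub_psubtI[OF has_type.ty_plam[OF ty_plam.hyps] ty_plam.prems])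
    fix \<sigma> E
    assume \<sigma>: "\<sigma> \<in> stacks \<Gamma> (fsub \<rho> S (embed (AllP A)))"
      and E: "LC2_star \<Gamma> (apps (psub \<theta> (psubt \<rho> ?S (PLam t))) \<sigma>) E"
    consider "\<sigma> = []" | b \<tau> where "\<sigma> = Prd (fst b) # \<tau>" "opponent \<Gamma> b"
        "\<tau> \<in> stacks \<Gamma> (fsub \<rho> (case_nat (opp_const b) S) (embed A))"
      using \<sigma> by (auto simp: fpinst_fsub simp del: split_paired_Ex)
    then show "apps (psub \<theta> (psubt \<rho> ?S (PLam t))) \<sigma> \<in> HN_star \<Gamma>"
    proof cases
      case 1
      show ?thesis
        using E unfolding 1 by (rule HN_star_value) simp_all
    next
      case 2
      \<comment> \<open>The opponent behind the stack interprets the bound predicate variable; its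
        erasure is the formula that the stack passes to \<open>PLam\<close>.\<close>
      let ?S' = "case_nat (opp_const b) S"
      have S': "(\<lambda>X. erase (Suc 0) 0 (?S' X)) = case_nat (fst b) ?S"
        unfolding case_nat_comp erase_opp_const ..
      have "realizes \<Gamma> (psub \<theta> (psubt \<rho> (\<lambda>X. erase (Suc 0) 0 (?S' X)) t)) (fsub \<rho> ?S' (embed A))"
        by (rule ty_plam.IH)
          (simp_all add: ty_plam.prems fsub_embed_pshift 2(2) split: nat.split)
      from realizes_HN[OF this[unfolded S'] 2(3)] show ?thesis
        using HN_star_basic[OF basic.intros(3), of \<Gamma> "psub (up_prd \<theta>) (psubt \<rho> (upp ?S) t)" "fst b" \<tau> E] E
        unfolding 2(1) by (simp add: pinst_prd_psub)
    qed
  qed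
next
  case (ty_prd \<Delta> t A B)
  let ?S = "\<lambda>X. erase (Suc 0) 0 (S X)"
  let ?B = "fsub (up \<rho>) (upi S) (embed B)"
  \<comment> \<open>The canonical opponent of the instantiating formula: at \<open>m\<close> it
    plays all the stacks of that formula at \<open>m\<close>.\<close>
  define b where "b = (erase (Suc 0) 0 ?B, \<lambda>m. stacks \<Gamma> (finst ?B m))"
  have ok: "opponents_ok \<Gamma> ?B"
    using ty_prd.prems(1) by (simp add: opponents_ok_fsub opponents_ok_upi)
  have b: "opponent \<Gamma> b"
    using stacks_adapted[of \<Gamma> "finst ?B m" for m] ok
    by (auto simp: opponent_def b_def erase_finst[of \<Gamma>])
  have IH: "realizes \<Gamma> (psub \<theta> (psubt \<rho> ?S t)) (fsub \<rho> S (embed (AllP A)))"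
    using ty_prd.prems by (intro ty_prd.IH) simp_all
  \<comment> \<open>The formula and its canonical opponent have the same stacks at every term and
    the same erasure, so they are interchangeable inside \<open>A\<close>. This turns a stack for
    the instance into one for the quantified formula.\<close>
  have "stacks \<Gamma> (fsub \<rho> (case_nat ?B S) (embed A)) = stacks \<Gamma> (fsub \<rho> (case_nat (opp_const b) S) (embed A))"
  proof (rule stacks_fsub_cong)
    fix X m
    show "opponents_ok \<Gamma> (case_nat ?B S X)" "opponents_ok \<Gamma> (case_nat (opp_const b) S X)"
      using ok b ty_prd.prems(1) by (simp_all split: nat.split)
    show "erase (Suc 0) 0 (case_nat ?B S X) = erase (Suc 0) 0 (case_nat (opp_const b) S X)"
      using erase_opp_const[of b] by (cases X) (simp_all add: b_def)
    show "stacks \<Gamma> (finst (case_nat ?B S X) m) = stacks \<Gamma> (finst (case_nat (opp_const b) S X) m)"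
      by (cases X) (simp_all add: b_def)
  qed
  then have st: "stacks \<Gamma> (fsub \<rho> S (embed (fpinst A B))) = stacks \<Gamma> (fpinst (fsub \<rho> (upp S) (embed A)) (opp_const b))"
    by (simp only: embed_fpinst fsub_fpinst fpinst_fsub)
  have B: "fsub (up \<rho>) (upi ?S) B = fst b"
    using erase_fsub_embed[of \<Gamma> "upi S" "Suc 0" 0 "up \<rho>" B] erase_upi[of \<Gamma> S 0 0] ty_prd.prems(1)
    by (simp add: opponents_ok_upi b_def)
  show ?case
  proof (rule realizes_psub_psubtI[OF has_type.ty_prd[OF ty_prd.hyps] ty_prd.prems])
    fix \<sigma>
    assume "\<sigma> \<in> stacks \<Gamma> (fsub \<rho> S (embed (fpinst A B)))"
    then have "Prd (fst b) # \<sigma> \<in> stacks \<Gamma> (fsub \<rho> S (embed (AllP A)))"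
      using b unfolding st by (auto simp del: split_paired_Ex)
    from realizes_HN[OF IH this]
    show "apps (psub \<theta> (psubt \<rho> ?S (El t (Prd B)))) \<sigma> \<in> HN_star \<Gamma>"
      by (simp add: B)
  qed
qed simp

section \<open>Environments given by lists\<close>

lemma asg_notin: "x \<notin> set xs \<Longrightarrow> asg d xs ts x = d x"
  by (cases "map_of (zip xs ts) x") (auto simp: asg_def dest!: map_of_SomeD set_zip_leftD)

lemma asg_nth: "distinct xs \<Longrightarrow> length ts = length xs \<Longrightarrow> i < length xs \<Longrightarrow> asg d xs ts (xs ! i) = ts ! i"
  by (simp add: asg_def map_of_zip_nth)

theorem theorem5p7:
  fixes \<Gamma> \<Delta> :: "('f, 'p) ctx"
    and w :: "('f, 'p) trm" and A :: "('f, 'p) fm"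
    and xs :: "nat list" and As :: "('f, 'p) fm list" and ts :: "('f, 'p) trm list"
    and \<alpha>s :: "nat list" and rs :: "'f tm list"
    and Xs :: "nat list" and bs :: "('f, 'p) opp list"
  assumes w: "LC2 \<Delta> w A"
    and xs: "distinct xs" "map \<Delta> xs = As" "fpv w \<subseteq> set xs"
    and \<alpha>s: "distinct \<alpha>s" "length rs = length \<alpha>s"
    and Xs: "distinct Xs" "length bs = length Xs"
    and bs: "\<forall>b\<in>set bs. opponent \<Gamma> b"
    and ts: "length ts = length xs"
      "\<forall>i<length xs. realizes \<Gamma> (ts ! i) (bar \<alpha>s rs Xs bs (As ! i))"
  shows "realizes \<Gamma>
    (psub (asg Var xs ts) (psubt (asg V \<alpha>s rs) (asg PVar Xs (map fst bs)) w))
    (bar \<alpha>s rs Xs bs A)"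
proof -
  define S :: "nat \<Rightarrow> ('f, 'p) ofm" where "S = asg PVar Xs (map opp_const bs)"
  \<comment> \<open>A variable outside \<open>Xs\<close> is left in place; it contains no opponent
    and is its own erasure.\<close>
  have S: "opponents_ok \<Gamma> (S X) \<and> erase (Suc 0) 0 (S X) = asg PVar Xs (map fst bs) X" for X
  proof (cases "X \<in> set Xs")
    case True
    then obtain k where k: "k < length Xs" "X = Xs ! k"
      by (metis in_set_conv_nth)
    then have "S X = opp_const (bs ! k)" "asg PVar Xs (map fst bs) X = fst (bs ! k)"
      unfolding k(2) S_def using Xs k(1) by (subst asg_nth; simp)+
    moreover have "opponent \<Gamma> (bs ! k)"
      using bs k(1) Xs(2) by simp
    ultimately show ?thesis
      unfolding erase_opp_const by (simp only: opponents_ok.simps sum.case erase_opp_const) simp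
  next
    case False
    then show ?thesis
      by (simp add: S_def asg_notin)
  qed
  then have eS: "asg PVar Xs (map fst bs) = (\<lambda>X. erase (Suc 0) 0 (S X))"
    by (intro ext) (metis)
  \<comment> \<open>For a free variable of \<open>w\<close>, the default \<open>Var\<close> of the
    assignment is never reached.\<close>
  have "realizes \<Gamma> (asg Var xs ts i) (fsub (asg V \<alpha>s rs) S (embed (\<Delta> i)))" if i: "i \<in> fpv w" for i
  proof -
    obtain k where k: "k < length xs" "i = xs ! k"
      using subsetD[OF xs(3) i] by (auto simp: in_set_conv_nth)
    then have "As ! k = \<Delta> i"
      unfolding xs(2)[symmetric] by simp
    then have "realizes \<Gamma> (ts ! k) (fsub (asg V \<alpha>s rs) S (embed (\<Delta> i)))"
      using ts(2) k(1) unfolding bar_def embed_def S_def by metis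
    then show ?thesis
      unfolding k(2) using asg_nth[OF xs(1) ts(1) k(1)] by metis
  qed
  then have "realizes \<Gamma> (psub (asg Var xs ts) (psubt (asg V \<alpha>s rs) (\<lambda>X. erase (Suc 0) 0 (S X)) w))
      (fsub (asg V \<alpha>s rs) S (embed A))"
    by (rule adequacy[where S = S, OF w conjunct1[OF S]])
  then show ?thesis
    unfolding eS bar_def embed_def S_def .
qed

end
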